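(* Fix $p\in(0,1)$. Let $S_n$ be the number of triangles in the Erdős–Rényi random graph $G(n,p)$, let $\sigma_n=\sqrt{\operatorname{Var}[S_n]}$, and let $R_n=\frac{S_n-p^3\binom{n}{3}}{\sigma_n}$. For $x\in\mathbb{L}_n=\left\{\frac{k-p^3\binom n3}{\sigma_n}:k\in\mathbb{Z}\right\}$ let $p_n(x)=\Pr(R_n=x)$, and for real $x$ let $\mathcal N(x)=\frac{1}{\sqrt{2\pi}}e^{-x^2/2}$. Then $$\sup_{x\in\mathbb{L}_n}\left|\sigma_n p_n(x)-\mathcal N(x)\right|\to 0\quad\text{as } n\to\infty.$$ Equivalently, for all $k\in\mathbb Z$, $$\Pr[S_n=k]=\frac{1}{\sigma_n}\mathcal N\!\left(\frac{k-p^3\binom n3}{\sigma_n}\right)+o\!\left(\frac1{n^2}\right),$$ where the $o(1/n^2)$ term is uniform in $k$.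
   Context: $G(n,p)$ is the random graph on vertex set $\{1,\dots,n\}$ in which each of the $\binom n2$ possible edges is included independently with probability $p$. It is known that $\sigma_n^2=\Theta(n^4)$ for fixed $p\in(0,1)$. *)

theory Defs
  imports "HOL-Probability.Probability" "HOL-Library.Landau_Symbols"
begin

text \<open>A graph on the vertex set \<open>{1..n}\<close> is represented by its set of edges, an edge being a
  two-element subset of \<open>{1..n}\<close>.\<close>

definition vertex_pairs :: "nat \<Rightarrow> nat set set" where
  "vertex_pairs n = {e. e \<subseteq> {1..n} \<and> card e = 2}"

definition erdos_renyi :: "nat \<Rightarrow> real \<Rightarrow> nat set set pmf" where
  "erdos_renyi n p =
     map_pmf (\<lambda>f. {e \<in> vertex_pairs n. f e})
       (Pi_pmf (vertex_pairs n) False (\<lambda>_. bernoulli_pmf p))"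

definition triangle_count :: "nat \<Rightarrow> nat set set \<Rightarrow> nat" where
  "triangle_count n E =
     card {T. T \<subseteq> {1..n} \<and> card T = 3 \<and> (\<forall>e. e \<subseteq> T \<and> card e = 2 \<longrightarrow> e \<in> E)}"

definition triangle_sd :: "nat \<Rightarrow> real \<Rightarrow> real" where
  "triangle_sd n p =
     sqrt (measure_pmf.variance (erdos_renyi n p) (\<lambda>E. real (triangle_count n E)))"

text \<open>For \<open>n < 3\<close> the standard deviation is \<open>0\<close> and the quotients below are \<open>0\<close> by the
  convention \<open>x / 0 = 0\<close>; this does not affect statements about \<open>n \<rightarrow> \<infinity>\<close>.\<close>

definition standardize :: "nat \<Rightarrow> real \<Rightarrow> real \<Rightarrow> real" where
  "standardize n p s = (s - p ^ 3 * real (n choose 3)) / triangle_sd n p"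

definition triangle_lattice :: "nat \<Rightarrow> real \<Rightarrow> real set" where
  "triangle_lattice n p = range (\<lambda>k::int. standardize n p (of_int k))"

definition standardized_prob :: "nat \<Rightarrow> real \<Rightarrow> real \<Rightarrow> real" where
  "standardized_prob n p x =
     measure_pmf.prob (erdos_renyi n p)
       {E. standardize n p (real (triangle_count n E)) = x}"

text \<open>The supremum of \<open>\<bar>\<sigma>\<^sub>n p\<^sub>n(x) - \<N>(x)\<bar>\<close> over the lattice is a supremum of a bounded set, so the
  conditionally complete \<open>SUP\<close> on \<^typ>\<open>real\<close> is the true one.\<close>

lemma bdd_above_local_deviation:
  "bdd_above ((\<lambda>x. \<bar>triangle_sd n p * standardized_prob n p x - std_normal_density x\<bar>) ` A)"
proof (rule bdd_aboveI2)
  fix x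
  have "\<bar>triangle_sd n p * standardized_prob n p x\<bar> \<le> \<bar>triangle_sd n p\<bar>"
    unfolding abs_mult standardized_prob_def
    by (simp add: mult_left_le)
  moreover have "\<bar>std_normal_density x\<bar> \<le> 1 / sqrt (2 * pi)"
    by (simp add: std_normal_density_def divide_simps)
  ultimately show "\<bar>triangle_sd n p * standardized_prob n p x - std_normal_density x\<bar>
      \<le> \<bar>triangle_sd n p\<bar> + 1 / sqrt (2 * pi)"
    by linarith
qed

end

theory Submission
  imports Defs "HOL-Real_Asymp.Real_Asymp"
begin

text \<open>
  Write \<open>S\<close> for the triangle count, \<open>\<mu>\<close> and \<open>\<sigma>\<close> for its mean and standard deviation, and
  \<open>\<psi>(t) = E exp(\<i>tS)\<close>. By Fourier inversion the local error at any integer is at most the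
  integral of \<open>\<bar>\<psi>(t) exp(-\<i>t\<mu>) - exp(-\<sigma>\<^sup>2t\<^sup>2/2)\<bar>\<close> over \<open>[-\<pi>, \<pi>]\<close> plus a Gaussian tail, and this has to
  be \<open>o(n powr -2)\<close>. Three arguments cover the range of \<open>t\<close>.

  \<^item> For \<open>\<bar>t\<bar> \<le> n powr -1.76\<close>, replace \<open>S - \<mu>\<close> by its projection onto linear functions of the edge
    indicators. The remainder is a sum of pairwise orthogonal terms, one per triangle, so its
    \<open>L\<^sup>2\<close> norm is \<open>O(n powr 1.5)\<close>, while the linear part is a sum of independent variables.

  \<^item> For \<open>n powr -1.76 \<le> \<bar>t\<bar> \<le> n powr -1.49\<close>, fix a block of \<open>D\<close> vertices and condition on all edges not inside the
    block. Then \<open>S\<close> is linear in the block edges, with codegrees of order \<open>n\<close> as coefficients, up to the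
    triangle count of the block, whose nonlinear part has size \<open>O(D powr 1.5)\<close>. This gives
    \<open>\<bar>\<psi>(t)\<bar> \<le> O(\<bar>t\<bar>D powr 1.5) + exp(-c t\<^sup>2D\<^sup>2n\<^sup>2)\<close>.

  \<^item> For \<open>n powr -1.49 \<le> \<bar>t\<bar> \<le> \<pi>\<close>, take disjoint vertex sets \<open>U\<close>, \<open>W\<close>, \<open>Z\<close> and use the Cauchy-Schwarz inequality
    to duplicate the edges between \<open>U\<close> and \<open>W\<close>. In the difference of the two triangle counts only
    triangles meeting all three sets involve an edge between \<open>W\<close> and \<open>Z\<close>, so it is linear
    in these edges and the coefficients are centred. Averaging gives
    \<open>\<bar>\<psi>(t)\<bar>\<^sup>2 \<le> exp(-c t\<^sup>2\<bar>U\<bar>\<bar>W\<bar>\<bar>Z\<bar>)\<close> as long as \<open>t\<^sup>2\<bar>W\<bar>\<bar>U\<bar>\<^sup>2\<close> and \<open>t\<^sup>2\<bar>Z\<bar>\<close> are bounded.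
\<close>

section \<open>Product Bernoulli expectations\<close>

text \<open>The mean over a random subset of \<open>A\<close> with independent inclusions. As a
  finite sum with values in any real vector space it serves real moments and complex characteristic
  functions alike, and Fubini becomes an exchange of finite sums.\<close>

definition bern_exp :: "real \<Rightarrow> 'a set \<Rightarrow> ('a set \<Rightarrow> 'b::real_vector) \<Rightarrow> 'b" where
  "bern_exp p A g = (\<Sum>X\<in>Pow A. (p ^ card X * (1 - p) ^ card (A - X)) *\<^sub>R g X)"

lemma bern_exp_empty [simp]: "bern_exp p {} g = g {}"
  by (simp add: bern_exp_def)

lemma bern_exp_cong:
  assumes "A = B" "\<And>X. X \<subseteq> B \<Longrightarrow> g X = h X"
  shows "bern_exp p A g = bern_exp p B h"
  unfolding bern_exp_def using assms by (auto intro!: sum.cong)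

lemma bern_exp_insert:
  assumes "finite A" "a \<notin> A"
  shows "bern_exp p (insert a A) g =
    (1 - p) *\<^sub>R bern_exp p A g + p *\<^sub>R bern_exp p A (\<lambda>X. g (insert a X))"
proof -
  let ?w = "\<lambda>B X. (p ^ card X * (1 - p) ^ card (B - X))"
  have 1: "(\<Sum>X\<in>Pow A. ?w (insert a A) X *\<^sub>R g X) = (1 - p) *\<^sub>R bern_exp p A g"
    unfolding bern_exp_def scaleR_sum_right
  proof (rule sum.cong[OF refl])
    fix X assume "X \<in> Pow A"
    then have "insert a A - X = insert a (A - X)" "a \<notin> A - X" "finite (A - X)"
      using assms by auto
    then have "card (insert a A - X) = Suc (card (A - X))" by simp
    then show "?w (insert a A) X *\<^sub>R g X = (1 - p) *\<^sub>R ?w A X *\<^sub>R g X"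
      by (simp add: algebra_simps)
  qed
  have "(\<Sum>X\<in>insert a ` Pow A. ?w (insert a A) X *\<^sub>R g X)
      = (\<Sum>X\<in>Pow A. ?w (insert a A) (insert a X) *\<^sub>R g (insert a X))"
    using assms by (subst sum.reindex) (auto simp: inj_on_def)
  also have "\<dots> = p *\<^sub>R bern_exp p A (\<lambda>X. g (insert a X))"
    unfolding bern_exp_def scaleR_sum_right
  proof (rule sum.cong[OF refl])
    fix X assume X: "X \<in> Pow A"
    then have "insert a A - insert a X = A - X" "a \<notin> X" "finite X"
      using assms finite_subset by auto
    then show "?w (insert a A) (insert a X) *\<^sub>R g (insert a X) = p *\<^sub>R ?w A X *\<^sub>R g (insert a X)"
      by (simp add: algebra_simps)
  qed
  finally have 2: "(\<Sum>X\<in>insert a ` Pow A. ?w (insert a A) X *\<^sub>R g X)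
    = p *\<^sub>R bern_exp p A (\<lambda>X. g (insert a X))" .
  have "Pow A \<inter> insert a ` Pow A = {}" using assms by auto
  then show ?thesis
    unfolding bern_exp_def[of p "insert a A"] Pow_insert using 1 2 assms
    by (subst sum.union_disjoint) auto
qed

lemma bern_exp_const [simp]: "finite A \<Longrightarrow> bern_exp p A (\<lambda>_. c) = c"
  by (induction A rule: finite_induct)
    (simp_all add: bern_exp_insert flip: scaleR_add_left)

lemma bern_exp_add: "bern_exp p A (\<lambda>X. g X + h X) = bern_exp p A g + bern_exp p A h"
  by (simp add: bern_exp_def sum.distrib scaleR_add_right)

lemma bern_exp_diff: "bern_exp p A (\<lambda>X. g X - h X) = bern_exp p A g - bern_exp p A h"
  by (simp add: bern_exp_def sum_subtractf scaleR_diff_right)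

lemma bern_exp_sum: "bern_exp p A (\<lambda>X. \<Sum>i\<in>I. g i X) = (\<Sum>i\<in>I. bern_exp p A (g i))"
  unfolding bern_exp_def scaleR_sum_right by (rule sum.swap)

lemma bern_exp_mult_left:
  fixes c :: "'b::real_algebra"
  shows "bern_exp p A (\<lambda>X. c * g X) = c * bern_exp p A g"
  by (simp add: bern_exp_def sum_distrib_left)

lemma bern_exp_mult_right:
  fixes c :: "'b::real_algebra"
  shows "bern_exp p A (\<lambda>X. g X * c) = bern_exp p A g * c"
  by (simp add: bern_exp_def sum_distrib_right)

lemma bern_exp_of_real:
  "bern_exp p A (\<lambda>X. of_real (g X) :: 'b::real_algebra_1) = of_real (bern_exp p A g)"
  by (simp add: bern_exp_def scaleR_conv_of_real)

lemma bern_exp_cnj: "bern_exp p A (\<lambda>X. cnj (g X)) = cnj (bern_exp p A g)"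
  by (simp add: bern_exp_def)

lemma bern_exp_swap:
  "bern_exp p A (\<lambda>X. bern_exp p B (\<lambda>Y. g X Y)) = bern_exp p B (\<lambda>Y. bern_exp p A (\<lambda>X. g X Y))"
  unfolding bern_exp_def scaleR_sum_right
  by (subst sum.swap) (simp add: mult.commute)

lemma bern_exp_union:
  assumes "finite A" "finite B" "A \<inter> B = {}"
  shows "bern_exp p (A \<union> B) g = bern_exp p A (\<lambda>X. bern_exp p B (\<lambda>Y. g (X \<union> Y)))"
  using assms
proof (induction A arbitrary: g rule: finite_induct)
  case (insert a A)
  then show ?case by (simp add: bern_exp_insert)
qed simp

lemma bern_exp_restrict:
  assumes "finite U" "A \<subseteq> U"
  shows "bern_exp p U (\<lambda>X. g (X \<inter> A)) = bern_exp p A g"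
proof -
  have fin: "finite A" "finite (U - A)" using assms finite_subset by auto
  have "bern_exp p U (\<lambda>X. g (X \<inter> A)) = bern_exp p (A \<union> (U - A)) (\<lambda>X. g (X \<inter> A))"
    using assms by (simp add: Un_absorb1)
  also have "\<dots> = bern_exp p A (\<lambda>X. bern_exp p (U - A) (\<lambda>Y. g ((X \<union> Y) \<inter> A)))"
    using fin by (intro bern_exp_union) auto
  also have "\<dots> = bern_exp p A (\<lambda>X. bern_exp p (U - A) (\<lambda>Y. g X))"
    by (intro bern_exp_cong refl arg_cong[where f=g]) auto
  finally show ?thesis using fin by simp
qed

lemma bern_exp_image:
  assumes "inj_on f A"
  shows "bern_exp p (f ` A) g = bern_exp p A (\<lambda>X. g (f ` X))"
proof -
  have "bern_exp p (f ` A) g = (\<Sum>X\<in>(`) f ` Pow A. (p ^ card X * (1 - p) ^ card (f ` A - X)) *\<^sub>R g X)"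
    by (simp add: bern_exp_def image_Pow_surj)
  also have "\<dots> = (\<Sum>X\<in>Pow A. (p ^ card (f ` X) * (1 - p) ^ card (f ` A - f ` X)) *\<^sub>R g (f ` X))"
    using assms by (subst sum.reindex) (auto intro: inj_on_image_Pow)
  also have "\<dots> = bern_exp p A (\<lambda>X. g (f ` X))"
    unfolding bern_exp_def
  proof (rule sum.cong[OF refl])
    fix X assume X: "X \<in> Pow A"
    then have "f ` A - f ` X = f ` (A - X)"
      using assms by (subst inj_on_image_set_diff[of f A A X]) auto
    then show "(p ^ card (f ` X) * (1 - p) ^ card (f ` A - f ` X)) *\<^sub>R g (f ` X) =
       (p ^ card X * (1 - p) ^ card (A - X)) *\<^sub>R g (f ` X)"
      using X assms by (simp add: card_image inj_on_subset)
  qed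
  finally show ?thesis .
qed

lemma bern_exp_prod:
  fixes h :: "'a \<Rightarrow> bool \<Rightarrow> 'b::{comm_ring_1,real_algebra_1}"
  assumes "finite A"
  shows "bern_exp p A (\<lambda>X. \<Prod>a\<in>A. h a (a \<in> X)) =
    (\<Prod>a\<in>A. (1 - p) *\<^sub>R h a False + p *\<^sub>R h a True)"
  using assms
proof (induction A rule: finite_induct)
  case (insert a A)
  have "bern_exp p A (\<lambda>X. \<Prod>b\<in>insert a A. h b (b \<in> X))
      = bern_exp p A (\<lambda>X. h a False * (\<Prod>b\<in>A. h b (b \<in> X)))"
  proof (intro bern_exp_cong refl)
    fix X assume "X \<subseteq> A"
    then have "a \<notin> X" using insert by auto
    then show "(\<Prod>b\<in>insert a A. h b (b \<in> X)) = h a False * (\<Prod>b\<in>A. h b (b \<in> X))"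
      using insert by simp
  qed
  moreover have "bern_exp p A (\<lambda>X. \<Prod>b\<in>insert a A. h b (b \<in> insert a X))
      = bern_exp p A (\<lambda>X. h a True * (\<Prod>b\<in>A. h b (b \<in> X)))"
  proof (intro bern_exp_cong refl)
    fix X
    have "(\<Prod>b\<in>A. h b (b \<in> insert a X)) = (\<Prod>b\<in>A. h b (b \<in> X))"
      using \<open>a \<notin> A\<close> by (intro prod.cong refl arg_cong2[where f=h]) auto
    then show "(\<Prod>b\<in>insert a A. h b (b \<in> insert a X)) = h a True * (\<Prod>b\<in>A. h b (b \<in> X))"
      using insert by simp
  qed
  ultimately show ?case
    using insert by (simp add: bern_exp_insert bern_exp_mult_left algebra_simps)
qed simp

text \<open>Independence of disjoint blocks of coordinates, peeled off one at a time. In later uses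
  the block \<open>A z\<close> collects the edges from one vertex \<open>z\<close> to a fixed vertex
  set.\<close>

lemma bern_exp_prod_groups:
  fixes g :: "'i \<Rightarrow> 'a set \<Rightarrow> real"
  assumes "finite Z" "\<And>z. z \<in> Z \<Longrightarrow> finite (A z)" "disjoint_family_on A Z"
  shows "bern_exp p (\<Union>z\<in>Z. A z) (\<lambda>X. \<Prod>z\<in>Z. g z (X \<inter> A z)) = (\<Prod>z\<in>Z. bern_exp p (A z) (g z))"
  using assms
proof (induction Z rule: finite_induct)
  case (insert y Z)
  have disj: "A y \<inter> (\<Union>z\<in>Z. A z) = {}"
    using insert.prems(2) insert.hyps(2) by (auto simp: disjoint_family_on_def)
  have "bern_exp p (\<Union>z\<in>insert y Z. A z) (\<lambda>X. \<Prod>z\<in>insert y Z. g z (X \<inter> A z))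
      = bern_exp p (A y) (\<lambda>X. bern_exp p (\<Union>z\<in>Z. A z) (\<lambda>Y. \<Prod>z\<in>insert y Z. g z ((X \<union> Y) \<inter> A z)))"
    unfolding UN_insert using insert disj by (intro bern_exp_union) auto
  also have "\<dots> = bern_exp p (A y) (\<lambda>X. bern_exp p (\<Union>z\<in>Z. A z) (\<lambda>Y. g y X * (\<Prod>z\<in>Z. g z (Y \<inter> A z))))"
  proof (intro bern_exp_cong refl)
    fix X Y assume XY: "X \<subseteq> A y" "Y \<subseteq> (\<Union>z\<in>Z. A z)"
    have "(X \<union> Y) \<inter> A y = X" using XY disj by blast
    moreover have "(X \<union> Y) \<inter> A z = Y \<inter> A z" if "z \<in> Z" for z
      using XY disj that by blast
    ultimately show "(\<Prod>z\<in>insert y Z. g z ((X \<union> Y) \<inter> A z)) = g y X * (\<Prod>z\<in>Z. g z (Y \<inter> A z))"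
      using insert.hyps by simp
  qed
  also have "\<dots> = bern_exp p (A y) (g y) * (\<Prod>z\<in>Z. bern_exp p (A z) (g z))"
    using insert.IH insert.prems
    by (simp add: bern_exp_mult_left bern_exp_mult_right disjoint_family_on_def)
  finally show ?case using insert.hyps by simp
qed simp

lemma bern_exp_subset_indicator:
  assumes "finite A" "C \<subseteq> A"
  shows "bern_exp p A (\<lambda>X. of_bool (C \<subseteq> X)) = (p ^ card C :: real)"
proof -
  have finC: "finite C" using assms finite_subset by blast
  have "bern_exp p A (\<lambda>X. of_bool (C \<subseteq> X) :: real) = bern_exp p A (\<lambda>X. of_bool (C \<subseteq> X \<inter> C))"
    by (intro bern_exp_cong) auto
  also have "\<dots> = bern_exp p C (\<lambda>X. of_bool (C \<subseteq> X))"
    using assms by (rule bern_exp_restrict)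
  also have "\<dots> = bern_exp p C (\<lambda>X. \<Prod>a\<in>C. of_bool (a \<in> X))"
    using finC by (intro bern_exp_cong) (auto simp: subset_iff)
  also have "\<dots> = p ^ card C"
    using finC by (subst bern_exp_prod) simp_all
  finally show ?thesis .
qed

lemma bern_exp_indicator:
  assumes "finite A" "a \<in> A"
  shows "bern_exp p A (\<lambda>X. of_bool (a \<in> X)) = (p :: real)"
  using bern_exp_subset_indicator[of A "{a}" p] assms by simp

text \<open>The two summands are the variance and the squared mean. Lower bounds keep only the
  variance, which does not see cancellation between coefficients of opposite sign.\<close>

lemma bern_exp_linear_square:
  fixes c :: "'a \<Rightarrow> real"
  assumes "finite A"
  shows "bern_exp p A (\<lambda>X. (\<Sum>a\<in>A. c a * of_bool (a \<in> X))\<^sup>2)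
    = p * (1 - p) * (\<Sum>a\<in>A. (c a)\<^sup>2) + p\<^sup>2 * (\<Sum>a\<in>A. c a)\<^sup>2"
  using assms
proof (induction A rule: finite_induct)
  case (insert a A)
  let ?s = "\<lambda>X. \<Sum>b\<in>A. c b * of_bool (b \<in> X) :: real"
  have mean: "bern_exp p A ?s = p * (\<Sum>b\<in>A. c b)"
    unfolding bern_exp_sum bern_exp_mult_left using insert.hyps
    by (simp add: bern_exp_indicator sum_distrib_left mult.commute)
  have "bern_exp p A (\<lambda>X. (\<Sum>b\<in>insert a A. c b * of_bool (b \<in> X))\<^sup>2) = bern_exp p A (\<lambda>X. (?s X)\<^sup>2)"
  proof (intro bern_exp_cong refl)
    fix X assume "X \<subseteq> A"
    then have "a \<notin> X" using insert.hyps by auto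
    then show "(\<Sum>b\<in>insert a A. c b * of_bool (b \<in> X))\<^sup>2 = (?s X)\<^sup>2"
      using insert.hyps by (simp del: sum_mult_of_bool_eq)
  qed
  moreover have "bern_exp p A (\<lambda>X. (\<Sum>b\<in>insert a A. c b * of_bool (b \<in> insert a X))\<^sup>2)
      = bern_exp p A (\<lambda>X. (c a)\<^sup>2 + (2 * c a) * ?s X + (?s X)\<^sup>2)"
  proof (intro bern_exp_cong refl)
    fix X
    have "(\<Sum>b\<in>A. c b * of_bool (b \<in> insert a X)) = ?s X"
      using insert.hyps by (intro sum.cong) auto
    then have "(\<Sum>b\<in>insert a A. c b * of_bool (b \<in> insert a X)) = c a + ?s X"
      using insert.hyps by simp
    then show "(\<Sum>b\<in>insert a A. c b * of_bool (b \<in> insert a X))\<^sup>2 = (c a)\<^sup>2 + (2 * c a) * ?s X + (?s X)\<^sup>2"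
      by (simp add: power2_sum)
  qed
  ultimately have "bern_exp p (insert a A) (\<lambda>X. (\<Sum>b\<in>insert a A. c b * of_bool (b \<in> X))\<^sup>2)
    = (1 - p) * bern_exp p A (\<lambda>X. (?s X)\<^sup>2) +
      p * ((c a)\<^sup>2 + (2 * c a) * (p * (\<Sum>b\<in>A. c b)) + bern_exp p A (\<lambda>X. (?s X)\<^sup>2))"
    by (simp only: bern_exp_insert[OF insert.hyps] bern_exp_add bern_exp_mult_left mean
        bern_exp_const[OF insert.hyps(1)] real_scaleR_def)
  also have "\<dots> = p * (1 - p) * (\<Sum>b\<in>insert a A. (c b)\<^sup>2) + p\<^sup>2 * (\<Sum>b\<in>insert a A. c b)\<^sup>2"
    using insert.hyps unfolding insert.IH by (simp add: power2_eq_square algebra_simps)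
  finally show ?case .
qed simp

text \<open>Fubini with the inner average over \<open>A\<close>: conditioning on the remaining
  coordinates \<open>Y\<close> already gives zero.\<close>

lemma bern_exp_eq_0_if_partial:
  assumes "finite U" "A \<subseteq> U" "\<And>Y. Y \<subseteq> U - A \<Longrightarrow> bern_exp p A (\<lambda>X. g (X \<union> Y)) = 0"
  shows "bern_exp p U g = 0"
proof -
  have fin: "finite A" "finite (U - A)" using assms finite_subset by auto
  have "bern_exp p U g = bern_exp p ((U - A) \<union> A) g"
    using assms by (simp add: Un_absorb2)
  also have "\<dots> = bern_exp p (U - A) (\<lambda>Y. bern_exp p A (\<lambda>X. g (Y \<union> X)))"
    using fin by (intro bern_exp_union) auto
  also have "\<dots> = bern_exp p (U - A) (\<lambda>Y. 0)"
    using assms(3) by (intro bern_exp_cong) (simp_all add: Un_commute)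
  finally show ?thesis using fin by simp
qed

section \<open>Monotonicity, Jensen and Cauchy-Schwarz for the average\<close>

context
  fixes p :: real
  assumes p: "0 < p" "p < 1"
begin

lemma bern_exp_mono:
  fixes g h :: "'a set \<Rightarrow> real"
  assumes "\<And>X. X \<subseteq> A \<Longrightarrow> g X \<le> h X"
  shows "bern_exp p A g \<le> bern_exp p A h"
  unfolding bern_exp_def using assms p by (auto intro!: sum_mono mult_left_mono)

lemma bern_exp_nonneg:
  fixes g :: "'a set \<Rightarrow> real"
  assumes "\<And>X. X \<subseteq> A \<Longrightarrow> 0 \<le> g X"
  shows "0 \<le> bern_exp p A g"
  unfolding bern_exp_def using assms p by (auto intro!: sum_nonneg mult_nonneg_nonneg)

lemma norm_bern_exp_le:
  fixes g :: "'a set \<Rightarrow> 'b::real_normed_vector"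
  shows "norm (bern_exp p A g) \<le> bern_exp p A (\<lambda>X. norm (g X))"
  unfolding bern_exp_def using p
  by (intro order.trans[OF norm_sum] sum_mono) simp

lemma bern_exp_square_le:
  fixes g :: "'a set \<Rightarrow> real"
  assumes "finite A"
  shows "(bern_exp p A g)\<^sup>2 \<le> bern_exp p A (\<lambda>X. (g X)\<^sup>2)"
proof -
  let ?m = "bern_exp p A g"
  have "0 \<le> bern_exp p A (\<lambda>X. (g X - ?m)\<^sup>2)"
    by (intro bern_exp_nonneg) simp
  also have "\<dots> = bern_exp p A (\<lambda>X. (g X)\<^sup>2 + ?m\<^sup>2 - (2 * ?m) * g X)"
    by (intro bern_exp_cong) (simp_all add: power2_diff)
  also have "\<dots> = bern_exp p A (\<lambda>X. (g X)\<^sup>2) - ?m\<^sup>2"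
    using assms by (simp add: bern_exp_diff bern_exp_add bern_exp_mult_left power2_eq_square)
  finally show ?thesis by simp
qed

lemma norm_bern_exp_square_le:
  fixes g :: "'a set \<Rightarrow> 'b::real_normed_vector"
  assumes "finite A"
  shows "(norm (bern_exp p A g))\<^sup>2 \<le> bern_exp p A (\<lambda>X. (norm (g X))\<^sup>2)"
  using power_mono[OF norm_bern_exp_le[of A g] norm_ge_zero, of 2] bern_exp_square_le[OF assms]
  by (rule order.trans)

text \<open>Cauchy-Schwarz in \<open>c\<close> and \<open>q\<close> leaves the squared modulus of
  the mean over \<open>r\<close>, which expands into two independent copies \<open>r\<close> and
  \<open>r'\<close>. Moving the mean over \<open>q\<close> inside, any factor of \<open>e\<close>
  independent of \<open>r\<close> and of modulus one cancels, as does the modulus of any factor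
  independent of \<open>q\<close>.\<close>

lemma bern_exp_decoupling:
  fixes e :: "'a set \<Rightarrow> 'b set \<Rightarrow> 'c set \<Rightarrow> complex"
  assumes "finite C" "finite Q" "finite R"
  shows "(norm (bern_exp p C (\<lambda>c. bern_exp p Q (\<lambda>q. bern_exp p R (e c q)))))\<^sup>2
    \<le> bern_exp p C (\<lambda>c. bern_exp p R (\<lambda>r. bern_exp p R (\<lambda>r'.
        norm (bern_exp p Q (\<lambda>q. e c q r * cnj (e c q r'))))))"
proof -
  have "(norm (bern_exp p C (\<lambda>c. bern_exp p Q (\<lambda>q. bern_exp p R (e c q)))))\<^sup>2
    \<le> bern_exp p C (\<lambda>c. (norm (bern_exp p Q (\<lambda>q. bern_exp p R (e c q))))\<^sup>2)"
    using assms by (intro norm_bern_exp_square_le)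
  also have "\<dots> \<le> bern_exp p C (\<lambda>c. bern_exp p Q (\<lambda>q. (norm (bern_exp p R (e c q)))\<^sup>2))"
    using assms by (intro bern_exp_mono norm_bern_exp_square_le)
  \<comment> \<open>The bound is a nonnegative real; embedding it in the complex numbers allows the
    expansion of a squared modulus as a number times its conjugate.\<close>
  also have "\<dots> = norm (complex_of_real \<dots>)"
    by (simp add: bern_exp_nonneg)
  also have "complex_of_real (bern_exp p C (\<lambda>c. bern_exp p Q (\<lambda>q. (norm (bern_exp p R (e c q)))\<^sup>2)))
    = bern_exp p C (\<lambda>c. bern_exp p Q (\<lambda>q. bern_exp p R (\<lambda>r. bern_exp p R (\<lambda>r'. e c q r * cnj (e c q r')))))"
    by (simp add: bern_exp_mult_left bern_exp_mult_right bern_exp_cnj complex_norm_square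
        del: of_real_power flip: bern_exp_of_real)
  also have "\<dots> = bern_exp p C (\<lambda>c. bern_exp p R (\<lambda>r. bern_exp p R (\<lambda>r'. bern_exp p Q (\<lambda>q. e c q r * cnj (e c q r')))))"
    by (simp add: bern_exp_swap[of p Q R])
  also have "norm \<dots> \<le> bern_exp p C (\<lambda>c. bern_exp p R (\<lambda>r. bern_exp p R (\<lambda>r'.
        norm (bern_exp p Q (\<lambda>q. e c q r * cnj (e c q r'))))))"
    by (intro order.trans[OF norm_bern_exp_le] bern_exp_mono order.refl)
  finally show ?thesis .
qed

end

section \<open>Triangle counts and their linear part\<close>

definition pairs :: "'a set \<Rightarrow> 'a set set" where
  "pairs V = {e. e \<subseteq> V \<and> card e = 2}"

definition triples :: "'a set \<Rightarrow> 'a set set" where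
  "triples V = {T. T \<subseteq> V \<and> card T = 3}"

definition tri_count :: "'a set \<Rightarrow> 'a set set \<Rightarrow> nat" where
  "tri_count V X = card {T \<in> triples V. pairs T \<subseteq> X}"

lemma finite_pairs [simp]: "finite V \<Longrightarrow> finite (pairs V)"
  unfolding pairs_def by (rule finite_subset[of _ "Pow V"]) auto

lemma finite_triples [simp]: "finite V \<Longrightarrow> finite (triples V)"
  unfolding triples_def by (rule finite_subset[of _ "Pow V"]) auto

lemma card_pairs: "finite V \<Longrightarrow> card (pairs V) = card V choose 2"
  unfolding pairs_def by (rule n_subsets)

lemma card_triples: "finite V \<Longrightarrow> card (triples V) = card V choose 3"
  unfolding triples_def by (rule n_subsets)

lemma pairs_mono: "T \<subseteq> V \<Longrightarrow> pairs T \<subseteq> pairs V"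
  by (auto simp: pairs_def)

lemma triples_finite: "T \<in> triples V \<Longrightarrow> finite T"
  by (auto simp: triples_def intro: card_ge_0_finite)

lemma card_pairs_triple: "T \<in> triples V \<Longrightarrow> card (pairs T) = 3"
  using card_pairs[OF triples_finite[of T V]] by (auto simp: triples_def eval_nat_numeral)

lemma real_tri_count:
  assumes "finite V"
  shows "real (tri_count V X) = (\<Sum>T\<in>triples V. of_bool (pairs T \<subseteq> X))"
  using assms by (simp add: tri_count_def Int_def)

text \<open>Two different common pairs would together cover at least three common vertices, forcing
  the triples to coincide.\<close>

lemma pairs_triple_Int:
  assumes "T \<in> triples V" "T' \<in> triples V" "T \<noteq> T'" "e \<in> pairs T \<inter> pairs T'" "f \<in> pairs T \<inter> pairs T'"
  shows "e = f"
proof (rule ccontr)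
  assume "e \<noteq> f"
  have fin: "finite T" "finite T'" using assms triples_finite by auto
  have c: "card e = 2" "card f = 2" "e \<subseteq> T \<inter> T'" "f \<subseteq> T \<inter> T'" "card T = 3" "card T' = 3"
    using assms by (auto simp: pairs_def triples_def)
  then have "e \<subset> e \<union> f" using \<open>e \<noteq> f\<close>
    by (metis Un_upper1 card_subset_eq fin(1) finite_Int finite_subset psubsetI sup.orderI sup_commute)
  then have "card e < card (e \<union> f)"
    by (intro psubset_card_mono) (use c fin finite_subset in \<open>auto\<close>)
  also have "card (e \<union> f) \<le> card (T \<inter> T')"
    using c fin by (intro card_mono) auto
  finally have "3 \<le> card (T \<inter> T')" using c by simp
  then have "T \<inter> T' = T" "T \<inter> T' = T'"
    using c fin card_mono[of T "T \<inter> T'"] card_mono[of T' "T \<inter> T'"]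
    by (simp_all add: card_subset_eq)
  then show False using assms by auto
qed

lemma card_triples_containing:
  assumes "finite V" "e \<in> pairs V"
  shows "card {T \<in> triples V. e \<subseteq> T} = card V - 2"
proof -
  have e: "e \<subseteq> V" "card e = 2" "finite e"
    using assms finite_subset by (auto simp: pairs_def)
  have "{T \<in> triples V. e \<subseteq> T} = (\<lambda>v. insert v e) ` (V - e)"
  proof (intro equalityI subsetI)
    fix T assume T: "T \<in> {T \<in> triples V. e \<subseteq> T}"
    then have "card (T - e) = 1" using e by (simp add: card_Diff_subset triples_def)
    then obtain v where "T - e = {v}" by (rule card_1_singletonE)
    then have "T = insert v e" "v \<in> V - e" using T by (auto simp: triples_def)
    then show "T \<in> (\<lambda>v. insert v e) ` (V - e)" by auto
  qed (use e in \<open>auto simp: triples_def\<close>)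
  moreover have "inj_on (\<lambda>v. insert v e) (V - e)" by (auto simp: inj_on_def)
  ultimately show ?thesis using e by (simp add: card_image card_Diff_subset)
qed

lemma sum_triples_pairs:
  fixes f :: "'a set \<Rightarrow> real"
  assumes "finite V"
  shows "(\<Sum>T\<in>triples V. \<Sum>e\<in>pairs T. f e) = real (card V - 2) * (\<Sum>e\<in>pairs V. f e)"
proof -
  have "pairs T = {e \<in> pairs V. e \<subseteq> T}" if "T \<in> triples V" for T
    using that by (auto simp: pairs_def triples_def)
  then have "(\<Sum>T\<in>triples V. \<Sum>e\<in>pairs T. f e) = (\<Sum>T\<in>triples V. \<Sum>e | e \<in> pairs V \<and> e \<subseteq> T. f e)"
    by (intro sum.cong) auto
  also have "\<dots> = (\<Sum>e\<in>pairs V. \<Sum>T | T \<in> triples V \<and> e \<subseteq> T. f e)"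
    using assms by (intro sum.swap_restrict) auto
  also have "\<dots> = (\<Sum>e\<in>pairs V. real (card V - 2) * f e)"
    using assms card_triples_containing by (intro sum.cong) auto
  finally show ?thesis by (simp add: sum_distrib_left)
qed

text \<open>The subtracted affine function is the projection of the triangle indicator; averaging the
  difference over any two of the three edges gives zero, hence the orthogonality below.\<close>

definition triple_rem :: "real \<Rightarrow> 'a set \<Rightarrow> 'a set set \<Rightarrow> real" where
  "triple_rem p T X = of_bool (pairs T \<subseteq> X) - p ^ 3 - p\<^sup>2 * (\<Sum>e\<in>pairs T. of_bool (e \<in> X) - p)"

definition tri_rem :: "real \<Rightarrow> 'a set \<Rightarrow> 'a set set \<Rightarrow> real" where
  "tri_rem p V X = (\<Sum>T\<in>triples V. triple_rem p T X)"

text \<open>Summed over triples, the linear parts regroup by edge, each edge lying in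
  \<open>card V - 2\<close> triples. The truncated subtraction does no harm, since there are no
  pairs when \<open>card V < 2\<close>.\<close>

lemma tri_count_decomp:
  assumes "finite V"
  shows "real (tri_count V X) = p ^ 3 * real (card V choose 3) +
    real (card V - 2) * p\<^sup>2 * (\<Sum>e\<in>pairs V. of_bool (e \<in> X) - p) + tri_rem p V X"
proof -
  have "tri_rem p V X = real (tri_count V X) - p ^ 3 * real (card V choose 3)
      - p\<^sup>2 * (\<Sum>T\<in>triples V. \<Sum>e\<in>pairs T. of_bool (e \<in> X) - p)"
  proof -
    have "tri_rem p V X = (\<Sum>T\<in>triples V. of_bool (pairs T \<subseteq> X)) - (\<Sum>T\<in>triples V. p ^ 3)
        - (\<Sum>T\<in>triples V. p\<^sup>2 * (\<Sum>e\<in>pairs T. of_bool (e \<in> X) - p))"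
      by (simp only: tri_rem_def triple_rem_def sum_subtractf)
    then show ?thesis using assms
      by (simp only: real_tri_count sum_distrib_left[symmetric] sum_constant card_triples mult.commute)
  qed
  then show ?thesis unfolding sum_triples_pairs[OF assms] by simp
qed

text \<open>With \<open>e0\<close> frozen, averaging over the other two edges turns the triangle
  indicator into p^2 times the indicator of \<open>e0\<close> and kills their centred terms. The
  constant and the centred term of \<open>e0\<close> cancel exactly what is left.\<close>

lemma triple_rem_partial:
  assumes "T \<in> triples V" "e0 \<in> pairs T" "Y \<inter> (pairs T - {e0}) = {}"
  shows "bern_exp p (pairs T - {e0}) (\<lambda>X. triple_rem p T (X \<union> Y)) = 0"
proof -
  have "card (pairs T - {e0}) = 2"
    using card_pairs_triple[OF assms(1)] assms(2) by simp
  then obtain e1 e2 where e: "pairs T - {e0} = {e1, e2}" "e1 \<noteq> e2"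
    by (auto simp: card_2_iff)
  then have P: "pairs T = {e0, e1, e2}" "e0 \<noteq> e1" "e0 \<noteq> e2" using assms(2) by auto
  have Y: "e1 \<notin> Y" "e2 \<notin> Y" using assms(3) e by auto
  show ?thesis unfolding e(1) triple_rem_def P(1)
    using e(2) P(2,3) Y
    by (cases "e0 \<in> Y") (simp_all add: bern_exp_insert algebra_simps power2_eq_square power3_eq_cube)
qed

text \<open>The hypothesis on \<open>h\<close> says that it ignores two edges of \<open>T\<close>;
  averaging over these first leaves \<open>h\<close> as a constant factor in front of
  \<open>triple_rem_partial\<close>.\<close>

lemma triple_rem_orthogonal:
  assumes "finite V" "T \<in> triples V" "e0 \<in> pairs T"
    and h: "\<And>X Y. X \<subseteq> pairs T - {e0} \<Longrightarrow> Y \<inter> (pairs T - {e0}) = {} \<Longrightarrow> h (X \<union> Y) = h Y"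
  shows "bern_exp p (pairs V) (\<lambda>X. triple_rem p T X * h X) = 0"
proof (rule bern_exp_eq_0_if_partial)
  show "pairs T - {e0} \<subseteq> pairs V" using assms pairs_mono[of T V] by (auto simp: triples_def)
  fix Y assume "Y \<subseteq> pairs V - (pairs T - {e0})"
  then have Y: "Y \<inter> (pairs T - {e0}) = {}" by auto
  have "bern_exp p (pairs T - {e0}) (\<lambda>X. triple_rem p T (X \<union> Y) * h (X \<union> Y))
      = bern_exp p (pairs T - {e0}) (\<lambda>X. triple_rem p T (X \<union> Y) * h Y)"
    using h Y by (intro bern_exp_cong) auto
  then show "bern_exp p (pairs T - {e0}) (\<lambda>X. triple_rem p T (X \<union> Y) * h (X \<union> Y)) = 0"
    using triple_rem_partial[OF assms(2,3) Y, of p] by (simp add: bern_exp_mult_right)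
qed (use assms in simp)

lemma triple_rem_depends:
  "pairs T' \<inter> X = {} \<Longrightarrow> triple_rem p T' (X \<union> Y) = triple_rem p T' Y"
proof -
  assume a: "pairs T' \<inter> X = {}"
  then have "pairs T' \<subseteq> X \<union> Y \<longleftrightarrow> pairs T' \<subseteq> Y" by auto
  moreover have "(\<Sum>e\<in>pairs T'. of_bool (e \<in> X \<union> Y) - p) = (\<Sum>e\<in>pairs T'. of_bool (e \<in> Y) - p)"
    using a by (intro sum.cong) auto
  ultimately show ?thesis by (simp add: triple_rem_def)
qed

lemma triple_has_pair:
  assumes "T \<in> triples V"
  obtains e where "e \<in> pairs T"
  using card_pairs_triple[OF assms] by fastforce

text \<open>Distinct triples share at most one edge. Taking it as \<open>e0\<close>, the remainder
  of \<open>T'\<close> does not depend on the other two edges of \<open>T\<close>.\<close>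

lemma triple_rem_orthogonal_triple:
  assumes "finite V" "T \<in> triples V" "T' \<in> triples V" "T \<noteq> T'"
  shows "bern_exp p (pairs V) (\<lambda>X. triple_rem p T X * triple_rem p T' X) = 0"
proof -
  obtain e0 where e0: "e0 \<in> pairs T" "pairs T \<inter> pairs T' \<subseteq> {e0}"
  proof (cases "pairs T \<inter> pairs T' = {}")
    case True
    then show ?thesis using triple_has_pair[OF assms(2)] that by blast
  next
    case False
    then show ?thesis using pairs_triple_Int[OF assms(2-4)] that by blast
  qed
  show ?thesis
    using assms(1,2) e0(1)
  proof (rule triple_rem_orthogonal)
    fix X Y assume "X \<subseteq> pairs T - {e0}"
    then have "pairs T' \<inter> X = {}" using e0 by auto
    then show "triple_rem p T' (X \<union> Y) = triple_rem p T' Y" by (rule triple_rem_depends)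
  qed
qed

lemma triple_rem_orthogonal_edge:
  assumes "finite V" "T \<in> triples V"
  shows "bern_exp p (pairs V) (\<lambda>X. triple_rem p T X * (of_bool (e \<in> X) - p)) = 0"
proof -
  obtain e0 where "e0 \<in> pairs T" "e \<in> pairs T \<longrightarrow> e = e0"
    using triple_has_pair[OF assms(2)] by blast
  with assms show ?thesis
    by (intro triple_rem_orthogonal[of V T e0]) auto
qed

lemma triple_rem_mean:
  assumes "finite V" "T \<in> triples V"
  shows "bern_exp p (pairs V) (triple_rem p T) = 0"
proof -
  obtain e0 where "e0 \<in> pairs T"
    using triple_has_pair[OF assms(2)] by blast
  with assms show ?thesis
    using triple_rem_orthogonal[of V T e0 "\<lambda>_. 1" p] by simp
qed

lemma bern_exp_centered_sum:
  assumes "finite A"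
  shows "bern_exp p A (\<lambda>X. \<Sum>e\<in>A. of_bool (e \<in> X) - p) = 0"
  using assms unfolding bern_exp_sum
  by (intro sum.neutral) (simp add: bern_exp_diff bern_exp_indicator)

lemma bern_exp_centered_square:
  assumes "finite A"
  shows "bern_exp p A (\<lambda>X. (\<Sum>e\<in>A. of_bool (e \<in> X) - p)\<^sup>2) = p * (1 - p) * real (card A)"
proof -
  let ?s = "\<lambda>X. \<Sum>e\<in>A. 1 * of_bool (e \<in> X) :: real"
  let ?c = "\<lambda>X. \<Sum>e\<in>A. of_bool (e \<in> X) - p"
  have "bern_exp p A (\<lambda>X. (?s X)\<^sup>2) = bern_exp p A (\<lambda>X. (?c X)\<^sup>2 + 2 * p * card A * ?c X + (p * card A)\<^sup>2)"
    by (intro bern_exp_cong refl)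
      (simp add: sum_subtractf power2_eq_square algebra_simps)
  also have "\<dots> = bern_exp p A (\<lambda>X. (?c X)\<^sup>2) + (p * card A)\<^sup>2"
    using assms by (simp add: bern_exp_add bern_exp_mult_left bern_exp_centered_sum)
  finally have "bern_exp p A (\<lambda>X. (?c X)\<^sup>2) + (p * card A)\<^sup>2 = bern_exp p A (\<lambda>X. (?s X)\<^sup>2)" by simp
  also have "\<dots> = p * (1 - p) * card A + p\<^sup>2 * (real (card A))\<^sup>2"
    using bern_exp_linear_square[OF assms, of p "\<lambda>_. 1"] by simp
  finally show ?thesis by (simp add: power_mult_distrib)
qed

section \<open>Mean, variance and size of the nonlinear remainder\<close>

definition tri_mean :: "real \<Rightarrow> 'a set \<Rightarrow> real" where
  "tri_mean p V = p ^ 3 * real (card V choose 3)"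

definition tri_var :: "real \<Rightarrow> 'a set \<Rightarrow> real" where
  "tri_var p V = bern_exp p (pairs V) (\<lambda>X. (real (tri_count V X) - tri_mean p V)\<^sup>2)"

lemma tri_count_mean:
  assumes "finite V"
  shows "bern_exp p (pairs V) (\<lambda>X. real (tri_count V X)) = tri_mean p V"
proof -
  have "bern_exp p (pairs V) (tri_rem p V) = 0"
    unfolding tri_rem_def bern_exp_sum using assms by (intro sum.neutral) (simp add: triple_rem_mean)
  then show ?thesis
    unfolding tri_count_decomp[OF assms, where p = p] bern_exp_add bern_exp_mult_left
    using assms
    by (simp only: finite_pairs bern_exp_centered_sum bern_exp_const mult_zero_right add_0_right tri_mean_def)
qed

text \<open>Pythagoras: the remainder is orthogonal to every centred edge indicator, so the variance
  is that of the linear part plus the second moment of \<open>tri_rem\<close>.\<close>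

lemma tri_count_variance:
  assumes "finite V"
  shows "tri_var p V = (real (card V - 2) * p\<^sup>2)\<^sup>2 * (p * (1 - p) * real (card V choose 2))
      + bern_exp p (pairs V) (\<lambda>X. (tri_rem p V X)\<^sup>2)"
proof -
  let ?k = "real (card V - 2) * p\<^sup>2"
  let ?c = "\<lambda>X. \<Sum>e\<in>pairs V. of_bool (e \<in> X) - p"
  have cross: "bern_exp p (pairs V) (\<lambda>X. tri_rem p V X * ?c X) = 0"
    unfolding tri_rem_def sum_product bern_exp_sum
    using assms by (intro sum.neutral ballI triple_rem_orthogonal_edge)
  have "tri_var p V = bern_exp p (pairs V) (\<lambda>X. ?k\<^sup>2 * (?c X)\<^sup>2 + (2 * ?k) * (tri_rem p V X * ?c X) + (tri_rem p V X)\<^sup>2)"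
    unfolding tri_var_def tri_mean_def using assms
    by (intro bern_exp_cong refl) (simp add: tri_count_decomp[where p = p] power2_eq_square algebra_simps)
  also have "\<dots> = ?k\<^sup>2 * (p * (1 - p) * real (card V choose 2)) + bern_exp p (pairs V) (\<lambda>X. (tri_rem p V X)\<^sup>2)"
    unfolding bern_exp_add bern_exp_mult_left cross
    using assms by (simp add: bern_exp_centered_square card_pairs)
  finally show ?thesis .
qed

context
  fixes p :: real
  assumes p: "0 < p" "p < 1"
begin

lemma abs_triple_rem_le:
  assumes "T \<in> triples V"
  shows "\<bar>triple_rem p T X\<bar> \<le> 4"
proof -
  have p3: "0 \<le> p ^ 3" "p ^ 3 \<le> 1" "0 \<le> p\<^sup>2" "p\<^sup>2 \<le> 1" using p by (auto intro: power_le_one)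
  have "\<bar>\<Sum>e\<in>pairs T. of_bool (e \<in> X) - p\<bar> \<le> (\<Sum>e\<in>pairs T. 1)"
    using p by (intro order.trans[OF sum_abs] sum_mono) (auto simp: of_bool_def)
  then have "\<bar>\<Sum>e\<in>pairs T. of_bool (e \<in> X) - p\<bar> \<le> 3"
    using card_pairs_triple[OF assms] by simp
  then have "p\<^sup>2 * \<bar>\<Sum>e\<in>pairs T. of_bool (e \<in> X) - p\<bar> \<le> 1 * 3"
    using p3 by (intro mult_mono) auto
  then have 1: "\<bar>p\<^sup>2 * (\<Sum>e\<in>pairs T. of_bool (e \<in> X) - p)\<bar> \<le> 3" using p3 by (simp add: abs_mult)
  have 2: "\<bar>of_bool (pairs T \<subseteq> X) - p ^ 3\<bar> \<le> 1" using p3 by (auto simp: of_bool_def)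
  show ?thesis unfolding triple_rem_def using 1 2 by linarith
qed

text \<open>By orthogonality only the diagonal of the double sum over triples survives. This gives
  order \<open>card V ^ 3\<close>, compared with order \<open>card V ^ 4\<close> for the variance of
  the linear part.\<close>

lemma tri_rem_second_moment:
  assumes "finite V"
  shows "bern_exp p (pairs V) (\<lambda>X. (tri_rem p V X)\<^sup>2) \<le> 16 * real (card V) ^ 3"
proof -
  have "bern_exp p (pairs V) (\<lambda>X. (tri_rem p V X)\<^sup>2)
      = (\<Sum>T\<in>triples V. \<Sum>T'\<in>triples V. bern_exp p (pairs V) (\<lambda>X. triple_rem p T X * triple_rem p T' X))"
    unfolding tri_rem_def power2_eq_square sum_product bern_exp_sum ..
  also have "\<dots> = (\<Sum>T\<in>triples V. \<Sum>T'\<in>triples V. if T = T' then bern_exp p (pairs V) (\<lambda>X. (triple_rem p T X)\<^sup>2) else 0)"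
    using assms by (intro sum.cong refl) (auto simp: triple_rem_orthogonal_triple power2_eq_square)
  also have "\<dots> = (\<Sum>T\<in>triples V. bern_exp p (pairs V) (\<lambda>X. (triple_rem p T X)\<^sup>2))"
    using assms by simp
  also have "\<dots> \<le> (\<Sum>T\<in>triples V. 16)"
  proof (intro sum_mono)
    fix T assume T: "T \<in> triples V"
    have "bern_exp p (pairs V) (\<lambda>X. (triple_rem p T X)\<^sup>2) \<le> bern_exp p (pairs V) (\<lambda>X. 4\<^sup>2)"
      using power_mono[OF abs_triple_rem_le[OF T] abs_ge_zero, where n = 2] by (intro bern_exp_mono p) simp
    then show "bern_exp p (pairs V) (\<lambda>X. (triple_rem p T X)\<^sup>2) \<le> 16" using assms by simp
  qed
  also have "\<dots> \<le> 16 * real (card V) ^ 3"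
  proof -
    have "card V choose 3 \<le> card V ^ 3"
      by (cases "3 \<le> card V") (auto intro: binomial_le_pow simp: binomial_eq_0)
    then have "real (card V choose 3) \<le> real (card V ^ 3)" by (rule of_nat_mono)
    then show ?thesis using assms by (simp add: card_triples)
  qed
  finally show ?thesis .
qed

lemma tri_rem_abs_moment:
  assumes "finite V"
  shows "bern_exp p (pairs V) (\<lambda>X. \<bar>tri_rem p V X\<bar>) \<le> 4 * sqrt (real (card V) ^ 3)"
proof -
  have "(bern_exp p (pairs V) (\<lambda>X. \<bar>tri_rem p V X\<bar>))\<^sup>2 \<le> 16 * real (card V) ^ 3"
    using bern_exp_square_le[OF p, of "pairs V" "\<lambda>X. \<bar>tri_rem p V X\<bar>"] tri_rem_second_moment[OF assms] assms
    by simp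
  then have "bern_exp p (pairs V) (\<lambda>X. \<bar>tri_rem p V X\<bar>) \<le> sqrt (16 * real (card V) ^ 3)"
    by (rule real_le_rsqrt)
  also have "\<dots> = 4 * sqrt (real (card V) ^ 3)"
    by (simp add: real_sqrt_mult)
  finally show ?thesis .
qed

end

section \<open>Conditioning on the edges outside a vertex block\<close>

lemma norm_iexp_quadratic_error: "norm (iexp x - (1 + \<i> * x - x\<^sup>2 / 2)) \<le> \<bar>x\<bar> ^ 3 / 6"
proof -
  have "{..2} = {0, 1, 2 :: nat}" by auto
  then have "(\<Sum>k\<le>2. (\<i> * x) ^ k / fact k) = 1 + \<i> * x - x\<^sup>2 / 2"
    by (simp add: power_mult_distrib)
  then show ?thesis using iexp_approx1[of x 2] by (simp add: eval_nat_numeral)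
qed

text \<open>For absolute values up to 2 the Taylor estimate even gives x^2/6. Beyond 2 the cosine is
  negative, and 1 exceeds x^2/16 because pi < 4.\<close>

lemma one_minus_cos_ge:
  assumes "\<bar>x\<bar> \<le> pi"
  shows "x\<^sup>2 / 16 \<le> 1 - cos x"
proof (cases "\<bar>x\<bar> \<le> 2")
  case True
  have "cmod (iexp x - (1 + \<i> * x - x\<^sup>2 / 2)) \<le> \<bar>x\<bar> ^ 3 / 6"
    by (rule norm_iexp_quadratic_error)
  then have "\<bar>Re (iexp x - (1 + \<i> * x - x\<^sup>2 / 2))\<bar> \<le> \<bar>x\<bar> ^ 3 / 6"
    using abs_Re_le_cmod order.trans by metis
  moreover have "Re (iexp x - (1 + \<i> * x - x\<^sup>2 / 2)) = cos x - 1 + x\<^sup>2 / 2"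
    by (simp add: Re_exp)
  ultimately have "cos x - 1 + x\<^sup>2 / 2 \<le> \<bar>x\<bar> ^ 3 / 6" by linarith
  also have "\<dots> \<le> 2 * x\<^sup>2 / 6"
    using mult_right_mono[OF True, of "x\<^sup>2"] by (simp add: power3_eq_cube power2_eq_square)
  finally show ?thesis using cos_le_one[of x] by linarith
next
  case False
  have "cos \<bar>x\<bar> \<le> cos 2"
    using assms False by (intro cos_monotone_0_pi_le) auto
  then have "cos x < 0" using cos_two_less_zero unfolding cos_abs_real by linarith
  moreover have "x\<^sup>2 \<le> 4\<^sup>2"
    using assms pi_less_4 by (intro power2_le_iff_abs_le[THEN iffD2]) auto
  ultimately show ?thesis by simp
qed

context
  fixes p :: real
  assumes p: "0 < p" "p < 1"
begin

text \<open>The squared modulus equals 1 - 2p(1-p)(1 - cos x). The restriction to one period is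
  essential, as the modulus returns to 1 at 2 pi; hence the conditions of the form (absolute value
  of t) times (size) at most \<open>pi\<close> further on.\<close>

lemma norm_bernoulli_char_le:
  assumes "\<bar>x\<bar> \<le> pi"
  shows "norm ((1 - p) *\<^sub>R 1 + p *\<^sub>R iexp x) \<le> exp (- (p * (1 - p) / 16 * x\<^sup>2))"
proof -
  have "(norm ((1 - p) *\<^sub>R 1 + p *\<^sub>R iexp x))\<^sup>2 = (1 - p + p * cos x)\<^sup>2 + (p * sin x)\<^sup>2"
    by (simp add: cmod_power2 Re_exp Im_exp)
  also have "\<dots> = (1 - p)\<^sup>2 + 2 * p * (1 - p) * cos x + p\<^sup>2 * ((sin x)\<^sup>2 + (cos x)\<^sup>2)"
    by algebra
  also have "\<dots> = 1 - 2 * (p * (1 - p)) * (1 - cos x)"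
    by (simp only: sin_cos_squared_add) (simp add: power2_eq_square algebra_simps)
  also have "\<dots> \<le> 1 - 2 * (p * (1 - p)) * (x\<^sup>2 / 16)"
    using p one_minus_cos_ge[OF assms] by (intro diff_left_mono mult_left_mono) auto
  also have "\<dots> \<le> exp (- 2 * (p * (1 - p)) * (x\<^sup>2 / 16))"
    using exp_ge_add_one_self[of "- 2 * (p * (1 - p)) * (x\<^sup>2 / 16)"] by simp
  also have "\<dots> = (exp (- (p * (1 - p) / 16 * x\<^sup>2)))\<^sup>2"
    by (simp add: power2_eq_square mult_exp_exp)
  finally show ?thesis by (rule power2_le_imp_le) simp
qed

end

section \<open>Splitting the triangle count along a vertex block\<close>

definition tri_char :: "real \<Rightarrow> 'a set \<Rightarrow> real \<Rightarrow> complex" where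
  "tri_char p V t = bern_exp p (pairs V) (\<lambda>X. iexp (t * real (tri_count V X)))"

definition codegree :: "'a set \<Rightarrow> 'a set set \<Rightarrow> 'a set \<Rightarrow> nat" where
  "codegree Z Y e = card {z \<in> Z. \<forall>u\<in>e. {u, z} \<in> Y}"

lemma pairs_insert:
  assumes "z \<notin> A"
  shows "pairs (insert z A) = pairs A \<union> (\<lambda>u. {u, z}) ` A"
proof (intro equalityI subsetI)
  fix e assume e: "e \<in> pairs (insert z A)"
  show "e \<in> pairs A \<union> (\<lambda>u. {u, z}) ` A"
  proof (cases "z \<in> e")
    case True
    then have "card (e - {z}) = 1" using e by (simp add: pairs_def)
    then obtain u where "e - {z} = {u}" by (rule card_1_singletonE)
    then have "e = {u, z}" "u \<in> A" using True e by (auto simp: pairs_def)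
    then show ?thesis by auto
  qed (use e in \<open>auto simp: pairs_def\<close>)
qed (use assms in \<open>auto simp: pairs_def card_insert_if\<close>)

lemma pairs_of_pair: "card e = 2 \<Longrightarrow> pairs e = {e}"
  using card_subset_eq[of e] by (auto simp: pairs_def card_ge_0_finite)

text \<open>Triples are sorted by how many vertices they have in \<open>B\<close>. With two, the
  triangle is an edge of the block and a common neighbour in \<open>Z\<close>, which produces the
  codegrees. With at most one, it has no edge in the block and so does not depend on
  \<open>X\<close>.\<close>

lemma tri_count_block:
  assumes fin: "finite B" "finite Z" and disj: "B \<inter> Z = {}"
    and X: "X \<subseteq> pairs B" and Y: "Y \<subseteq> pairs (B \<union> Z) - pairs B"
  shows "real (tri_count (B \<union> Z) (X \<union> Y)) = real (tri_count B X)
    + (\<Sum>e\<in>pairs B. of_bool (e \<in> X) * real (codegree Z Y e))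
    + real (card {T \<in> triples (B \<union> Z). card (T \<inter> B) \<le> 1 \<and> pairs T \<subseteq> Y})"
proof -
  let ?f = "\<lambda>T. of_bool (pairs T \<subseteq> X \<union> Y) :: real"
  let ?T2 = "{T \<in> triples (B \<union> Z). card (T \<inter> B) = 2}"
  let ?T1 = "{T \<in> triples (B \<union> Z). card (T \<inter> B) \<le> 1}"
  have T3: "card (T \<inter> B) = 3 \<longleftrightarrow> T \<subseteq> B" if "T \<in> triples (B \<union> Z)" for T
    using that triples_finite[OF that] card_subset_eq[of T "T \<inter> B"]
    by (auto simp: triples_def Int_absorb2)
  have le3: "card (T \<inter> B) \<le> 3" if "T \<in> triples (B \<union> Z)" for T
    using that triples_finite[OF that] card_mono[of T "T \<inter> B"] by (auto simp: triples_def)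
  have split: "triples (B \<union> Z) = triples B \<union> (?T2 \<union> ?T1)"
  proof (intro equalityI subsetI)
    fix T assume T: "T \<in> triples (B \<union> Z)"
    consider "card (T \<inter> B) = 3" | "card (T \<inter> B) = 2" | "card (T \<inter> B) \<le> 1"
      using le3[OF T] by linarith
    then show "T \<in> triples B \<union> (?T2 \<union> ?T1)"
      using T T3[OF T] by cases (simp_all add: triples_def)
  qed (auto simp: triples_def)
  have d1: "triples B \<inter> (?T2 \<union> ?T1) = {}"
    by (auto simp: triples_def Int_absorb2)
  have "real (tri_count (B \<union> Z) (X \<union> Y)) = sum ?f (triples B \<union> (?T2 \<union> ?T1))"
    using fin unfolding split[symmetric] by (intro real_tri_count) auto
  also have "\<dots> = sum ?f (triples B) + (sum ?f ?T2 + sum ?f ?T1)"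
    using fin d1 by (subst sum.union_disjoint; (subst sum.union_disjoint)?) auto
  also have "sum ?f (triples B) = real (tri_count B X)"
    unfolding real_tri_count[OF fin(1)]
  proof (intro sum.cong refl arg_cong[where f = of_bool])
    fix T assume "T \<in> triples B"
    then have "pairs T \<subseteq> pairs B" by (intro pairs_mono) (auto simp: triples_def)
    then show "(pairs T \<subseteq> X \<union> Y) = (pairs T \<subseteq> X)" using Y by auto
  qed
  also have "sum ?f ?T1 = real (card {T \<in> triples (B \<union> Z). card (T \<inter> B) \<le> 1 \<and> pairs T \<subseteq> Y})"
  proof -
    have "pairs T \<inter> X = {}" if "T \<in> ?T1" for T
    proof (rule ccontr)
      assume "pairs T \<inter> X \<noteq> {}"
      then obtain e where "e \<in> pairs T" "e \<in> pairs B" using X by auto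
      then have "e \<subseteq> T \<inter> B" "card e = 2" by (auto simp: pairs_def)
      then have "2 \<le> card (T \<inter> B)" using fin card_mono[of "T \<inter> B" e] by auto
      with that show False by auto
    qed
    then have "sum ?f ?T1 = (\<Sum>T\<in>?T1. of_bool (pairs T \<subseteq> Y))"
      by (intro sum.cong refl arg_cong[where f = of_bool]) blast
    also have "?T1 \<inter> {T. pairs T \<subseteq> Y} = {T \<in> triples (B \<union> Z). card (T \<inter> B) \<le> 1 \<and> pairs T \<subseteq> Y}" by auto
    ultimately show ?thesis using fin by simp
  qed
  also have "sum ?f ?T2 = (\<Sum>(e, z)\<in>pairs B \<times> Z. ?f (insert z e))"
  proof (rule sum.reindex_bij_betw[symmetric, THEN trans])
    show "bij_betw (\<lambda>(e, z). insert z e) (pairs B \<times> Z) ?T2"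
    proof (rule bij_betw_imageI)
      show "inj_on (\<lambda>(e, z). insert z e) (pairs B \<times> Z)"
      proof (rule inj_onI, clarify)
        fix e z e' z' assume a: "e \<in> pairs B" "z \<in> Z" "e' \<in> pairs B" "z' \<in> Z" "insert z e = insert z' e'"
        have "insert z e \<inter> B = e" "insert z' e' \<inter> B = e'" "insert z e \<inter> Z = {z}" "insert z' e' \<inter> Z = {z'}"
          using a disj by (auto simp: pairs_def)
        then show "e = e' \<and> z = z'" using a(5) by auto
      qed
      show "(\<lambda>(e, z). insert z e) ` (pairs B \<times> Z) = ?T2"
      proof (intro equalityI subsetI)
        fix T assume "T \<in> (\<lambda>(e, z). insert z e) ` (pairs B \<times> Z)"
        then obtain e z where T: "T = insert z e" "e \<in> pairs B" "z \<in> Z" by auto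
        have e: "insert z e \<inter> B = e" "z \<notin> e" "finite e" "card e = 2" "insert z e \<subseteq> B \<union> Z"
          using T(2,3) disj finite_subset[OF _ fin(1), of e] by (auto simp: pairs_def)
        then have "card (insert z e) = 3" by simp
        then have "insert z e \<in> triples (B \<union> Z)" using e(5) unfolding triples_def by blast
        then show "T \<in> ?T2" using e(4) unfolding T(1) mem_Collect_eq e(1) by (rule conjI)
      next
        fix T assume T: "T \<in> ?T2"
        have "card (T - B) = 1"
        proof -
          have "card T = 3" "card (T \<inter> B) = 2" "finite T"
            using T triples_finite by (simp_all add: triples_def card_ge_0_finite)
          then show ?thesis using card_Int_Diff[of T B] by linarith
        qed
        then obtain z where z: "T - B = {z}" by (rule card_1_singletonE)
        then have "T = insert z (T \<inter> B)" by auto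
        moreover have "T \<inter> B \<in> pairs B" using T by (simp add: pairs_def)
        moreover have "z \<in> Z" using z T unfolding triples_def by blast
        ultimately show "T \<in> (\<lambda>(e, z). insert z e) ` (pairs B \<times> Z)"
          by (intro image_eqI[where x = "(T \<inter> B, z)"]) simp_all
      qed
    qed
  qed (simp add: case_prod_unfold)
  also have "\<dots> = (\<Sum>(e, z)\<in>pairs B \<times> Z. of_bool (e \<in> X) * of_bool (\<forall>u\<in>e. {u, z} \<in> Y))"
  proof (rule sum.cong[OF refl], clarify)
    fix e z assume ez: "e \<in> pairs B" "z \<in> Z"
    then have "z \<notin> e" "z \<notin> B" "card e = 2" using disj by (auto simp: pairs_def)
    then have "pairs (insert z e) = insert e ((\<lambda>u. {u, z}) ` e)"
      by (simp add: pairs_insert pairs_of_pair)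
    moreover have "e \<notin> Y" using ez Y by auto
    moreover have "{u, z} \<notin> X" for u using \<open>z \<notin> B\<close> X by (auto simp: pairs_def)
    ultimately have "pairs (insert z e) \<subseteq> X \<union> Y \<longleftrightarrow> e \<in> X \<and> (\<forall>u\<in>e. {u, z} \<in> Y)"
      by (simp add: image_subset_iff)
    then show "?f (insert z e) = of_bool (e \<in> X) * of_bool (\<forall>u\<in>e. {u, z} \<in> Y)" by simp
  qed
  also have "\<dots> = (\<Sum>e\<in>pairs B. of_bool (e \<in> X) * real (codegree Z Y e))"
    unfolding sum.cartesian_product[symmetric] codegree_def
  proof (intro sum.cong refl)
    fix e
    have "(\<Sum>z\<in>Z. of_bool (\<forall>u\<in>e. {u, z} \<in> Y)) = real (card {z \<in> Z. \<forall>u\<in>e. {u, z} \<in> Y})"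
      using fin by (simp add: Int_def)
    then show "(\<Sum>z\<in>Z. of_bool (e \<in> X) * of_bool (\<forall>u\<in>e. {u, z} \<in> Y)) =
         of_bool (e \<in> X) * real (card {z \<in> Z. \<forall>u\<in>e. {u, z} \<in> Y})"
      by (simp only: sum_distrib_left[symmetric])
  qed
  finally show ?thesis by simp
qed

text \<open>Replaces an exponential by an affine function, so that a Laplace transform of a bounded
  nonnegative variable is controlled by its mean alone.\<close>

lemma exp_minus_le_linear:
  fixes x :: real
  assumes "0 \<le> x" "x \<le> 1"
  shows "exp (- x) \<le> 1 - x / 2"
proof -
  have "exp (- x) \<le> 1 / (1 + x)"
    using assms exp_ge_add_one_self[of x] by (simp add: exp_minus field_simps)
  also have "\<dots> \<le> 1 - x / 2"
    using assms mult_left_mono[of x 1 x] by (simp add: field_simps)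
  finally show ?thesis .
qed

lemma real_choose_two: "real (n choose 2) = real n * (real n - 1) / 2"
proof (induction n)
  case (Suc n)
  then show ?case by (simp add: numeral_2_eq_2 field_simps)
qed simp

lemma real_choose_two_le: "real (n choose 2) \<le> real n ^ 2"
  by (cases n) (simp_all add: real_choose_two power2_eq_square field_simps)

lemma norm_iexp_diff_le: "norm (iexp (a + b) - iexp a) \<le> \<bar>b\<bar>"
proof -
  have "iexp (a + b) - iexp a = iexp a * (iexp b - 1)"
    by (simp add: algebra_simps exp_add)
  then show ?thesis using iexp_approx1[of b 0] by (simp add: norm_mult)
qed

lemma bern_exp_iexp_linear:
  fixes a :: "'a \<Rightarrow> real"
  assumes "finite A"
  shows "bern_exp p A (\<lambda>X. iexp (c + (\<Sum>e\<in>A. of_bool (e \<in> X) * a e)))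
    = iexp c * (\<Prod>e\<in>A. (1 - p) *\<^sub>R 1 + p *\<^sub>R iexp (a e))"
proof -
  have "bern_exp p A (\<lambda>X. iexp (c + (\<Sum>e\<in>A. of_bool (e \<in> X) * a e)))
     = bern_exp p A (\<lambda>X. iexp c * (\<Prod>e\<in>A. (if e \<in> X then iexp (a e) else 1)))"
  proof (intro bern_exp_cong refl)
    fix X
    have "iexp (\<Sum>e\<in>A. of_bool (e \<in> X) * a e) = (\<Prod>e\<in>A. iexp (of_bool (e \<in> X) * a e))"
      using assms by (simp only: of_real_sum sum_distrib_left exp_sum)
    also have "\<dots> = (\<Prod>e\<in>A. (if e \<in> X then iexp (a e) else 1))"
      by (intro prod.cong) auto
    finally show "iexp (c + (\<Sum>e\<in>A. of_bool (e \<in> X) * a e)) = iexp c * (\<Prod>e\<in>A. (if e \<in> X then iexp (a e) else 1))"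
      by (simp only: of_real_add distrib_left exp_add)
  qed
  also have "\<dots> = iexp c * (\<Prod>e\<in>A. (1 - p) *\<^sub>R 1 + p *\<^sub>R iexp (a e))"
    unfolding bern_exp_mult_left
    using bern_exp_prod[OF assms, of p "\<lambda>e b. if b then iexp (a e) else 1"] by simp
  finally show ?thesis .
qed

text \<open>Double counting of pairs with a common neighbour. Intersecting with the star from
  \<open>z\<close> to \<open>B\<close> exhibits the summands as functions of disjoint sets of edges,
  hence independent.\<close>

lemma sum_codegree:
  assumes "finite B" "finite Z"
  shows "(\<Sum>e\<in>pairs B. real (codegree Z Y e))
    = (\<Sum>z\<in>Z. real (card {e \<in> pairs B. \<forall>u\<in>e. {u, z} \<in> Y \<inter> (\<lambda>u. {u, z}) ` B}))"
proof -
  have "(\<Sum>e\<in>pairs B. card {z \<in> Z. \<forall>u\<in>e. {u, z} \<in> Y}) = (\<Sum>z\<in>Z. card {e \<in> pairs B. \<forall>u\<in>e. {u, z} \<in> Y})"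
    using sum.swap_restrict[of "pairs B" Z "\<lambda>_ _. 1 :: nat" "\<lambda>e z. \<forall>u\<in>e. {u, z} \<in> Y"] assms by simp
  also have "\<dots> = (\<Sum>z\<in>Z. card {e \<in> pairs B. \<forall>u\<in>e. {u, z} \<in> Y \<inter> (\<lambda>u. {u, z}) ` B})"
    by (intro sum.cong refl arg_cong[where f = card]) (auto simp: pairs_def)
  finally show ?thesis unfolding codegree_def of_nat_sum[symmetric] by simp
qed

section \<open>Averaging the block bound over the outside edges\<close>

context
  fixes p :: real
  assumes p: "0 < p" "p < 1"
begin

lemma bern_exp_pairs_within:
  assumes "finite B"
  shows "bern_exp p B (\<lambda>W. real (card {e \<in> pairs B. e \<subseteq> W})) = real (card (pairs B)) * p\<^sup>2"
proof -
  have "bern_exp p B (\<lambda>W. real (card {e \<in> pairs B. e \<subseteq> W}))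
      = bern_exp p B (\<lambda>W. \<Sum>e\<in>pairs B. of_bool (e \<subseteq> W))"
    using assms by (intro bern_exp_cong) (auto simp: Int_def)
  also have "\<dots> = (\<Sum>e\<in>pairs B. p\<^sup>2)"
    unfolding bern_exp_sum using assms
    by (intro sum.cong refl) (auto simp: pairs_def bern_exp_subset_indicator)
  finally show ?thesis by simp
qed

text \<open>The Laplace transform factors over the vertices of \<open>Z\<close>. For one vertex the
  number of pairs inside its neighbourhood is at most \<open>card (pairs B)\<close>, so
  \<open>l * real (card (pairs B)) \<le> 1\<close> permits linearisation, and its mean is p^2 times
  that number.\<close>

lemma codegree_laplace:
  assumes fin: "finite B" "finite Z" and disj: "B \<inter> Z = {}"
    and l: "0 \<le> l" "l * real (card (pairs B)) \<le> 1"
  shows "bern_exp p (pairs (B \<union> Z) - pairs B) (\<lambda>Y. exp (- (l * (\<Sum>e\<in>pairs B. real (codegree Z Y e)))))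
    \<le> exp (- (real (card Z) * (l * real (card (pairs B)) * p\<^sup>2 / 2)))"
proof -
  let ?f = "real (card (pairs B))"
  define A where "A z = (\<lambda>u. {u, z}) ` B" for z
  define h where "h z W = exp (- (l * real (card {e \<in> pairs B. \<forall>u\<in>e. {u, z} \<in> W})))" for z W
  have A_sub: "(\<Union>z\<in>Z. A z) \<subseteq> pairs (B \<union> Z) - pairs B"
    using disj by (auto simp: A_def pairs_def card_insert_if)
  have "bern_exp p (pairs (B \<union> Z) - pairs B) (\<lambda>Y. exp (- (l * (\<Sum>e\<in>pairs B. real (codegree Z Y e)))))
      = bern_exp p (pairs (B \<union> Z) - pairs B) (\<lambda>Y. \<Prod>z\<in>Z. h z ((Y \<inter> (\<Union>z\<in>Z. A z)) \<inter> A z))"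
  proof (intro bern_exp_cong refl)
    fix Y
    have "exp (- (l * (\<Sum>e\<in>pairs B. real (codegree Z Y e)))) = (\<Prod>z\<in>Z. h z (Y \<inter> A z))"
      unfolding sum_codegree[OF fin] h_def A_def
      using fin by (simp add: sum_distrib_left exp_sum flip: sum_negf)
    also have "\<dots> = (\<Prod>z\<in>Z. h z ((Y \<inter> (\<Union>z\<in>Z. A z)) \<inter> A z))"
      by (intro prod.cong refl arg_cong2[where f = h]) auto
    finally show "exp (- (l * (\<Sum>e\<in>pairs B. real (codegree Z Y e)))) = \<dots>" .
  qed
  also have "\<dots> = bern_exp p (\<Union>z\<in>Z. A z) (\<lambda>Y. \<Prod>z\<in>Z. h z (Y \<inter> A z))"
    using A_sub fin by (intro bern_exp_restrict) auto
  also have "\<dots> = (\<Prod>z\<in>Z. bern_exp p (A z) (h z))"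
  proof (rule bern_exp_prod_groups)
    show "disjoint_family_on A Z"
      using disj by (auto simp: disjoint_family_on_def A_def doubleton_eq_iff)
  qed (use fin in \<open>auto simp: A_def\<close>)
  also have "\<dots> \<le> (\<Prod>z\<in>Z. exp (- (l * ?f * p\<^sup>2 / 2)))"
  proof (intro prod_mono conjI)
    fix z assume z: "z \<in> Z"
    show "0 \<le> bern_exp p (A z) (h z)" by (intro bern_exp_nonneg p) (simp add: h_def)
    have inj: "inj_on (\<lambda>u. {u, z}) B" using z disj by (auto simp: inj_on_def doubleton_eq_iff)
    have "bern_exp p (A z) (h z) = bern_exp p B (\<lambda>W. h z ((\<lambda>u. {u, z}) ` W))"
      unfolding A_def by (rule bern_exp_image[OF inj])
    also have "\<dots> = bern_exp p B (\<lambda>W. exp (- (l * real (card {e \<in> pairs B. e \<subseteq> W}))))"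
    proof (intro bern_exp_cong refl)
      fix W assume "W \<subseteq> B"
      then have "{u, z} \<in> (\<lambda>u. {u, z}) ` W \<longleftrightarrow> u \<in> W" if "u \<in> B" for u
        using inj that by (auto simp: inj_on_def)
      then have "{e \<in> pairs B. \<forall>u\<in>e. {u, z} \<in> (\<lambda>u. {u, z}) ` W} = {e \<in> pairs B. e \<subseteq> W}"
        unfolding pairs_def by blast
      then show "h z ((\<lambda>u. {u, z}) ` W) = exp (- (l * real (card {e \<in> pairs B. e \<subseteq> W})))"
        by (simp only: h_def)
    qed
    also have "\<dots> \<le> bern_exp p B (\<lambda>W. 1 - l / 2 * real (card {e \<in> pairs B. e \<subseteq> W}))"
    proof (intro bern_exp_mono p)
      fix W
      have "real (card {e \<in> pairs B. e \<subseteq> W}) \<le> ?f"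
        using fin by (intro of_nat_mono card_mono) auto
      then have "l * real (card {e \<in> pairs B. e \<subseteq> W}) \<le> 1"
        using l mult_left_mono order.trans by blast
      then show "exp (- (l * real (card {e \<in> pairs B. e \<subseteq> W}))) \<le> 1 - l / 2 * real (card {e \<in> pairs B. e \<subseteq> W})"
        using exp_minus_le_linear[of "l * real (card {e \<in> pairs B. e \<subseteq> W})"] l by simp
    qed
    also have "\<dots> = 1 - l * ?f * p\<^sup>2 / 2"
      unfolding bern_exp_diff bern_exp_mult_left bern_exp_pairs_within[OF fin(1)] using fin by simp
    also have "\<dots> \<le> exp (- (l * ?f * p\<^sup>2 / 2))"
      using exp_ge_add_one_self[of "- (l * ?f * p\<^sup>2 / 2)"] by simp
    finally show "bern_exp p (A z) (h z) \<le> exp (- (l * ?f * p\<^sup>2 / 2))" .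
  qed
  also have "\<dots> = exp (- (real (card Z) * (l * ?f * p\<^sup>2 / 2)))"
    by (simp flip: exp_of_nat_mult)
  finally show ?thesis .
qed

text \<open>Given the outside edges \<open>Y\<close>, the phase is linear in the block edges up to
  \<open>t * tri_rem p B X\<close>. Dropping this term costs its first absolute moment; the rest is
  a product of Bernoulli characteristic functions.\<close>

lemma tri_char_block_conditional:
  assumes fin: "finite B" "finite Z" and disj: "B \<inter> Z = {}"
    and Y: "Y \<subseteq> pairs (B \<union> Z) - pairs B"
    and s: "0 \<le> s" "s \<le> t\<^sup>2" and t: "\<bar>t\<bar> * (real (card B) + real (card Z)) \<le> pi"
  shows "norm (bern_exp p (pairs B) (\<lambda>X. iexp (t * real (tri_count (B \<union> Z) (Y \<union> X)))))
    \<le> \<bar>t\<bar> * (4 * sqrt (real (card B) ^ 3)) + (\<Prod>e\<in>pairs B. exp (- (p * (1 - p) / 16 * s * (real (codegree Z Y e))\<^sup>2)))"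
proof -
  let ?F = "pairs B"
  \<comment> \<open>Linear coefficient contributed by the triangles inside the block. It is
    nonnegative, so it only enlarges the coefficients and can be discarded in the decay
    estimate.\<close>
  define d where "d = real (card B - 2) * p\<^sup>2"
  define a where "a e = t * (real (codegree Z Y e) + d)" for e
  define c where "c = t * (real (card {T \<in> triples (B \<union> Z). card (T \<inter> B) \<le> 1 \<and> pairs T \<subseteq> Y})
     + p ^ 3 * real (card B choose 3) - d * p * real (card ?F))"
  have d: "0 \<le> d" "d \<le> real (card B)"
    unfolding d_def using p mult_mono[of "real (card B - 2)" "real (card B)" "p\<^sup>2" 1]
    by (auto simp: power_le_one)
  let ?l = "\<lambda>X. c + (\<Sum>e\<in>?F. of_bool (e \<in> X) * a e)"
  have phase: "t * real (tri_count (B \<union> Z) (Y \<union> X)) = ?l X + t * tri_rem p B X" if "X \<subseteq> ?F" for X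
  proof -
    have sum_a: "(\<Sum>e\<in>?F. of_bool (e \<in> X) * a e) = t * ((\<Sum>e\<in>?F. of_bool (e \<in> X) * real (codegree Z Y e))
        + d * (\<Sum>e\<in>?F. of_bool (e \<in> X)))"
      unfolding a_def sum_distrib_left sum.distrib[symmetric] by (intro sum.cong refl) (simp add: algebra_simps)
    have centered: "(\<Sum>e\<in>?F. of_bool (e \<in> X) - p) = (\<Sum>e\<in>?F. of_bool (e \<in> X)) - p * real (card ?F)"
      by (simp only: sum_subtractf sum_constant mult.commute)
    have count: "real (tri_count B X) = p ^ 3 * real (card B choose 3) + d * (\<Sum>e\<in>?F. of_bool (e \<in> X) - p) + tri_rem p B X"
      using tri_count_decomp[OF fin(1), of X p] by (simp only: d_def)
    show ?thesis
      unfolding Un_commute[of Y X] tri_count_block[OF fin disj that Y] c_def count centered sum_a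
      by (simp only: algebra_simps)
  qed
  have "norm (bern_exp p ?F (\<lambda>X. iexp (t * real (tri_count (B \<union> Z) (Y \<union> X)))))
     = norm (bern_exp p ?F (\<lambda>X. iexp (?l X + t * tri_rem p B X)))"
    by (intro arg_cong[where f = norm] bern_exp_cong refl) (simp only: phase)
  also have "\<dots> = norm (bern_exp p ?F (\<lambda>X. iexp (?l X + t * tri_rem p B X) - iexp (?l X)) + bern_exp p ?F (\<lambda>X. iexp (?l X)))"
    by (simp only: bern_exp_diff diff_add_cancel)
  also have "\<dots> \<le> bern_exp p ?F (\<lambda>X. norm (iexp (?l X + t * tri_rem p B X) - iexp (?l X))) + norm (bern_exp p ?F (\<lambda>X. iexp (?l X)))"
    by (intro order.trans[OF norm_triangle_ineq] add_mono norm_bern_exp_le p order.refl)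
  also have "bern_exp p ?F (\<lambda>X. norm (iexp (?l X + t * tri_rem p B X) - iexp (?l X))) \<le> bern_exp p ?F (\<lambda>X. \<bar>t * tri_rem p B X\<bar>)"
    by (intro bern_exp_mono p norm_iexp_diff_le)
  also have "\<dots> = \<bar>t\<bar> * bern_exp p ?F (\<lambda>X. \<bar>tri_rem p B X\<bar>)"
    by (simp only: abs_mult bern_exp_mult_left)
  also have "\<dots> \<le> \<bar>t\<bar> * (4 * sqrt (real (card B) ^ 3))"
    using tri_rem_abs_moment[OF p fin(1)] by (intro mult_left_mono) auto
  also have "norm (bern_exp p ?F (\<lambda>X. iexp (?l X))) = (\<Prod>e\<in>?F. norm ((1 - p) *\<^sub>R 1 + p *\<^sub>R iexp (a e)))"
    unfolding bern_exp_iexp_linear[OF finite_pairs[OF fin(1)]] by (simp add: norm_mult prod_norm)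
  also have "\<dots> \<le> (\<Prod>e\<in>?F. exp (- (p * (1 - p) / 16 * s * (real (codegree Z Y e))\<^sup>2)))"
  proof (intro prod_mono conjI norm_ge_zero)
    fix e
    have cod: "real (codegree Z Y e) \<le> real (card Z)"
      unfolding codegree_def using fin by (intro of_nat_mono card_mono) auto
    have "\<bar>a e\<bar> = \<bar>t\<bar> * (real (codegree Z Y e) + d)"
      using d by (simp add: a_def abs_mult)
    also have "\<dots> \<le> \<bar>t\<bar> * (real (card B) + real (card Z))"
      using d cod by (intro mult_left_mono) auto
    finally have "\<bar>a e\<bar> \<le> pi" using t by simp
    then have "norm ((1 - p) *\<^sub>R 1 + p *\<^sub>R iexp (a e)) \<le> exp (- (p * (1 - p) / 16 * (a e)\<^sup>2))"
      by (rule norm_bernoulli_char_le[OF p])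
    also have "\<dots> \<le> exp (- (p * (1 - p) / 16 * (s * (real (codegree Z Y e))\<^sup>2)))"
    proof -
      have "s * (real (codegree Z Y e))\<^sup>2 \<le> t\<^sup>2 * (real (codegree Z Y e) + d)\<^sup>2"
        using s d by (intro mult_mono power_mono) auto
      then show ?thesis using p by (auto simp: a_def power_mult_distrib intro!: mult_left_mono)
    qed
    finally show "norm ((1 - p) *\<^sub>R 1 + p *\<^sub>R iexp (a e)) \<le> exp (- (p * (1 - p) / 16 * s * (real (codegree Z Y e))\<^sup>2))"
      by (simp only: mult.assoc)
  qed
  finally show ?thesis by simp
qed

text \<open>The conditional bound still contains the squares of the random codegrees. A tangent-line
  bound reduces these to the sum of the codegrees, to which \<open>codegree_laplace\<close>
  applies.\<close>

lemma tri_char_block_bound: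
  assumes fin: "finite B" "finite Z" and disj: "B \<inter> Z = {}" and D: "2 \<le> card B"
    and s: "0 \<le> s" "s \<le> t\<^sup>2" "s * (real (card B))\<^sup>2 * real (card Z) \<le> 1"
    and t: "\<bar>t\<bar> * (real (card B) + real (card Z)) \<le> pi"
  shows "norm (tri_char p (B \<union> Z) t) \<le> \<bar>t\<bar> * (4 * sqrt (real (card B) ^ 3))
    + exp (- (p ^ 5 * (1 - p) / 256 * s * (real (card B))\<^sup>2 * (real (card Z))\<^sup>2))"
proof -
  let ?F = "pairs B" and ?G = "pairs (B \<union> Z) - pairs B"
  define f where "f = real (card ?F)"
  define K where "K = real (card Z)"
  define g where "g = p * (1 - p) / 16"
  define r where "r = p\<^sup>2 * K / 2"
  have "p * (1 - p) \<le> 1" using p by (intro mult_le_one) auto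
  then have g: "0 \<le> g" "g \<le> 1" using p by (auto simp: g_def)
  have p2: "0 \<le> p\<^sup>2" "p\<^sup>2 \<le> 1" using p by (auto simp: power_le_one)
  have f_eq: "f = real (card B) * (real (card B) - 1) / 2"
    using fin by (simp add: f_def card_pairs real_choose_two)
  have f_ge: "(real (card B))\<^sup>2 / 4 \<le> f" and f_le: "f \<le> (real (card B))\<^sup>2" and f0: "0 \<le> f"
    using D mult_left_mono[of 2 "real (card B)" "real (card B)"] unfolding f_eq by (auto simp: power2_eq_square field_simps)
  have K0: "0 \<le> K" by (simp add: K_def)
  \<comment> \<open>The Laplace parameter will be \<open>2 * g * s * r\<close>; this is the
    smallness condition of \<open>codegree_laplace\<close> for it.\<close>
  have l1: "2 * g * s * r * f \<le> 1"
  proof -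
    have "2 * g * s * r * f = (g * p\<^sup>2) * (s * f * K)" by (simp add: r_def)
    also have "\<dots> \<le> 1 * (s * (real (card B))\<^sup>2 * K)"
      using g p2 s f_le f0 K0 by (intro mult_mono mult_nonneg_nonneg mult_le_one) auto
    finally show ?thesis using s by (simp add: K_def)
  qed
  have "tri_char p (B \<union> Z) t = bern_exp p (?G \<union> ?F) (\<lambda>X. iexp (t * real (tri_count (B \<union> Z) X)))"
    unfolding tri_char_def using pairs_mono[of B "B \<union> Z"] by (simp add: Un_absorb2)
  also have "\<dots> = bern_exp p ?G (\<lambda>Y. bern_exp p ?F (\<lambda>X. iexp (t * real (tri_count (B \<union> Z) (Y \<union> X)))))"
    using fin by (intro bern_exp_union) auto
  finally have "norm (tri_char p (B \<union> Z) t)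
      \<le> bern_exp p ?G (\<lambda>Y. norm (bern_exp p ?F (\<lambda>X. iexp (t * real (tri_count (B \<union> Z) (Y \<union> X))))))"
    using norm_bern_exp_le[OF p] by metis
  also have "\<dots> \<le> bern_exp p ?G (\<lambda>Y. \<bar>t\<bar> * (4 * sqrt (real (card B) ^ 3)) +
       exp (g * s * r\<^sup>2 * f) * exp (- (2 * g * s * r * (\<Sum>e\<in>?F. real (codegree Z Y e)))))"
  proof (intro bern_exp_mono p)
    fix Y assume Y: "Y \<subseteq> ?G"
    \<comment> \<open>Linearising the square at \<open>r\<close>, half the expected codegree, leaves only the sum of the codegrees,
      which is a sum of independent contributions of the vertices of \<open>Z\<close>.\<close>
    have "(\<Prod>e\<in>?F. exp (- (g * s * (real (codegree Z Y e))\<^sup>2)))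
        \<le> (\<Prod>e\<in>?F. exp (g * s * r\<^sup>2 - 2 * g * s * r * real (codegree Z Y e)))"
    proof (intro prod_mono conjI)
      fix e
      have "0 \<le> g * s * (real (codegree Z Y e) - r)\<^sup>2" using g s by simp
      then show "exp (- (g * s * (real (codegree Z Y e))\<^sup>2)) \<le> exp (g * s * r\<^sup>2 - 2 * g * s * r * real (codegree Z Y e))"
        by (simp add: power2_eq_square algebra_simps)
    qed simp
    also have "\<dots> = exp (\<Sum>e\<in>?F. g * s * r\<^sup>2 - 2 * g * s * r * real (codegree Z Y e))"
      using fin by (simp add: exp_sum)
    also have "(\<Sum>e\<in>?F. g * s * r\<^sup>2 - 2 * g * s * r * real (codegree Z Y e))
        = g * s * r\<^sup>2 * f + - (2 * g * s * r * (\<Sum>e\<in>?F. real (codegree Z Y e)))"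
      by (simp add: sum_subtractf f_def sum_distrib_left)
    finally show "norm (bern_exp p ?F (\<lambda>X. iexp (t * real (tri_count (B \<union> Z) (Y \<union> X)))))
      \<le> \<bar>t\<bar> * (4 * sqrt (real (card B) ^ 3)) +
       exp (g * s * r\<^sup>2 * f) * exp (- (2 * g * s * r * (\<Sum>e\<in>?F. real (codegree Z Y e))))"
      using tri_char_block_conditional[OF fin disj Y s(1,2) t] unfolding g_def[symmetric] exp_add by linarith
  qed
  also have "\<dots> = \<bar>t\<bar> * (4 * sqrt (real (card B) ^ 3)) +
      exp (g * s * r\<^sup>2 * f) * bern_exp p ?G (\<lambda>Y. exp (- (2 * g * s * r * (\<Sum>e\<in>?F. real (codegree Z Y e)))))"
    using fin by (simp add: bern_exp_add bern_exp_mult_left)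
  also have "\<dots> \<le> \<bar>t\<bar> * (4 * sqrt (real (card B) ^ 3)) +
      exp (g * s * r\<^sup>2 * f) * exp (- (K * (2 * g * s * r * f * p\<^sup>2 / 2)))"
    unfolding K_def f_def using l1 g s K0 p2
    by (intro add_left_mono mult_left_mono codegree_laplace fin disj) (auto simp: f_def r_def)
  \<comment> \<open>Since \<open>K * p\<^sup>2\<close> equals \<open>2 * r\<close>, the gain is
    twice the loss \<open>g * s * r\<^sup>2 * f\<close>, and half of it remains.\<close>
  also have "exp (g * s * r\<^sup>2 * f) * exp (- (K * (2 * g * s * r * f * p\<^sup>2 / 2))) = exp (- (g * s * p ^ 4 * K\<^sup>2 / 4 * f))"
    by (simp add: r_def mult_exp_exp power2_eq_square eval_nat_numeral field_simps)
  also have "\<dots> \<le> exp (- (g * s * p ^ 4 * K\<^sup>2 / 4 * ((real (card B))\<^sup>2 / 4)))"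
    using mult_left_mono[OF f_ge, of "g * s * p ^ 4 * K\<^sup>2 / 4"] g s p by simp
  also have "g * s * p ^ 4 * K\<^sup>2 / 4 * ((real (card B))\<^sup>2 / 4) = p ^ 5 * (1 - p) / 256 * s * (real (card B))\<^sup>2 * (real (card Z))\<^sup>2"
    by (simp add: g_def K_def eval_nat_numeral)
  finally show ?thesis by simp
qed

end

section \<open>Decoupling along a tripartition\<close>

lemma inj_on_doubleton:
  assumes "A \<inter> B = {}"
  shows "inj_on (\<lambda>(a, b). {a, b}) (A \<times> B)"
  using assms by (auto simp: inj_on_def doubleton_eq_iff)

lemma iexp_mult_cnj: "iexp x * cnj (iexp y) = iexp (x - y)"
proof -
  have "cnj (iexp y) = iexp (- y)" by (simp add: exp_cnj)
  then show ?thesis by (simp add: right_diff_distrib flip: exp_add)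
qed

text \<open>Only transversal triangles, with one vertex in each of the three sets, couple
  \<open>q\<close> and \<open>r\<close>. The second term ignores \<open>q\<close> and the third
  ignores \<open>r\<close>, so the third disappears when two choices of \<open>r\<close> are
  compared.\<close>

lemma tri_count_tripartite:
  fixes U W Z V :: "'a set"
  defines "P \<equiv> (\<lambda>(u, w). {u, w}) ` (U \<times> W)" and "Q \<equiv> (\<lambda>(w, z). {w, z}) ` (W \<times> Z)"
  defines "Tr \<equiv> (\<lambda>(u, w, z). {u, w, z}) ` (U \<times> W \<times> Z)"
  assumes V: "finite V" "U \<subseteq> V" "W \<subseteq> V" "Z \<subseteq> V"
    and disj: "U \<inter> W = {}" "U \<inter> Z = {}" "W \<inter> Z = {}"
    and X: "q \<subseteq> Q" "r \<subseteq> P" "c \<subseteq> pairs V - P - Q"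
  shows "real (tri_count V (c \<union> q \<union> r))
    = (\<Sum>(w, z)\<in>W \<times> Z. of_bool ({w, z} \<in> q) * (\<Sum>u\<in>U. of_bool ({u, w} \<in> r) * of_bool ({u, z} \<in> c)))
    + real (card {T \<in> triples V - Tr. pairs T \<inter> Q = {} \<and> pairs T \<subseteq> c \<union> r})
    + real (card {T \<in> triples V - Tr. pairs T \<inter> Q \<noteq> {} \<and> pairs T \<subseteq> c \<union> q})"
proof -
  let ?f = "\<lambda>T. of_bool (pairs T \<subseteq> c \<union> q \<union> r) :: real"
  let ?Ta = "{T \<in> triples V - Tr. pairs T \<inter> Q = {}}" and ?Tb = "{T \<in> triples V - Tr. pairs T \<inter> Q \<noteq> {}}"
  have fin: "finite U" "finite W" "finite Z"
    by (rule finite_subset[OF _ V(1)], rule V)+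
  have pairs_uwz: "pairs {u, w, z} = {{u, w}, {u, z}, {w, z}}" if "u \<in> U" "w \<in> W" "z \<in> Z" for u w z
  proof -
    have ne: "u \<noteq> w" "u \<noteq> z" "w \<noteq> z" using that disj by auto
    have "pairs {z} = ({} :: 'a set set)" by (auto simp: pairs_def subset_singleton_iff)
    then have "pairs {w, z} = {{z, w}}" using ne pairs_insert[of w "{z}"] by simp
    then show ?thesis using ne pairs_insert[of u "{w, z}"] by (simp add: insert_commute)
  qed
  have Tr_sub: "Tr \<subseteq> triples V"
  proof
    fix T assume "T \<in> Tr"
    then obtain u w z where "T = {u, w, z}" "u \<in> U" "w \<in> W" "z \<in> Z" by (auto simp: Tr_def)
    moreover from this have "u \<noteq> w" "u \<noteq> z" "w \<noteq> z" using disj by auto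
    ultimately show "T \<in> triples V" using V by (auto simp: triples_def)
  qed
  \<comment> \<open>A triple with an edge in \<open>P\<close> and one in \<open>Q\<close> has
    vertices in \<open>U\<close>, \<open>W\<close> and \<open>Z\<close>, so it is transversal and
    was already removed.\<close>
  have noP: "pairs T \<inter> P = {}" if "T \<in> ?Tb" for T
  proof (rule ccontr)
    assume "pairs T \<inter> P \<noteq> {}"
    then obtain u w' where 1: "{u, w'} \<in> pairs T" "u \<in> U" "w' \<in> W" by (auto simp: P_def)
    have "pairs T \<inter> Q \<noteq> {}" using that by simp
    then obtain w z where 2: "{w, z} \<in> pairs T" "w \<in> W" "z \<in> Z" by (auto simp: Q_def)
    have "u \<noteq> w" "u \<noteq> z" "w \<noteq> z" using 1 2 disj by auto
    then have "card {u, w, z} = 3" by simp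
    moreover have "{u, w, z} \<subseteq> T" "card T = 3" "finite T"
      using 1 2 that triples_finite by (auto simp: pairs_def triples_def)
    ultimately have "T = {u, w, z}" using card_subset_eq by metis
    then have "T \<in> Tr" using 1 2 by (force simp: Tr_def)
    then show False using that by auto
  qed
  have "real (tri_count V (c \<union> q \<union> r)) = sum ?f (triples V)"
    by (rule real_tri_count[OF V(1)])
  also have "triples V = Tr \<union> (?Ta \<union> ?Tb)" using Tr_sub by auto
  also have "sum ?f \<dots> = sum ?f Tr + (sum ?f ?Ta + sum ?f ?Tb)"
    using V fin Tr_def by (subst sum.union_disjoint; (subst sum.union_disjoint)?) auto
  also have "sum ?f ?Ta = real (card {T \<in> triples V - Tr. pairs T \<inter> Q = {} \<and> pairs T \<subseteq> c \<union> r})"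
  proof -
    have "sum ?f ?Ta = (\<Sum>T\<in>?Ta. of_bool (pairs T \<subseteq> c \<union> r))"
      using X by (intro sum.cong refl arg_cong[where f = of_bool]) auto
    also have "?Ta \<inter> {T. pairs T \<subseteq> c \<union> r} = {T \<in> triples V - Tr. pairs T \<inter> Q = {} \<and> pairs T \<subseteq> c \<union> r}" by auto
    ultimately show ?thesis using V by simp
  qed
  also have "sum ?f ?Tb = real (card {T \<in> triples V - Tr. pairs T \<inter> Q \<noteq> {} \<and> pairs T \<subseteq> c \<union> q})"
  proof -
    have "sum ?f ?Tb = (\<Sum>T\<in>?Tb. of_bool (pairs T \<subseteq> c \<union> q))"
      using X noP by (intro sum.cong refl arg_cong[where f = of_bool]) fast
    also have "?Tb \<inter> {T. pairs T \<subseteq> c \<union> q} = {T \<in> triples V - Tr. pairs T \<inter> Q \<noteq> {} \<and> pairs T \<subseteq> c \<union> q}" by auto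
    ultimately show ?thesis using V by simp
  qed
  also have "sum ?f Tr = (\<Sum>(u, w, z)\<in>U \<times> W \<times> Z. ?f {u, w, z})"
  proof -
    have "inj_on (\<lambda>(u, w, z). {u, w, z}) (U \<times> W \<times> Z)"
    proof (rule inj_onI)
      fix x y assume xy: "x \<in> U \<times> W \<times> Z" "y \<in> U \<times> W \<times> Z"
        "(\<lambda>(u, w, z). {u, w, z}) x = (\<lambda>(u, w, z). {u, w, z}) y"
      obtain u w z u' w' z' where eq: "x = (u, w, z)" "y = (u', w', z')" by (metis prod_cases3)
      have a: "u \<in> U" "w \<in> W" "z \<in> Z" "u' \<in> U" "w' \<in> W" "z' \<in> Z" "{u, w, z} = {u', w', z'}"
        using xy unfolding eq by auto
      have "{u, w, z} \<inter> U = {u}" "{u, w, z} \<inter> W = {w}" "{u, w, z} \<inter> Z = {z}"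
        "{u', w', z'} \<inter> U = {u'}" "{u', w', z'} \<inter> W = {w'}" "{u', w', z'} \<inter> Z = {z'}"
        using a(1-6) disj by auto
      then show "x = y" using a(7) unfolding eq by auto
    qed
    from sum.reindex[OF this, of ?f] show ?thesis
      unfolding Tr_def by (simp add: comp_def case_prod_unfold)
  qed
  also have "\<dots> = (\<Sum>(u, w, z)\<in>U \<times> W \<times> Z. of_bool ({w, z} \<in> q) * (of_bool ({u, w} \<in> r) * of_bool ({u, z} \<in> c)))"
  proof (rule sum.cong[OF refl], clarify)
    fix u w z assume a: "u \<in> U" "w \<in> W" "z \<in> Z"
    then have ne: "u \<noteq> w" "u \<noteq> z" "w \<noteq> z" using disj by auto
    have 1: "{u, w} \<in> P" "{w, z} \<in> Q" using a by (auto simp: P_def Q_def)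
    have 2: "{u, w} \<notin> Q" "{w, z} \<notin> P" "{u, z} \<notin> P" "{u, z} \<notin> Q"
      using a disj by (auto simp: P_def Q_def doubleton_eq_iff)
    show "?f {u, w, z} = of_bool ({w, z} \<in> q) * (of_bool ({u, w} \<in> r) * of_bool ({u, z} \<in> c))"
      unfolding pairs_uwz[OF a] using 1 2 X by auto
  qed
  also have "\<dots> = (\<Sum>u\<in>U. \<Sum>(w, z)\<in>W \<times> Z. of_bool ({w, z} \<in> q) * (of_bool ({u, w} \<in> r) * of_bool ({u, z} \<in> c)))"
    by (simp only: sum.cartesian_product case_prod_unfold)
  also have "\<dots> = (\<Sum>(w, z)\<in>W \<times> Z. of_bool ({w, z} \<in> q) * (\<Sum>u\<in>U. of_bool ({u, w} \<in> r) * of_bool ({u, z} \<in> c)))"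
    by (subst sum.swap) (simp only: case_prod_unfold sum_distrib_left)
  finally show ?thesis by (simp only: add.assoc)
qed

section \<open>Laplace estimates after decoupling\<close>

context
  fixes p :: real
  assumes p: "0 < p" "p < 1"
begin

text \<open>Averages over the edges between \<open>U\<close> and \<open>Z\<close>. Different
  \<open>z\<close> are independent, and the condition on \<open>g\<close> keeps each exponent in
  [0, 1], so the exponential may be linearised and only second moments of linear forms are
  needed.\<close>

lemma quadratic_form_laplace:
  fixes x :: "'a \<Rightarrow> 'b \<Rightarrow> real" and Z :: "'c set"
  assumes fin: "finite U" "finite W" "finite Z" and x: "\<And>u w. \<bar>x u w\<bar> \<le> 1"
    and g: "0 \<le> g" "g * real (card W) * (real (card U))\<^sup>2 \<le> 1"
  shows "bern_exp p (U \<times> Z) (\<lambda>c. exp (- (g * (\<Sum>z\<in>Z. \<Sum>w\<in>W. (\<Sum>u\<in>U. x u w * of_bool ((u, z) \<in> c))\<^sup>2))))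
    \<le> exp (- (g * (p * (1 - p)) / 2 * real (card Z) * (\<Sum>w\<in>W. \<Sum>u\<in>U. (x u w)\<^sup>2)))"
proof -
  define A where "A z = (\<lambda>u. (u, z)) ` U" for z :: 'c
  define h where "h z c = exp (- (g * (\<Sum>w\<in>W. (\<Sum>u\<in>U. x u w * of_bool ((u, z) \<in> c))\<^sup>2)))" for z and c :: "('a \<times> 'c) set"
  let ?S = "\<Sum>w\<in>W. \<Sum>u\<in>U. (x u w)\<^sup>2"
  have A: "(\<Union>z\<in>Z. A z) = U \<times> Z" by (auto simp: A_def)
  have "bern_exp p (U \<times> Z) (\<lambda>c. exp (- (g * (\<Sum>z\<in>Z. \<Sum>w\<in>W. (\<Sum>u\<in>U. x u w * of_bool ((u, z) \<in> c))\<^sup>2))))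
      = bern_exp p (\<Union>z\<in>Z. A z) (\<lambda>c. \<Prod>z\<in>Z. h z (c \<inter> A z))"
  proof (intro bern_exp_cong A[symmetric])
    fix c
    have "exp (- (g * (\<Sum>z\<in>Z. \<Sum>w\<in>W. (\<Sum>u\<in>U. x u w * of_bool ((u, z) \<in> c))\<^sup>2))) = (\<Prod>z\<in>Z. h z c)"
      unfolding h_def using fin by (simp only: sum_distrib_left exp_sum flip: sum_negf)
    also have "\<dots> = (\<Prod>z\<in>Z. h z (c \<inter> A z))"
      unfolding h_def A_def
      by (intro prod.cong refl arg_cong[where f = exp] arg_cong[where f = uminus] arg_cong2[where f = "(*)"]
          sum.cong arg_cong2[where f = power] arg_cong[where f = of_bool]) auto
    finally show "exp (- (g * (\<Sum>z\<in>Z. \<Sum>w\<in>W. (\<Sum>u\<in>U. x u w * of_bool ((u, z) \<in> c))\<^sup>2))) = (\<Prod>z\<in>Z. h z (c \<inter> A z))" .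
  qed
  also have "\<dots> = (\<Prod>z\<in>Z. bern_exp p (A z) (h z))"
    using fin by (intro bern_exp_prod_groups) (auto simp: A_def disjoint_family_on_def)
  also have "\<dots> \<le> (\<Prod>z\<in>Z. exp (- (g * (p * (1 - p)) / 2 * ?S)))"
  proof (intro prod_mono conjI)
    fix z assume z: "z \<in> Z"
    let ?L = "\<lambda>w c. \<Sum>u\<in>U. x u w * of_bool (u \<in> c)"
    show "0 \<le> bern_exp p (A z) (h z)" by (intro bern_exp_nonneg p) (simp add: h_def)
    have inj: "inj_on (\<lambda>u. (u, z)) U" by (auto simp: inj_on_def)
    have "bern_exp p (A z) (h z) = bern_exp p U (\<lambda>c. h z ((\<lambda>u. (u, z)) ` c))"
      unfolding A_def by (rule bern_exp_image[OF inj])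
    also have "\<dots> = bern_exp p U (\<lambda>c. exp (- (g * (\<Sum>w\<in>W. (?L w c)\<^sup>2))))"
    proof (intro bern_exp_cong refl)
      fix c :: "'a set"
      have "(u, z) \<in> (\<lambda>u. (u, z)) ` c \<longleftrightarrow> u \<in> c" for u by auto
      then show "h z ((\<lambda>u. (u, z)) ` c) = exp (- (g * (\<Sum>w\<in>W. (?L w c)\<^sup>2)))" by (simp only: h_def)
    qed
    also have "\<dots> \<le> bern_exp p U (\<lambda>c. 1 - g / 2 * (\<Sum>w\<in>W. (?L w c)\<^sup>2))"
    proof (intro bern_exp_mono p)
      fix c
      have "(?L w c)\<^sup>2 \<le> (real (card U))\<^sup>2" for w
      proof -
        have "\<bar>?L w c\<bar> \<le> (\<Sum>u\<in>U. 1)"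
          using x by (intro order.trans[OF sum_abs] sum_mono) (auto simp: abs_mult of_bool_def)
        then show ?thesis by (intro power2_le_iff_abs_le[THEN iffD2]) auto
      qed
      then have "(\<Sum>w\<in>W. (?L w c)\<^sup>2) \<le> (\<Sum>w\<in>W. (real (card U))\<^sup>2)" by (intro sum_mono)
      then have "g * (\<Sum>w\<in>W. (?L w c)\<^sup>2) \<le> g * (\<Sum>w\<in>W. (real (card U))\<^sup>2)" using g by (intro mult_left_mono)
      then have "g * (\<Sum>w\<in>W. (?L w c)\<^sup>2) \<le> 1" using g by (simp only: sum_constant mult.assoc)
      moreover have "0 \<le> g * (\<Sum>w\<in>W. (?L w c)\<^sup>2)" using g by (intro mult_nonneg_nonneg sum_nonneg) auto
      ultimately show "exp (- (g * (\<Sum>w\<in>W. (?L w c)\<^sup>2))) \<le> 1 - g / 2 * (\<Sum>w\<in>W. (?L w c)\<^sup>2)"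
        using exp_minus_le_linear[of "g * (\<Sum>w\<in>W. (?L w c)\<^sup>2)"] by linarith
    qed
    also have "\<dots> = 1 - g / 2 * (\<Sum>w\<in>W. bern_exp p U (\<lambda>c. (?L w c)\<^sup>2))"
      unfolding bern_exp_diff bern_exp_mult_left bern_exp_sum bern_exp_const[OF fin(1)] ..
    \<comment> \<open>The squared mean in \<open>bern_exp_linear_square\<close> is dropped; the
      variance alone suffices whatever the signs of \<open>x\<close>.\<close>
    also have "\<dots> \<le> 1 - g / 2 * (\<Sum>w\<in>W. p * (1 - p) * (\<Sum>u\<in>U. (x u w)\<^sup>2))"
    proof (intro diff_left_mono mult_left_mono sum_mono)
      fix w
      show "p * (1 - p) * (\<Sum>u\<in>U. (x u w)\<^sup>2) \<le> bern_exp p U (\<lambda>c. (?L w c)\<^sup>2)"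
        unfolding bern_exp_linear_square[OF fin(1)] by simp
    qed (use g in simp)
    also have "\<dots> = 1 + - (g * (p * (1 - p)) / 2 * ?S)"
      by (simp add: sum_distrib_left mult.assoc)
    also have "\<dots> \<le> exp (- (g * (p * (1 - p)) / 2 * ?S))" by (rule exp_ge_add_one_self)
    finally show "bern_exp p (A z) (h z) \<le> exp (- (g * (p * (1 - p)) / 2 * ?S))" .
  qed
  also have "\<dots> = exp (- (g * (p * (1 - p)) / 2 * real (card Z) * ?S))"
    by (simp flip: exp_of_nat_mult)
  finally show ?thesis .
qed

text \<open>Two independent copies differ in a given coordinate with probability 2p(1-p),
  independently over coordinates, so the double mean is a product of one-coordinate factors.\<close>

lemma symmetrized_laplace:
  assumes fin: "finite A" and l: "0 \<le> l" "l \<le> 1"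
  shows "bern_exp p A (\<lambda>r. bern_exp p A (\<lambda>r'. exp (- (l * (\<Sum>a\<in>A. (of_bool (a \<in> r) - of_bool (a \<in> r'))\<^sup>2)))))
    \<le> exp (- (p * (1 - p) * l * real (card A)))"
proof -
  define h where "h x y = exp (- (l * (of_bool x - of_bool y)\<^sup>2))" for x y
  have "bern_exp p A (\<lambda>r. bern_exp p A (\<lambda>r'. exp (- (l * (\<Sum>a\<in>A. (of_bool (a \<in> r) - of_bool (a \<in> r'))\<^sup>2)))))
      = bern_exp p A (\<lambda>r. bern_exp p A (\<lambda>r'. \<Prod>a\<in>A. h (a \<in> r) (a \<in> r')))"
    unfolding h_def using fin by (simp only: sum_distrib_left exp_sum flip: sum_negf)
  also have "\<dots> = bern_exp p A (\<lambda>r. \<Prod>a\<in>A. (1 - p) *\<^sub>R h (a \<in> r) False + p *\<^sub>R h (a \<in> r) True)"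
    by (intro bern_exp_cong refl, subst bern_exp_prod[OF fin, where h = "\<lambda>a. h (a \<in> _)"]) simp
  also have "\<dots> = (\<Prod>a\<in>A. 1 - 2 * (p * (1 - p)) * (1 - exp (- l)))"
    by (subst bern_exp_prod[OF fin, where h = "\<lambda>a b. (1 - p) *\<^sub>R h b False + p *\<^sub>R h b True"])
      (intro prod.cong refl, simp add: h_def algebra_simps)
  also have "\<dots> \<le> (\<Prod>a\<in>A. exp (- (p * (1 - p) * l)))"
  proof (intro prod_mono conjI)
    \<comment> \<open>The bound 1/4 keeps every factor nonnegative, as needed to compare products
      factor by factor.\<close>
    have "p * (1 - p) = 1 / 4 - (p - 1 / 2)\<^sup>2" by (simp add: power2_eq_square algebra_simps)
    then have "p * (1 - p) \<le> 1 / 4" using zero_le_power2[of "p - 1 / 2"] by linarith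
    moreover have "0 \<le> p * (1 - p)" using p by simp
    ultimately have q: "0 \<le> p * (1 - p)" "p * (1 - p) \<le> 1 / 4" by auto
    then have "2 * (p * (1 - p)) * (1 - exp (- l)) \<le> 1 * 1"
      using l by (intro mult_mono) auto
    then show "0 \<le> 1 - 2 * (p * (1 - p)) * (1 - exp (- l))" by simp
    have "1 - 2 * (p * (1 - p)) * (1 - exp (- l)) \<le> 1 - 2 * (p * (1 - p)) * (l / 2)"
      using exp_minus_le_linear[OF l] q by (intro diff_left_mono mult_left_mono) auto
    also have "\<dots> \<le> exp (- (p * (1 - p) * l))"
      using exp_ge_add_one_self[of "- (p * (1 - p) * l)"] by simp
    finally show "1 - 2 * (p * (1 - p)) * (1 - exp (- l)) \<le> exp (- (p * (1 - p) * l))" .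
  qed
  also have "\<dots> = exp (- (p * (1 - p) * l * real (card A)))"
    by (simp add: mult.commute flip: exp_of_nat_mult)
  finally show ?thesis .
qed

text \<open>The parameter \<open>s\<close> may be smaller than \<open>t\<^sup>2\<close>, so that one choice of \<open>U\<close>, \<open>W\<close>, \<open>Z\<close> serves a whole range
  of \<open>t\<close>.\<close>

lemma tri_char_tripartite_bound:
  fixes V :: "'a set"
  assumes V: "finite V" "U \<subseteq> V" "W \<subseteq> V" "Z \<subseteq> V"
    and disj: "U \<inter> W = {}" "U \<inter> Z = {}" "W \<inter> Z = {}"
    and s: "0 \<le> s" "s \<le> t\<^sup>2" "s * real (card W) * (real (card U))\<^sup>2 \<le> 1" "s * real (card Z) \<le> 1"
    and t: "\<bar>t\<bar> * real (card U) \<le> pi"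
  shows "(norm (tri_char p V t))\<^sup>2
    \<le> exp (- ((p * (1 - p)) ^ 3 / 32 * s * real (card U) * real (card W) * real (card Z)))"
proof -
  define fP where "fP = (\<lambda>(u, w). {u, w} :: 'a set)"
  \<comment> \<open>The edges in \<open>P\<close> get duplicated, those in \<open>Q\<close> carry
    the linear phase, and those in \<open>O'\<close>, which are part of the conditioning set
    \<open>C\<close>, are averaged next. The average over the two copies of \<open>P\<close> comes
    last.\<close>
  define P Q O' where "P = fP ` (U \<times> W)" and "Q = fP ` (W \<times> Z)" and "O' = fP ` (U \<times> Z)"
  define C where "C = pairs V - P - Q"
  define g where "g = p * (1 - p) / 16"
  define D where "D c r r' w z = (\<Sum>u\<in>U. (of_bool ((u, w) \<in> r) - of_bool ((u, w) \<in> r')) * of_bool ({u, z} \<in> c) :: real)"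
    for c :: "'a set set" and r r' :: "('a \<times> 'a) set" and w z
  define e where "e c q r = iexp (t * real (tri_count V (c \<union> fP ` q \<union> fP ` r)))" for c q r
  have "p * (1 - p) \<le> 1" using p by (intro mult_le_one) auto
  then have pq: "0 \<le> p * (1 - p)" "p * (1 - p) \<le> 1" and g: "0 \<le> g" "g \<le> 1" using p by (auto simp: g_def)
  have fin: "finite U" "finite W" "finite Z"
    by (rule finite_subset[OF _ V(1)], rule V)+
  have inj: "inj_on fP (U \<times> W)" "inj_on fP (W \<times> Z)" "inj_on fP (U \<times> Z)"
    unfolding fP_def using disj by (auto intro: inj_on_doubleton)
  have sub: "P \<subseteq> pairs V" "Q \<subseteq> pairs V" "O' \<subseteq> pairs V"
    using V disj by (auto simp: P_def Q_def O'_def fP_def pairs_def card_insert_if)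
  have dis: "P \<inter> Q = {}" "O' \<inter> P = {}" "O' \<inter> Q = {}"
    using disj by (auto simp: P_def Q_def O'_def fP_def doubleton_eq_iff)
  have finPQ: "finite P" "finite Q" "finite C" "finite O'"
    using fin V by (auto simp: P_def Q_def C_def O'_def)
  have O_sub: "O' \<subseteq> C" using sub dis by (auto simp: C_def)

  have "tri_char p V t = bern_exp p ((C \<union> Q) \<union> P) (\<lambda>X. iexp (t * real (tri_count V X)))"
    unfolding tri_char_def using sub by (intro bern_exp_cong) (auto simp: C_def)
  also have "\<dots> = bern_exp p (C \<union> Q) (\<lambda>X. bern_exp p P (\<lambda>r. iexp (t * real (tri_count V (X \<union> r)))))"
    using finPQ dis by (intro bern_exp_union) (auto simp: C_def)
  also have "\<dots> = bern_exp p C (\<lambda>c. bern_exp p Q (\<lambda>q. bern_exp p P (\<lambda>r. iexp (t * real (tri_count V (c \<union> q \<union> r))))))"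
    using finPQ by (intro bern_exp_union) (auto simp: C_def)
  also have "\<dots> = bern_exp p C (\<lambda>c. bern_exp p (W \<times> Z) (\<lambda>q. bern_exp p (U \<times> W) (e c q)))"
    unfolding P_def Q_def bern_exp_image[OF inj(1)] bern_exp_image[OF inj(2)] e_def ..
  finally have "(norm (tri_char p V t))\<^sup>2 \<le> bern_exp p C (\<lambda>c. bern_exp p (U \<times> W) (\<lambda>r. bern_exp p (U \<times> W) (\<lambda>r'.
        norm (bern_exp p (W \<times> Z) (\<lambda>q. e c q r * cnj (e c q r'))))))"
    using bern_exp_decoupling[OF p, of C "W \<times> Z" "U \<times> W" e] finPQ fin by simp
  also have "\<dots> \<le> bern_exp p C (\<lambda>c. bern_exp p (U \<times> W) (\<lambda>r. bern_exp p (U \<times> W) (\<lambda>r'.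
        exp (- (g * s * (\<Sum>z\<in>Z. \<Sum>w\<in>W. (D c r r' w z)\<^sup>2))))))"
  proof (intro bern_exp_mono p)
    fix c r r' assume c: "c \<subseteq> C" and r: "r \<subseteq> U \<times> W" and r': "r' \<subseteq> U \<times> W"
    let ?a = "\<lambda>wz. t * D c r r' (fst wz) (snd wz)"
    define k where "k r = real (card {T \<in> triples V - (\<lambda>(u, w, z). {u, w, z}) ` (U \<times> W \<times> Z). pairs T \<inter> Q = {} \<and> pairs T \<subseteq> c \<union> fP ` r})" for r
    have mem: "{u, w} \<in> fP ` r \<longleftrightarrow> (u, w) \<in> r" if "r \<subseteq> U \<times> W" "u \<in> U" "w \<in> W" for u w r
      using inj_on_image_mem_iff[OF inj(1), of "(u, w)" r] that by (simp add: fP_def)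
    have mem': "{w, z} \<in> fP ` q \<longleftrightarrow> (w, z) \<in> q" if "q \<subseteq> W \<times> Z" "w \<in> W" "z \<in> Z" for w z q
      using inj_on_image_mem_iff[OF inj(2), of "(w, z)" q] that by (simp add: fP_def)
    \<comment> \<open>The count \<open>b\<close> is common to both copies and cancels;
      \<open>k r - k r'\<close> does not involve \<open>q\<close>. What remains is linear in
      \<open>q\<close>, with coefficients that are differences of two identically distributed
      quantities.\<close>
    have "e c q r * cnj (e c q r') = iexp (t * (k r - k r') + (\<Sum>wz\<in>W \<times> Z. of_bool (wz \<in> q) * ?a wz))"
      if q: "q \<subseteq> W \<times> Z" for q
    proof -
      define b where "b = real (card {T \<in> triples V - (\<lambda>(u, w, z). {u, w, z}) ` (U \<times> W \<times> Z). pairs T \<inter> Q \<noteq> {} \<and> pairs T \<subseteq> c \<union> fP ` q})"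
      define N where "N r = (\<Sum>wz\<in>W \<times> Z. of_bool (wz \<in> q) * (\<Sum>u\<in>U. of_bool ((u, fst wz) \<in> r) * of_bool ({u, snd wz} \<in> c) :: real))" for r
      have count: "real (tri_count V (c \<union> fP ` q \<union> fP ` r)) = N r + k r + b" if r: "r \<subseteq> U \<times> W" for r
      proof -
        have "real (tri_count V (c \<union> fP ` q \<union> fP ` r)) =
          (\<Sum>(w, z)\<in>W \<times> Z. of_bool ({w, z} \<in> fP ` q) * (\<Sum>u\<in>U. of_bool ({u, w} \<in> fP ` r) * of_bool ({u, z} \<in> c))) + k r + b"
          unfolding k_def b_def Q_def fP_def
          by (rule tri_count_tripartite[OF V disj])
            (use q r c in \<open>auto simp: C_def P_def Q_def fP_def\<close>)
        also have "(\<Sum>(w, z)\<in>W \<times> Z. of_bool ({w, z} \<in> fP ` q) * (\<Sum>u\<in>U. of_bool ({u, w} \<in> fP ` r) * of_bool ({u, z} \<in> c))) = N r"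
          unfolding N_def
        proof (rule sum.cong[OF refl], clarify)
          fix w z assume wz: "w \<in> W" "z \<in> Z"
          have "(\<Sum>u\<in>U. of_bool ({u, w} \<in> fP ` r) * of_bool ({u, z} \<in> c)) = (\<Sum>u\<in>U. of_bool ((u, w) \<in> r) * of_bool ({u, z} \<in> c) :: real)"
            using mem[OF r _ wz(1)] by (intro sum.cong refl) simp
          then show "of_bool ({w, z} \<in> fP ` q) * (\<Sum>u\<in>U. of_bool ({u, w} \<in> fP ` r) * of_bool ({u, z} \<in> c))
            = of_bool ((w, z) \<in> q) * (\<Sum>u\<in>U. of_bool ((u, fst (w, z)) \<in> r) * of_bool ({u, snd (w, z)} \<in> c) :: real)"
            using mem'[OF q wz] by simp
        qed
        finally show ?thesis .
      qed
      have diff: "(\<Sum>wz\<in>W \<times> Z. of_bool (wz \<in> q) * ?a wz) = t * (N r - N r')"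
        unfolding N_def D_def sum_subtractf[symmetric] sum_distrib_left
        by (intro sum.cong refl) (simp only: algebra_simps sum_subtractf sum_distrib_left)
      have "e c q r * cnj (e c q r') = iexp (t * (N r + k r + b) + - (t * (N r' + k r' + b)))"
        unfolding e_def count[OF r] count[OF r'] by (simp only: iexp_mult_cnj diff_conv_add_uminus)
      also have "t * (N r + k r + b) + - (t * (N r' + k r' + b)) = t * (k r - k r') + (\<Sum>wz\<in>W \<times> Z. of_bool (wz \<in> q) * ?a wz)"
        unfolding diff by (simp add: algebra_simps)
      finally show ?thesis .
    qed
    then have "norm (bern_exp p (W \<times> Z) (\<lambda>q. e c q r * cnj (e c q r')))
      = norm (bern_exp p (W \<times> Z) (\<lambda>q. iexp (t * (k r - k r') + (\<Sum>wz\<in>W \<times> Z. of_bool (wz \<in> q) * ?a wz))))"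
      by (intro arg_cong[where f = norm] bern_exp_cong) auto
    also have "\<dots> = (\<Prod>wz\<in>W \<times> Z. norm ((1 - p) *\<^sub>R 1 + p *\<^sub>R iexp (?a wz)))"
      unfolding bern_exp_iexp_linear[OF finite_cartesian_product[OF fin(2,3)]] by (simp add: norm_mult prod_norm)
    also have "\<dots> \<le> (\<Prod>wz\<in>W \<times> Z. exp (- (g * s * (D c r r' (fst wz) (snd wz))\<^sup>2)))"
    proof (intro prod_mono conjI norm_ge_zero)
      fix wz
      have "\<bar>D c r r' (fst wz) (snd wz)\<bar> \<le> (\<Sum>u\<in>U. 1)"
        unfolding D_def by (intro order.trans[OF sum_abs] sum_mono) (auto simp: abs_mult of_bool_def)
      then have "\<bar>t\<bar> * \<bar>D c r r' (fst wz) (snd wz)\<bar> \<le> \<bar>t\<bar> * real (card U)" by (intro mult_left_mono) auto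
      then have "\<bar>?a wz\<bar> \<le> pi" using t by (simp add: abs_mult)
      then have "norm ((1 - p) *\<^sub>R 1 + p *\<^sub>R iexp (?a wz)) \<le> exp (- (g * (?a wz)\<^sup>2))"
        unfolding g_def by (rule norm_bernoulli_char_le[OF p])
      also have "\<dots> \<le> exp (- (g * s * (D c r r' (fst wz) (snd wz))\<^sup>2))"
        using mult_right_mono[OF s(2), of "(D c r r' (fst wz) (snd wz))\<^sup>2"] g
        by (auto simp: power_mult_distrib mult.assoc intro!: mult_left_mono)
      finally show "norm ((1 - p) *\<^sub>R 1 + p *\<^sub>R iexp (?a wz)) \<le> exp (- (g * s * (D c r r' (fst wz) (snd wz))\<^sup>2))" .
    qed
    also have "\<dots> = exp (- (g * s * (\<Sum>wz\<in>W \<times> Z. (D c r r' (fst wz) (snd wz))\<^sup>2)))"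
      using fin by (simp add: sum_distrib_left exp_sum flip: sum_negf)
    also have "(\<Sum>wz\<in>W \<times> Z. (D c r r' (fst wz) (snd wz))\<^sup>2) = (\<Sum>z\<in>Z. \<Sum>w\<in>W. (D c r r' w z)\<^sup>2)"
      by (subst sum.swap) (simp add: sum.cartesian_product case_prod_unfold)
    finally show "norm (bern_exp p (W \<times> Z) (\<lambda>q. e c q r * cnj (e c q r')))
      \<le> exp (- (g * s * (\<Sum>z\<in>Z. \<Sum>w\<in>W. (D c r r' w z)\<^sup>2)))" .
  qed
  \<comment> \<open>With absolute values taken, the mean over \<open>c\<close> may be moved
    innermost, so that \<open>r\<close> and \<open>r'\<close> act as fixed coefficients of the
    quadratic form.\<close>
  also have "\<dots> = bern_exp p (U \<times> W) (\<lambda>r. bern_exp p (U \<times> W) (\<lambda>r'. bern_exp p C (\<lambda>c.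
        exp (- (g * s * (\<Sum>z\<in>Z. \<Sum>w\<in>W. (D c r r' w z)\<^sup>2))))))"
    by (simp add: bern_exp_swap[of p C])
  also have "\<dots> \<le> bern_exp p (U \<times> W) (\<lambda>r. bern_exp p (U \<times> W) (\<lambda>r'.
      exp (- (g * s * (p * (1 - p)) / 2 * real (card Z) * (\<Sum>a\<in>U \<times> W. (of_bool (a \<in> r) - of_bool (a \<in> r'))\<^sup>2)))))"
  proof (intro bern_exp_mono p)
    fix r r' :: "('a \<times> 'a) set"
    let ?x = "\<lambda>u w. of_bool ((u, w) \<in> r) - of_bool ((u, w) \<in> r') :: real"
    have "bern_exp p C (\<lambda>c. exp (- (g * s * (\<Sum>z\<in>Z. \<Sum>w\<in>W. (D c r r' w z)\<^sup>2))))
      = bern_exp p C (\<lambda>c. exp (- (g * s * (\<Sum>z\<in>Z. \<Sum>w\<in>W. (D (c \<inter> O') r r' w z)\<^sup>2))))"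
    proof (intro bern_exp_cong refl arg_cong[where f = exp] arg_cong[where f = uminus] arg_cong2[where f = "(*)"]
          sum.cong arg_cong2[where f = power])
      fix c z w assume "z \<in> Z"
      then show "D c r r' w z = D (c \<inter> O') r r' w z"
        unfolding D_def by (intro sum.cong refl) (auto simp: O'_def fP_def)
    qed
    also have "\<dots> = bern_exp p O' (\<lambda>c. exp (- (g * s * (\<Sum>z\<in>Z. \<Sum>w\<in>W. (D c r r' w z)\<^sup>2))))"
      by (rule bern_exp_restrict[OF finPQ(3) O_sub])
    also have "\<dots> = bern_exp p (U \<times> Z) (\<lambda>c. exp (- (g * s * (\<Sum>z\<in>Z. \<Sum>w\<in>W. (D (fP ` c) r r' w z)\<^sup>2))))"
      unfolding O'_def by (rule bern_exp_image[OF inj(3)])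
    also have "\<dots> = bern_exp p (U \<times> Z) (\<lambda>c. exp (- (g * s * (\<Sum>z\<in>Z. \<Sum>w\<in>W. (\<Sum>u\<in>U. ?x u w * of_bool ((u, z) \<in> c))\<^sup>2))))"
    proof (intro bern_exp_cong refl arg_cong[where f = exp] arg_cong[where f = uminus] arg_cong2[where f = "(*)"]
          sum.cong arg_cong2[where f = power])
      fix c z w assume c: "c \<subseteq> U \<times> Z" "z \<in> Z"
      have "{u, z} \<in> fP ` c \<longleftrightarrow> (u, z) \<in> c" if "u \<in> U" for u
        using inj_on_image_mem_iff[OF inj(3), of "(u, z)" c] that c by (simp add: fP_def)
      then show "D (fP ` c) r r' w z = (\<Sum>u\<in>U. ?x u w * of_bool ((u, z) \<in> c))"
        unfolding D_def by (intro sum.cong refl) simp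
    qed
    also have "\<dots> \<le> exp (- (g * s * (p * (1 - p)) / 2 * real (card Z) * (\<Sum>w\<in>W. \<Sum>u\<in>U. (?x u w)\<^sup>2)))"
    proof (rule quadratic_form_laplace[OF fin])
      have "g * (s * real (card W) * (real (card U))\<^sup>2) \<le> 1"
        using s by (intro mult_le_one[OF g(2) _ s(3)]) auto
      then show "g * s * real (card W) * (real (card U))\<^sup>2 \<le> 1" by (simp only: mult.assoc)
    qed (use g s in \<open>auto simp: of_bool_def\<close>)
    also have "(\<Sum>w\<in>W. \<Sum>u\<in>U. (?x u w)\<^sup>2) = (\<Sum>a\<in>U \<times> W. (of_bool (a \<in> r) - of_bool (a \<in> r'))\<^sup>2)"
      by (subst sum.swap) (simp add: sum.cartesian_product case_prod_unfold)
    finally show "bern_exp p C (\<lambda>c. exp (- (g * s * (\<Sum>z\<in>Z. \<Sum>w\<in>W. (D c r r' w z)\<^sup>2))))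
      \<le> exp (- (g * s * (p * (1 - p)) / 2 * real (card Z) * (\<Sum>a\<in>U \<times> W. (of_bool (a \<in> r) - of_bool (a \<in> r'))\<^sup>2)))" .
  qed
  also have "\<dots> \<le> exp (- (p * (1 - p) * (g * s * (p * (1 - p)) / 2 * real (card Z)) * real (card (U \<times> W))))"
  proof (rule symmetrized_laplace)
    have "(g * (p * (1 - p))) * (s * real (card Z)) \<le> 1"
      using s by (intro mult_le_one[OF mult_le_one[OF g(2) pq] _ s(4)]) auto
    then show "g * s * (p * (1 - p)) / 2 * real (card Z) \<le> 1" by (simp add: mult_ac)
  qed (use fin g s pq in auto)
  \<comment> \<open>Each of the three averages contributes one factor p(1-p); 32 is 16 from the
    characteristic function times 2 from linearising the quadratic form.\<close>
  also have "p * (1 - p) * (g * s * (p * (1 - p)) / 2 * real (card Z)) * real (card (U \<times> W))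
    = (p * (1 - p)) ^ 3 / 32 * s * real (card U) * real (card W) * real (card Z)"
    unfolding g_def by (simp add: card_cartesian_product power3_eq_cube)
  finally show ?thesis .
qed

end

section \<open>The central range and Fourier inversion\<close>

lemma exp_minus_quadratic_error:
  fixes x :: real
  assumes "0 \<le> x"
  shows "\<bar>exp (- x) - (1 - x)\<bar> \<le> x\<^sup>2 / 2"
proof -
  have "exp (- x) \<le> 1 / (1 + x + x\<^sup>2 / 2)"
    using assms exp_lower_Taylor_quadratic[of x] by (simp add: exp_minus field_simps add_pos_nonneg)
  also have "\<dots> \<le> 1 - x + x\<^sup>2 / 2"
  proof -
    \<comment> \<open>The two quadratics are the factors of 1 + x^4/4, which is at least 1.\<close>
    have "(1 - x + x\<^sup>2 / 2) * (1 + x + x\<^sup>2 / 2) = 1 + (x\<^sup>2)\<^sup>2 / 4"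
      by (simp add: power2_eq_square algebra_simps)
    then have "1 \<le> (1 - x + x\<^sup>2 / 2) * (1 + x + x\<^sup>2 / 2)" by simp
    moreover have "0 < 1 + x + x\<^sup>2 / 2" using assms by (simp add: add_pos_nonneg)
    ultimately show ?thesis by (simp add: pos_divide_le_eq)
  qed
  finally show ?thesis using exp_ge_add_one_self[of "- x"] by simp
qed

context
  fixes p :: real
  assumes p: "0 < p" "p < 1"
begin

text \<open>Both functions agree with 1 - p(1-p)u^2/2 to second order, the linear term vanishing by
  centring. The errors 1/6 and 1/2 add up to less than 1.\<close>

lemma centered_bernoulli_char:
  assumes "\<bar>u\<bar> \<le> 1"
  shows "norm ((1 - p) *\<^sub>R iexp (- (p * u)) + p *\<^sub>R iexp ((1 - p) * u)
    - exp (- (p * (1 - p) * u\<^sup>2 / 2))) \<le> \<bar>u\<bar> ^ 3"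
proof -
  let ?R = "\<lambda>x. iexp x - (1 + \<i> * complex_of_real x - (complex_of_real x)\<^sup>2 / 2)"
  define v where "v = p * (1 - p) * u\<^sup>2 / 2"
  have "p * (1 - p) \<le> 1" using p by (intro mult_le_one) auto
  then have v: "0 \<le> v" "v \<le> u\<^sup>2 / 2" using p by (auto simp: v_def intro!: mult_left_le_one_le)
  have "(1 - p) *\<^sub>R iexp (- (p * u)) + p *\<^sub>R iexp ((1 - p) * u) - exp (- v)
      = (1 - p) *\<^sub>R ?R (- (p * u)) + p *\<^sub>R ?R ((1 - p) * u) - complex_of_real (exp (- v) - (1 - v))"
    by (simp add: v_def scaleR_conv_of_real algebra_simps power2_eq_square) (simp add: field_simps)
  also have "norm \<dots> \<le> (1 - p) * (\<bar>u\<bar> ^ 3 / 6) + p * (\<bar>u\<bar> ^ 3 / 6) + \<bar>u\<bar> ^ 3 / 2"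
  proof (intro order.trans[OF norm_triangle_ineq4] order.trans[OF norm_triangle_ineq] add_mono)
    have R: "norm (?R (a * u)) \<le> \<bar>u\<bar> ^ 3 / 6" if "\<bar>a\<bar> \<le> 1" for a
    proof -
      have "norm (?R (a * u)) \<le> \<bar>a * u\<bar> ^ 3 / 6" using norm_iexp_quadratic_error[of "a * u"] by simp
      also have "\<bar>a * u\<bar> ^ 3 \<le> \<bar>u\<bar> ^ 3"
        using that by (intro power_mono) (auto simp: abs_mult mult_left_le_one_le)
      finally show ?thesis by simp
    qed
    show "norm ((1 - p) *\<^sub>R ?R (- (p * u))) \<le> (1 - p) * (\<bar>u\<bar> ^ 3 / 6)"
      using R[of "- p"] p by (simp del: of_real_minus of_real_mult)
    show "norm (p *\<^sub>R ?R ((1 - p) * u)) \<le> p * (\<bar>u\<bar> ^ 3 / 6)"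
      using R[of "1 - p"] p by (simp del: of_real_diff of_real_mult)
    have "v\<^sup>2 \<le> (u\<^sup>2 / 2)\<^sup>2" using v by (intro power_mono) auto
    also have "(u\<^sup>2 / 2)\<^sup>2 = \<bar>u\<bar> ^ 3 * \<bar>u\<bar> / 4" by (simp add: power_divide eval_nat_numeral flip: abs_mult)
    also have "\<dots> \<le> \<bar>u\<bar> ^ 3 * 1 / 4" using assms by (intro divide_right_mono mult_left_mono) auto
    finally have "v\<^sup>2 \<le> \<bar>u\<bar> ^ 3 * 1 / 4" .
    moreover have "0 \<le> \<bar>u\<bar> ^ 3" by simp
    ultimately have "v\<^sup>2 \<le> \<bar>u\<bar> ^ 3" by linarith
    then show "norm (complex_of_real (exp (- v) - (1 - v))) \<le> \<bar>u\<bar> ^ 3 / 2"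
      using exp_minus_quadratic_error[OF v(1)] unfolding norm_of_real by linarith
  qed
  also have "\<dots> \<le> \<bar>u\<bar> ^ 3" by (simp add: field_simps)
  finally show ?thesis unfolding v_def by simp
qed

lemma tri_var_bounds:
  assumes "finite V"
  defines "L \<equiv> (real (card V - 2) * p\<^sup>2)\<^sup>2 * (p * (1 - p) * real (card V choose 2))"
  shows "L \<le> tri_var p V" "tri_var p V \<le> L + 16 * real (card V) ^ 3"
  using tri_count_variance[OF assms(1), of p] tri_rem_second_moment[OF p assms(1)]
    bern_exp_nonneg[OF p, of "pairs V" "\<lambda>X. (tri_rem p V X)\<^sup>2"]
  by (auto simp: L_def)

text \<open>The three terms bound three replacements: the count by its linear projection, the
  product of Bernoulli characteristic functions by a Gaussian one, and the variance of the linear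
  part by the full variance.\<close>

lemma tri_char_central:
  assumes V: "finite V" and t: "\<bar>t\<bar> * real (card V) \<le> 1"
  shows "norm (iexp (- (t * tri_mean p V)) * tri_char p V t - exp (- (tri_var p V * t\<^sup>2 / 2)))
    \<le> 4 * \<bar>t\<bar> * sqrt (real (card V) ^ 3) + (real (card V))\<^sup>2 * (\<bar>t\<bar> * real (card V)) ^ 3
      + 8 * t\<^sup>2 * real (card V) ^ 3"
proof -
  let ?n = "real (card V)" and ?N = "card (pairs V)" and ?E = "pairs V"
  define k where "k = real (card V - 2) * p\<^sup>2"
  define u where "u = t * k"
  define L where "L = k\<^sup>2 * (p * (1 - p) * real (card V choose 2))"
  define m where "m = tri_mean p V"
  define ph where "ph = (1 - p) *\<^sub>R iexp (- (p * u)) + p *\<^sub>R iexp ((1 - p) * u)"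
  define ga where "ga = complex_of_real (exp (- (p * (1 - p) * u\<^sup>2 / 2)))"
  let ?l = "\<lambda>X. - (p * u * real ?N) + (\<Sum>e\<in>?E. of_bool (e \<in> X) * u)"
  have "k \<le> ?n * 1" unfolding k_def using p by (intro mult_mono) (auto simp: power_le_one)
  then have k: "0 \<le> k" "k \<le> ?n" unfolding k_def by auto
  have u: "\<bar>u\<bar> \<le> \<bar>t\<bar> * ?n" unfolding u_def using k by (simp add: abs_mult mult_left_mono)
  then have u1: "\<bar>u\<bar> \<le> 1" using t by simp
  have NC: "real ?N = real (card V choose 2)" using V by (simp add: card_pairs)

  have lin: "bern_exp p ?E (\<lambda>X. iexp (?l X)) = ph ^ ?N"
  proof -
    have "bern_exp p ?E (\<lambda>X. iexp (?l X)) = iexp (- (p * u * real ?N)) * ((1 - p) *\<^sub>R 1 + p *\<^sub>R iexp u) ^ ?N"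
      unfolding bern_exp_iexp_linear[OF finite_pairs[OF V]] by simp
    also have "iexp (- (p * u * real ?N)) = iexp (- (p * u)) ^ ?N"
      by (simp add: mult_ac flip: exp_of_nat_mult)
    also have "iexp (- (p * u)) ^ ?N * ((1 - p) *\<^sub>R 1 + p *\<^sub>R iexp u) ^ ?N
        = (iexp (- (p * u)) * ((1 - p) *\<^sub>R 1 + p *\<^sub>R iexp u)) ^ ?N"
      by (rule power_mult_distrib[symmetric])
    also have "iexp (- (p * u)) * ((1 - p) *\<^sub>R 1 + p *\<^sub>R iexp u) = ph"
    proof -
      have "iexp (- (p * u)) * iexp u = iexp ((1 - p) * u)"
        by (simp add: algebra_simps flip: exp_add)
      then show ?thesis by (simp add: ph_def distrib_left)
    qed
    finally show ?thesis .
  qed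
  have "iexp (- (t * m)) * tri_char p V t = bern_exp p ?E (\<lambda>X. iexp (?l X + t * tri_rem p V X))"
    unfolding tri_char_def bern_exp_mult_left[symmetric]
  proof (intro bern_exp_cong refl)
    fix X
    have centered: "(\<Sum>e\<in>?E. of_bool (e \<in> X) - p) = (\<Sum>e\<in>?E. of_bool (e \<in> X)) - p * real ?N"
      by (simp only: sum_subtractf sum_constant mult.commute)
    have "- (t * m) + t * real (tri_count V X) = ?l X + t * tri_rem p V X"
      unfolding tri_count_decomp[OF V, of X p] centered m_def tri_mean_def u_def k_def sum_distrib_right[symmetric]
      by (simp only: algebra_simps)
    then show "iexp (- (t * m)) * iexp (t * real (tri_count V X)) = iexp (?l X + t * tri_rem p V X)"
      by (simp only: exp_add[symmetric] distrib_left[symmetric] of_real_add[symmetric])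
  qed
  also have "\<dots> = bern_exp p ?E (\<lambda>X. iexp (?l X + t * tri_rem p V X) - iexp (?l X)) + ph ^ ?N"
    by (simp only: bern_exp_diff lin diff_add_cancel)
  finally have eq: "iexp (- (t * m)) * tri_char p V t - exp (- (tri_var p V * t\<^sup>2 / 2))
    = bern_exp p ?E (\<lambda>X. iexp (?l X + t * tri_rem p V X) - iexp (?l X)) + (ph ^ ?N - ga ^ ?N)
      + (ga ^ ?N - exp (- (tri_var p V * t\<^sup>2 / 2)))" by simp

  have 1: "norm (bern_exp p ?E (\<lambda>X. iexp (?l X + t * tri_rem p V X) - iexp (?l X))) \<le> 4 * \<bar>t\<bar> * sqrt (?n ^ 3)"
  proof -
    have "norm (bern_exp p ?E (\<lambda>X. iexp (?l X + t * tri_rem p V X) - iexp (?l X)))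
        \<le> bern_exp p ?E (\<lambda>X. \<bar>t * tri_rem p V X\<bar>)"
      by (intro order.trans[OF norm_bern_exp_le[OF p]] bern_exp_mono p norm_iexp_diff_le)
    also have "\<dots> = \<bar>t\<bar> * bern_exp p ?E (\<lambda>X. \<bar>tri_rem p V X\<bar>)"
      by (simp only: abs_mult bern_exp_mult_left)
    also have "\<dots> \<le> \<bar>t\<bar> * (4 * sqrt (?n ^ 3))"
      using tri_rem_abs_moment[OF p V] by (intro mult_left_mono) auto
    finally show ?thesis by simp
  qed
  have 2: "norm (ph ^ ?N - ga ^ ?N) \<le> ?n\<^sup>2 * (\<bar>t\<bar> * ?n) ^ 3"
  proof -
    have "norm ph \<le> (1 - p) * 1 + p * 1"
      unfolding ph_def using p by (intro order.trans[OF norm_triangle_ineq] add_mono) auto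
    moreover have "norm ga \<le> 1" unfolding ga_def using p by simp
    \<comment> \<open>Telescoping of powers; it needs both bases in the closed unit disc.\<close>
    ultimately have "norm (ph ^ ?N - ga ^ ?N) \<le> real ?N * norm (ph - ga)"
      by (intro norm_power_diff) auto
    also have "\<dots> \<le> ?n\<^sup>2 * \<bar>u\<bar> ^ 3"
      using centered_bernoulli_char[OF u1] real_choose_two_le[of "card V"] NC
      unfolding ph_def ga_def by (intro mult_mono) auto
    also have "\<dots> \<le> ?n\<^sup>2 * (\<bar>t\<bar> * ?n) ^ 3"
      using u by (intro mult_left_mono power_mono) auto
    finally show ?thesis .
  qed
  have 3: "norm (ga ^ ?N - exp (- (tri_var p V * t\<^sup>2 / 2))) \<le> 8 * t\<^sup>2 * ?n ^ 3"
  proof -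
    have "ga ^ ?N = complex_of_real (exp (- (L * t\<^sup>2 / 2)))"
      unfolding ga_def L_def u_def NC[symmetric]
      by (simp add: power_mult_distrib mult_ac flip: exp_of_nat_mult of_real_power)
    then have "norm (ga ^ ?N - exp (- (tri_var p V * t\<^sup>2 / 2))) = \<bar>exp (- (L * t\<^sup>2 / 2)) - exp (- (tri_var p V * t\<^sup>2 / 2))\<bar>"
      by (simp only: of_real_diff[symmetric] norm_of_real)
    also have "\<dots> \<le> tri_var p V * t\<^sup>2 / 2 - L * t\<^sup>2 / 2"
    proof -
      have L: "0 \<le> L" "L \<le> tri_var p V" using p tri_var_bounds(1)[OF V] by (auto simp: L_def k_def)
      define d where "d = tri_var p V * t\<^sup>2 / 2 - L * t\<^sup>2 / 2"
      have d: "0 \<le> d" unfolding d_def using L mult_right_mono[OF L(2), of "t\<^sup>2"] by simp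
      have "exp (- (L * t\<^sup>2 / 2)) - exp (- (tri_var p V * t\<^sup>2 / 2)) = exp (- (L * t\<^sup>2 / 2)) * (1 - exp (- d))"
        by (simp add: d_def right_diff_distrib flip: exp_add)
      moreover have "0 \<le> \<dots>" using d by simp
      moreover have "\<dots> \<le> 1 * d"
        using d L exp_ge_add_one_self[of "- d"] by (intro mult_mono) auto
      ultimately show ?thesis unfolding d_def[symmetric] by (simp only: abs_of_nonneg mult_1)
    qed
    also have "\<dots> = (tri_var p V - L) * t\<^sup>2 / 2" by (simp add: algebra_simps)
    also have "\<dots> \<le> (16 * ?n ^ 3) * t\<^sup>2 / 2"
      using tri_var_bounds(2)[OF V] by (intro divide_right_mono mult_right_mono) (auto simp: L_def k_def)
    finally show ?thesis by simp
  qed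
  show ?thesis
    using 1 2 3 norm_triangle_ineq unfolding eq[unfolded m_def]
    by (smt (verit, best))
qed

end

section \<open>Fourier inversion for the point probabilities\<close>

lemma cos_int_integral:
  fixes j :: int
  shows "has_bochner_integral lborel (\<lambda>t. cos (t * of_int j) * indicator {-pi..pi} t) (if j = 0 then 2 * pi else 0)"
proof (cases "j = 0")
  case True
  have "has_bochner_integral lborel (\<lambda>t. (\<lambda>_. 1) t * indicator {-pi..pi} t) (pi - (- pi))"
    by (rule has_bochner_integral_FTC_Icc_real[where F = "\<lambda>x. x"])
      (auto intro!: derivative_eq_intros continuous_intros)
  then show ?thesis using True by simp
next
  case False
  have "has_bochner_integral lborel (\<lambda>t. cos (t * of_int j) * indicator {-pi..pi} t)
     (sin (pi * of_int j) / of_int j - sin (- pi * of_int j) / of_int j)"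
    using False
    by (intro has_bochner_integral_FTC_Icc_real[where F = "\<lambda>t. sin (t * of_int j) / of_int j"])
      (auto intro!: derivative_eq_intros continuous_intros)
  then show ?thesis using False by simp
qed

lemma std_normal_cos_integral:
  "has_bochner_integral lborel (\<lambda>x. std_normal_density x * cos (c * x)) (exp (- (c\<^sup>2) / 2))"
proof -
  have int: "integrable lborel (\<lambda>x. std_normal_density x *\<^sub>R iexp (c * x))"
  proof (rule Bochner_Integration.integrable_bound)
    show "integrable lborel std_normal_density" by simp
    show "AE x in lborel. norm (std_normal_density x *\<^sub>R iexp (c * x)) \<le> norm (std_normal_density x)"
      by simp
  qed measurable
  have "char std_normal_distribution c = (LINT x|lborel. std_normal_density x *\<^sub>R iexp (c * x))"
    unfolding char_def by (subst integral_density) auto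
  then have "has_bochner_integral lborel (\<lambda>x. std_normal_density x *\<^sub>R iexp (c * x)) (complex_of_real (exp (- (c\<^sup>2) / 2)))"
    using int unfolding char_std_normal_distribution by (simp add: has_bochner_integral_iff)
  from has_bochner_integral_Re[OF this] show ?thesis by (simp add: Re_exp)
qed

lemma gaussian_cos_integral:
  assumes "0 < s"
  shows "has_bochner_integral lborel (\<lambda>t. cos (t * y) * exp (- (s\<^sup>2 * t\<^sup>2 / 2))) (2 * pi / s * std_normal_density (y / s))"
proof -
  have "has_bochner_integral lborel (\<lambda>t. std_normal_density (0 + s * t) * cos ((y / s) * (0 + s * t)))
      (exp (- ((y / s)\<^sup>2) / 2) /\<^sub>R \<bar>s\<bar>)"
    using std_normal_cos_integral[of "y / s"] assms
    by (subst lborel_has_bochner_integral_real_affine_iff[of s, symmetric]) auto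
  then have "has_bochner_integral lborel (\<lambda>t. sqrt (2 * pi) * (std_normal_density (0 + s * t) * cos ((y / s) * (0 + s * t))))
      (sqrt (2 * pi) * (exp (- ((y / s)\<^sup>2) / 2) /\<^sub>R \<bar>s\<bar>))"
    by (rule has_bochner_integral_mult_right)
  moreover have "(\<lambda>t. sqrt (2 * pi) * (std_normal_density (0 + s * t) * cos ((y / s) * (0 + s * t))))
     = (\<lambda>t. cos (t * y) * exp (- (s\<^sup>2 * t\<^sup>2 / 2)))"
    using assms by (auto simp: std_normal_density_def power_mult_distrib mult_ac)
  moreover have "sqrt (2 * pi) * (exp (- ((y / s)\<^sup>2) / 2) /\<^sub>R \<bar>s\<bar>) = 2 * pi / s * std_normal_density (y / s)"
  proof -
    have "sqrt (2 * pi) = 2 * pi / sqrt (2 * pi)" by (simp add: real_div_sqrt)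
    then show ?thesis using assms by (simp add: std_normal_density_def field_simps)
  qed
  ultimately show ?thesis by simp
qed

lemma Re_bern_exp: "Re (bern_exp p A g) = bern_exp p A (\<lambda>X. Re (g X))"
  by (simp add: bern_exp_def)

lemma has_bochner_integral_bern_exp:
  fixes f :: "'a set \<Rightarrow> 'b \<Rightarrow> real"
  assumes "\<And>X. has_bochner_integral M (f X) (I X)"
  shows "has_bochner_integral M (\<lambda>t. bern_exp p A (\<lambda>X. f X t)) (bern_exp p A I)"
  unfolding bern_exp_def
  by (intro has_bochner_integral_sum has_bochner_integral_scaleR_right assms)

context
  fixes p :: real and V :: "'a set"
  assumes p: "0 < p" "p < 1" and V: "finite V"
begin

text \<open>The point probability is an integral over one period and the Gaussian density an
  integral over the whole line, so beyond \<open>pi\<close> only the Gaussian contributes. Both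
  being real, cosines replace complex exponentials, and \<open>H\<close> dominates the difference of
  the integrands.\<close>

lemma tri_point_prob_error:
  fixes k :: int and H :: "real \<Rightarrow> real"
  assumes s: "0 < s" and H: "integrable lborel H"
    and centre: "\<And>t. \<bar>t\<bar> \<le> pi \<Longrightarrow> norm (iexp (- (t * tri_mean p V)) * tri_char p V t - exp (- (s\<^sup>2 * t\<^sup>2 / 2))) \<le> H t"
    and tail: "\<And>t. pi < \<bar>t\<bar> \<Longrightarrow> exp (- (s\<^sup>2 * t\<^sup>2 / 2)) \<le> H t"
  shows "\<bar>bern_exp p (pairs V) (\<lambda>X. of_bool (int (tri_count V X) = k))
      - 1 / s * std_normal_density ((of_int k - tri_mean p V) / s)\<bar> \<le> integral\<^sup>L lborel H / (2 * pi)"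
proof -
  define y where "y = of_int k - tri_mean p V"
  define A where "A t = bern_exp p (pairs V) (\<lambda>X. cos (t * of_int (int (tri_count V X) - k)) * indicator {-pi..pi} t)" for t :: real
  define B where "B t = cos (t * y) * exp (- (s\<^sup>2 * t\<^sup>2 / 2))" for t
  let ?P = "bern_exp p (pairs V) (\<lambda>X. of_bool (int (tri_count V X) = k)) :: real"
  have "has_bochner_integral lborel A (bern_exp p (pairs V) (\<lambda>X. if int (tri_count V X) - k = 0 then 2 * pi else 0))"
    unfolding A_def by (intro has_bochner_integral_bern_exp cos_int_integral)
  also have "bern_exp p (pairs V) (\<lambda>X. if int (tri_count V X) - k = 0 then 2 * pi else 0) = 2 * pi * ?P"
    unfolding bern_exp_mult_left[symmetric] by (intro bern_exp_cong) auto
  finally have D: "has_bochner_integral lborel (\<lambda>t. A t - B t) (2 * pi * ?P - 2 * pi / s * std_normal_density (y / s))"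
    unfolding B_def by (intro has_bochner_integral_diff gaussian_cos_integral s)
  have le: "norm (A t - B t) \<le> H t" for t
  proof (cases "\<bar>t\<bar> \<le> pi")
    case True
    \<comment> \<open>Since \<open>y\<close> is measured from the mean, the two prefactors combine
      to the character at \<open>- k\<close>.\<close>
    have "iexp (- (t * tri_mean p V)) * tri_char p V t * iexp (- (t * y))
      = bern_exp p (pairs V) (\<lambda>X. iexp (t * of_int (int (tri_count V X) - k)))"
      unfolding tri_char_def bern_exp_mult_left[symmetric] bern_exp_mult_right[symmetric]
      by (intro bern_exp_cong refl) (simp add: y_def algebra_simps flip: exp_add)
    then have "A t = Re (iexp (- (t * tri_mean p V)) * tri_char p V t * iexp (- (t * y)))"
      unfolding A_def using True by (simp add: Re_bern_exp Re_exp indicator_def abs_le_iff)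
    moreover have "B t = Re (exp (- (s\<^sup>2 * t\<^sup>2 / 2)) * iexp (- (t * y)))"
      by (simp add: B_def Re_exp)
    ultimately have "A t - B t = Re ((iexp (- (t * tri_mean p V)) * tri_char p V t - exp (- (s\<^sup>2 * t\<^sup>2 / 2))) * iexp (- (t * y)))"
      by (simp only: left_diff_distrib minus_complex.simps)
    then have "norm (A t - B t) \<le> norm ((iexp (- (t * tri_mean p V)) * tri_char p V t - exp (- (s\<^sup>2 * t\<^sup>2 / 2))) * iexp (- (t * y)))"
      using abs_Re_le_cmod by (simp only: real_norm_def)
    then show ?thesis using centre[OF True] by (simp add: norm_mult)
  next
    case False
    then have "indicator {-pi..pi} t = (0 :: real)" by (auto simp: indicator_def)
    then have "A t = 0" unfolding A_def using V by simp
    moreover have "\<bar>B t\<bar> \<le> 1 * exp (- (s\<^sup>2 * t\<^sup>2 / 2))"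
      unfolding B_def abs_mult by (intro mult_mono) auto
    ultimately show ?thesis using tail[of t] False by simp
  qed
  have "\<bar>integral\<^sup>L lborel (\<lambda>t. A t - B t)\<bar> \<le> integral\<^sup>L lborel (\<lambda>t. norm (A t - B t))"
    using integral_norm_bound[of lborel "\<lambda>t. A t - B t"] by simp
  also have "\<dots> \<le> integral\<^sup>L lborel H"
    using D le H by (intro integral_mono integrable_norm) (auto simp: has_bochner_integral_iff)
  finally have "\<bar>2 * pi * ?P - 2 * pi / s * std_normal_density (y / s)\<bar> \<le> integral\<^sup>L lborel H"
    using D by (simp add: has_bochner_integral_iff)
  moreover have "2 * pi * ?P - 2 * pi / s * std_normal_density (y / s) = (2 * pi) * (?P - 1 / s * std_normal_density (y / s))"
    by (simp add: algebra_simps)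
  ultimately have "(2 * pi) * \<bar>?P - 1 / s * std_normal_density (y / s)\<bar> \<le> integral\<^sup>L lborel H"
    by (simp add: abs_mult)
  then show ?thesis unfolding y_def by (simp add: pos_le_divide_eq mult.commute)
qed

text \<open>The dominating function is a sum of constants on nested symmetric intervals plus a
  Gaussian. An interval of half-width \<open>T2\<close> contributes \<open>2 * T2 * B2\<close>, and
  the prefactor 1/(2 pi) absorbs the 2.\<close>

lemma tri_local_error:
  fixes k :: int
  assumes s: "0 < s" and T: "0 \<le> T1" "T1 \<le> T2" "T2 \<le> T3" "T3 \<le> T4" "T4 \<le> pi"
    and B0: "0 \<le> B1" "0 \<le> B2" "0 \<le> B3" "0 \<le> B4" "0 \<le> B5"
    and B1: "\<And>t. \<bar>t\<bar> \<le> T1 \<Longrightarrow> norm (iexp (- (t * tri_mean p V)) * tri_char p V t - exp (- (s\<^sup>2 * t\<^sup>2 / 2))) \<le> B1"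
    and B2: "\<And>t. T1 \<le> \<bar>t\<bar> \<Longrightarrow> \<bar>t\<bar> \<le> T2 \<Longrightarrow> norm (tri_char p V t) \<le> B2"
    and B3: "\<And>t. T2 \<le> \<bar>t\<bar> \<Longrightarrow> \<bar>t\<bar> \<le> T3 \<Longrightarrow> norm (tri_char p V t) \<le> B3"
    and B4: "\<And>t. T3 \<le> \<bar>t\<bar> \<Longrightarrow> \<bar>t\<bar> \<le> T4 \<Longrightarrow> norm (tri_char p V t) \<le> B4"
    and B5: "\<And>t. T4 \<le> \<bar>t\<bar> \<Longrightarrow> \<bar>t\<bar> \<le> pi \<Longrightarrow> norm (tri_char p V t) \<le> B5"
  shows "\<bar>bern_exp p (pairs V) (\<lambda>X. of_bool (int (tri_count V X) = k))
      - 1 / s * std_normal_density ((of_int k - tri_mean p V) / s)\<bar>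
    \<le> T1 * B1 + T2 * B2 + T3 * B3 + T4 * B4 + pi * B5 + exp (- (s\<^sup>2 * T1\<^sup>2 / 4)) / s"
proof -
  define E where "E = exp (- (s\<^sup>2 * T1\<^sup>2 / 4))"
  define g where "g t = exp (- (s\<^sup>2 * t\<^sup>2 / 4))" for t
  let ?i = "\<lambda>b. indicator {-b..b} :: real \<Rightarrow> real"
  define H where "H t = B1 * ?i T1 t + B2 * ?i T2 t + B3 * ?i T3 t + B4 * ?i T4 t + B5 * ?i pi t + E * g t" for t
  have ind: "has_bochner_integral lborel (?i b) (2 * b)" if "0 \<le> b" for b
    using that has_bochner_integral_real_indicator[of "{-b..b}" lborel] by simp
  have gauss: "has_bochner_integral lborel g (2 * sqrt pi / s)"
  proof -
    have eq: "2 * pi / (s / sqrt 2) * std_normal_density (0 / (s / sqrt 2)) = 2 * sqrt pi / s"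
      using s by (simp add: std_normal_density_def real_sqrt_mult field_simps flip: power2_eq_square)
    have "has_bochner_integral lborel g (2 * pi / (s / sqrt 2) * std_normal_density (0 / (s / sqrt 2)))"
      using gaussian_cos_integral[of "s / sqrt 2" 0] s by (simp add: g_def[abs_def] power_divide)
    then show ?thesis unfolding eq .
  qed
  have H: "has_bochner_integral lborel H (B1 * (2 * T1) + B2 * (2 * T2) + B3 * (2 * T3) + B4 * (2 * T4) + B5 * (2 * pi)
      + E * (2 * sqrt pi / s))"
    unfolding H_def using T
    by (intro has_bochner_integral_add has_bochner_integral_mult_right ind gauss) auto
  have g0: "0 \<le> E * g t" for t by (simp add: E_def g_def)
  \<comment> \<open>Half of the exponent is evaluated at \<open>T1\<close> and gives the small
    constant \<open>E\<close>; the other half stays integrable.\<close>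
  have tail: "exp (- (s\<^sup>2 * t\<^sup>2 / 2)) \<le> E * g t" if "T1 \<le> \<bar>t\<bar>" for t
  proof -
    have "T1\<^sup>2 \<le> t\<^sup>2" using that T power_mono[of T1 "\<bar>t\<bar>" 2] by simp
    then have "s\<^sup>2 * T1\<^sup>2 \<le> s\<^sup>2 * t\<^sup>2" by (intro mult_left_mono) auto
    then show ?thesis by (simp add: E_def g_def flip: exp_add)
  qed
  have "\<bar>bern_exp p (pairs V) (\<lambda>X. of_bool (int (tri_count V X) = k))
      - 1 / s * std_normal_density ((of_int k - tri_mean p V) / s)\<bar> \<le> integral\<^sup>L lborel H / (2 * pi)"
  proof (rule tri_point_prob_error[OF s])
    show "integrable lborel H" using H by (simp add: has_bochner_integral_iff)
    fix t :: real
    show "exp (- (s\<^sup>2 * t\<^sup>2 / 2)) \<le> H t" if "pi < \<bar>t\<bar>"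
      using tail[of t] that T B0 by (simp add: H_def indicator_def)
    assume t: "\<bar>t\<bar> \<le> pi"
    have i: "?i b t = 1" if "\<bar>t\<bar> \<le> b" for b using that by (auto simp: indicator_def)
    have nn: "0 \<le> B1 * ?i T1 t" "0 \<le> B2 * ?i T2 t" "0 \<le> B3 * ?i T3 t" "0 \<le> B4 * ?i T4 t" "0 \<le> B5 * ?i pi t"
      using B0 by auto
    show "norm (iexp (- (t * tri_mean p V)) * tri_char p V t - exp (- (s\<^sup>2 * t\<^sup>2 / 2))) \<le> H t"
    proof (cases "\<bar>t\<bar> \<le> T1")
      case True
      then show ?thesis using B1[OF True] i[OF True] nn g0[of t] unfolding H_def by simp
    next
      case False
      have "norm (iexp (- (t * tri_mean p V)) * tri_char p V t - exp (- (s\<^sup>2 * t\<^sup>2 / 2))) \<le> norm (tri_char p V t) + exp (- (s\<^sup>2 * t\<^sup>2 / 2))"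
        by (rule order.trans[OF norm_triangle_ineq4]) (simp add: norm_mult)
      moreover have "exp (- (s\<^sup>2 * t\<^sup>2 / 2)) \<le> E * g t" using tail False by simp
      moreover consider "\<bar>t\<bar> \<le> T2" | "T2 \<le> \<bar>t\<bar>" "\<bar>t\<bar> \<le> T3" | "T3 \<le> \<bar>t\<bar>" "\<bar>t\<bar> \<le> T4" | "T4 \<le> \<bar>t\<bar>" by linarith
      then have "norm (tri_char p V t) \<le> B1 * ?i T1 t + B2 * ?i T2 t + B3 * ?i T3 t + B4 * ?i T4 t + B5 * ?i pi t"
      proof cases
        case 1 then show ?thesis using B2[of t] False i[of T2] nn by simp
      next
        case 2 then show ?thesis using B3[of t] i[of T3] nn by simp
      next
        case 3 then show ?thesis using B4[of t] i[of T4] nn by simp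
      next
        case 4 then show ?thesis using B5[of t] t i[of pi] nn by simp
      qed
      ultimately show ?thesis unfolding H_def by linarith
    qed
  qed
  also have "integral\<^sup>L lborel H = 2 * (T1 * B1 + T2 * B2 + T3 * B3 + T4 * B4 + pi * B5) + E * (2 * sqrt pi / s)"
    using H by (simp add: has_bochner_integral_iff)
  also have "\<dots> / (2 * pi) \<le> T1 * B1 + T2 * B2 + T3 * B3 + T4 * B4 + pi * B5 + E / s"
  proof -
    define S where "S = T1 * B1 + T2 * B2 + T3 * B3 + T4 * B4 + pi * B5"
    have "0 \<le> S" using T B0 by (simp add: S_def)
    then have "S * 1 \<le> S * pi" using pi_gt3 by (intro mult_left_mono) auto
    then have "2 * S / (2 * pi) \<le> S" by (simp add: pos_divide_le_eq)
    moreover have "E * (2 * sqrt pi / s) / (2 * pi) \<le> E / s"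
    proof -
      have "sqrt pi \<le> pi" using pi_gt3 by (intro real_le_lsqrt) (auto simp: power2_eq_square)
      then have "sqrt pi * (E / s) \<le> pi * (E / s)" using s by (intro mult_right_mono) (auto simp: E_def)
      moreover have "E * (2 * sqrt pi / s) / (2 * pi) = sqrt pi * (E / s) / pi" by simp
      ultimately show ?thesis by (simp only: pos_divide_le_eq[OF pi_gt_zero] mult.commute)
    qed
    ultimately show ?thesis unfolding S_def by (simp only: add_divide_distrib)
  qed
  finally show ?thesis unfolding E_def by simp
qed

end

section \<open>Assembling the estimates\<close>

lemma vertex_pairs_eq: "vertex_pairs n = pairs {1..n}"
  by (simp add: vertex_pairs_def pairs_def)

lemma triangle_count_eq: "triangle_count n E = tri_count {1..n} E"
  unfolding triangle_count_def tri_count_def triples_def pairs_def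
  by (rule arg_cong[where f = card]) auto

text \<open>Each summand is the length of a range of \<open>t\<close> times the bound there; the last one is the
  Gaussian tail. The ranges end at \<open>T1\<close>, \<open>T2\<close>, \<open>T3\<close>, \<open>T4\<close> and \<open>pi\<close>; \<open>n powr 0.77\<close> and \<open>n powr 0.635\<close> are the block
  sizes, \<open>n powr 0.99\<close> and \<open>1\<close> the sizes of \<open>U\<close>.\<close>

definition local_err :: "real \<Rightarrow> nat \<Rightarrow> real" where
  "local_err p n = (let x = real n; T1 = x powr (-176/100); T2 = x powr (-1625/1000);
      T3 = x powr (-149/100); T4 = x powr (-99/100);
      c1 = p ^ 5 * (1 - p) / 4096; c2 = (p * (1 - p)) ^ 3 / 4608 in
    T1 * (4 * T1 * sqrt (x ^ 3) + x\<^sup>2 * (T1 * x) ^ 3 + 8 * T1\<^sup>2 * x ^ 3)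
    + T2 * (4 * T2 * sqrt ((x powr (77/100)) ^ 3) + exp (- (c1 * T1\<^sup>2 * (x powr (77/100))\<^sup>2 * x\<^sup>2)))
    + T3 * (4 * T3 * sqrt ((x powr (635/1000)) ^ 3) + exp (- (c1 * T2\<^sup>2 * (x powr (635/1000))\<^sup>2 * x\<^sup>2)))
    + T4 * exp (- (c2 * T3\<^sup>2 * x powr (99/100) * x\<^sup>2))
    + pi * exp (- (c2 * T4\<^sup>2 * 1 * x\<^sup>2))
    + exp (- (p ^ 5 * (1 - p) / 16 * x ^ 4 * T1\<^sup>2 / 4)))"

section \<open>The random graph as a product Bernoulli expectation\<close>

context
  fixes p :: real
  assumes p: "0 < p" "p < 1"
begin

text \<open>Functions in the support are \<open>False\<close> outside \<open>vertex_pairs n\<close>,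
  so each is determined by its edge set and the point mass is a product over the pairs.\<close>

lemma pmf_erdos_renyi:
  assumes "X \<subseteq> vertex_pairs n"
  shows "pmf (erdos_renyi n p) X = p ^ card X * (1 - p) ^ card (vertex_pairs n - X)"
proof -
  let ?A = "vertex_pairs n" and ?f = "\<lambda>e. e \<in> X"
  let ?M = "Pi_pmf ?A False (\<lambda>_. bernoulli_pmf p)"
  have fin: "finite ?A" by (simp add: vertex_pairs_eq)
  have set: "set_pmf ?M = {f. \<forall>e. e \<notin> ?A \<longrightarrow> \<not> f e}"
    using p fin by (auto simp: set_Pi_pmf PiE_dflt_def)
  have "pmf (erdos_renyi n p) {e \<in> ?A. ?f e} = pmf ?M ?f"
    unfolding erdos_renyi_def
  proof (rule pmf_map_inj)
    show "inj_on (\<lambda>f. {e \<in> ?A. f e}) (set_pmf ?M)"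
      unfolding set by (intro inj_onI ext) blast
  qed (use assms set in auto)
  also have "{e \<in> ?A. ?f e} = X" using assms by auto
  also have "pmf ?M ?f = (\<Prod>e\<in>?A. pmf (bernoulli_pmf p) (e \<in> X))"
    using assms fin by (intro pmf_Pi') auto
  also have "\<dots> = (\<Prod>e\<in>X. pmf (bernoulli_pmf p) (e \<in> X)) * (\<Prod>e\<in>?A - X. pmf (bernoulli_pmf p) (e \<in> X))"
    using prod.subset_diff[OF assms fin] by (simp only: mult.commute)
  also have "\<dots> = p ^ card X * (1 - p) ^ card (?A - X)"
    using p by simp
  finally show ?thesis .
qed

lemma expectation_erdos_renyi:
  fixes g :: "nat set set \<Rightarrow> real"
  shows "measure_pmf.expectation (erdos_renyi n p) g = bern_exp p (pairs {1..n}) g"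
proof -
  have "measure_pmf.expectation (erdos_renyi n p) g = (\<Sum>X\<in>Pow (vertex_pairs n). pmf (erdos_renyi n p) X *\<^sub>R g X)"
    by (rule integral_measure_pmf) (auto simp: vertex_pairs_eq erdos_renyi_def)
  also have "\<dots> = bern_exp p (pairs {1..n}) g"
    unfolding bern_exp_def vertex_pairs_eq[symmetric] by (intro sum.cong refl) (simp add: pmf_erdos_renyi)
  finally show ?thesis .
qed

lemma prob_erdos_renyi: "measure_pmf.prob (erdos_renyi n p) {E. P E} = bern_exp p (pairs {1..n}) (\<lambda>E. of_bool (P E))"
proof -
  have "measure_pmf.prob (erdos_renyi n p) {E. P E} = measure_pmf.expectation (erdos_renyi n p) (indicator {E. P E})"
    by simp
  also have "\<dots> = bern_exp p (pairs {1..n}) (\<lambda>E. of_bool (P E))"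
    unfolding expectation_erdos_renyi by (intro bern_exp_cong) (auto simp: indicator_def)
  finally show ?thesis .
qed

lemma triangle_sd_eq: "triangle_sd n p = sqrt (tri_var p {1..n})"
  unfolding triangle_sd_def expectation_erdos_renyi triangle_count_eq tri_var_def
  by (simp add: tri_count_mean)

section \<open>The bounds with real-valued sizes\<close>

lemma floor_halves:
  fixes y :: real
  assumes "1 \<le> y"
  shows "1 \<le> nat \<lfloor>y\<rfloor>" "y / 2 \<le> real (nat \<lfloor>y\<rfloor>)" "real (nat \<lfloor>y\<rfloor>) \<le> y"
proof -
  have "1 \<le> \<lfloor>y\<rfloor>" using assms by (simp add: le_floor_iff)
  then have "real (nat \<lfloor>y\<rfloor>) = real_of_int \<lfloor>y\<rfloor>" "1 \<le> real_of_int \<lfloor>y\<rfloor>" by auto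
  moreover have "y < real_of_int \<lfloor>y\<rfloor> + 1" by linarith
  ultimately show "1 \<le> nat \<lfloor>y\<rfloor>" "y / 2 \<le> real (nat \<lfloor>y\<rfloor>)" "real (nat \<lfloor>y\<rfloor>) \<le> y" by linarith+
qed

text \<open>Rounding down keeps at least half of \<open>y\<close>, and at least half of the vertices
  lie outside the block. The resulting factor 16 turns 256 into 4096.\<close>

lemma tri_char_block_range:
  fixes y :: real
  assumes y: "2 \<le> y" "y \<le> real n / 2" and T: "0 \<le> T" "T \<le> \<bar>t\<bar>" "\<bar>t\<bar> \<le> T'"
    and c: "T\<^sup>2 * y\<^sup>2 * real n \<le> 1" "T' * real n \<le> 1"
  shows "norm (tri_char p {1..n} t) \<le> 4 * T' * sqrt (y ^ 3) + exp (- (p ^ 5 * (1 - p) / 4096 * T\<^sup>2 * y\<^sup>2 * (real n)\<^sup>2))"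
proof -
  define D where "D = nat \<lfloor>y\<rfloor>"
  have D: "y / 2 \<le> real D" "real D \<le> y" using floor_halves[of y] y by (auto simp: D_def)
  have D2: "2 \<le> D" using y by (simp add: D_def le_nat_iff le_floor_iff)
  have Dn: "D \<le> n" using D y by linarith
  have un: "{1..n} = {1..D} \<union> {D + 1..n}" using Dn by auto
  have K: "real (card {D + 1..n}) = real n - real D" using Dn by (simp add: of_nat_diff)
  have "norm (tri_char p ({1..D} \<union> {D + 1..n}) t) \<le> \<bar>t\<bar> * (4 * sqrt (real (card {1..D}) ^ 3))
    + exp (- (p ^ 5 * (1 - p) / 256 * T\<^sup>2 * (real (card {1..D}))\<^sup>2 * (real (card {D + 1..n}))\<^sup>2))"
  proof (rule tri_char_block_bound[OF p])
    show "T\<^sup>2 \<le> t\<^sup>2" using power_mono[OF T(2,1), of 2] by simp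
    have "T\<^sup>2 * (real (card {1..D}))\<^sup>2 * real (card {D + 1..n}) \<le> T\<^sup>2 * y\<^sup>2 * real n"
      unfolding K using D Dn T by (intro mult_mono power_mono) auto
    then show "T\<^sup>2 * (real (card {1..D}))\<^sup>2 * real (card {D + 1..n}) \<le> 1" using c by simp
    have "\<bar>t\<bar> * real n \<le> T' * real n" using T by (intro mult_right_mono) auto
    then show "\<bar>t\<bar> * (real (card {1..D}) + real (card {D + 1..n})) \<le> pi"
      unfolding K using c pi_gt3 by simp
  qed (use D2 in auto)
  also have "\<dots> \<le> 4 * T' * sqrt (y ^ 3) + exp (- (p ^ 5 * (1 - p) / 4096 * T\<^sup>2 * y\<^sup>2 * (real n)\<^sup>2))"
  proof (intro add_mono)
    have "\<bar>t\<bar> * (4 * sqrt (real (card {1..D}) ^ 3)) \<le> T' * (4 * sqrt (y ^ 3))"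
      using T D by (intro mult_mono real_sqrt_le_mono power_mono) auto
    then show "\<bar>t\<bar> * (4 * sqrt (real (card {1..D}) ^ 3)) \<le> 4 * T' * sqrt (y ^ 3)" by simp
    have "p ^ 5 * (1 - p) / 256 * T\<^sup>2 * (y / 2)\<^sup>2 * (real n / 2)\<^sup>2
        \<le> p ^ 5 * (1 - p) / 256 * T\<^sup>2 * (real (card {1..D}))\<^sup>2 * (real (card {D + 1..n}))\<^sup>2"
      unfolding K using D y p T by (intro mult_mono power_mono mult_nonneg_nonneg) auto
    then show "exp (- (p ^ 5 * (1 - p) / 256 * T\<^sup>2 * (real (card {1..D}))\<^sup>2 * (real (card {D + 1..n}))\<^sup>2))
       \<le> exp (- (p ^ 5 * (1 - p) / 4096 * T\<^sup>2 * y\<^sup>2 * (real n)\<^sup>2))"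
      by (simp add: power_divide)
  qed
  finally show ?thesis unfolding un .
qed

text \<open>Here \<open>U\<close> has about \<open>y\<close> vertices, and \<open>W\<close> and
  \<open>Z\<close> have \<open>n div 3\<close> each, which is at least n/6. The constant is 32 * 2 *
  6 * 6, doubled by taking the square root.\<close>

lemma tri_char_tripartite_range:
  fixes y :: real
  assumes y: "1 \<le> y" "y \<le> real n / 3" and T: "0 \<le> T" "T \<le> \<bar>t\<bar>" "\<bar>t\<bar> * y \<le> pi"
    and c: "T\<^sup>2 * y\<^sup>2 * real n \<le> 1" and n: "4 \<le> n"
  shows "norm (tri_char p {1..n} t) \<le> exp (- ((p * (1 - p)) ^ 3 / 4608 * T\<^sup>2 * y * (real n)\<^sup>2))"
proof -
  define m where "m = nat \<lfloor>y\<rfloor>"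
  define M where "M = n div 3"
  have m: "1 \<le> m" "y / 2 \<le> real m" "real m \<le> y" using floor_halves[OF y(1)] by (auto simp: m_def)
  have "real (3 * m) \<le> real n" using m y by simp
  then have mM: "m \<le> M" unfolding of_nat_le_iff M_def by linarith
  have "n \<le> 6 * M" using n unfolding M_def by linarith
  then have M: "real n / 6 \<le> real M" by simp
  have M3: "3 * M \<le> n" unfolding M_def by simp
  then have Mn: "real M \<le> real n" by simp
  let ?U = "{1..m}" and ?W = "{m + 1..m + M}" and ?Z = "{m + M + 1..m + 2 * M}"
  have "(norm (tri_char p {1..n} t))\<^sup>2
      \<le> exp (- ((p * (1 - p)) ^ 3 / 32 * T\<^sup>2 * real (card ?U) * real (card ?W) * real (card ?Z)))"
  proof (rule tri_char_tripartite_bound[OF p])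
    show "T\<^sup>2 \<le> t\<^sup>2" using power_mono[OF T(2,1), of 2] by simp
    have "T\<^sup>2 * real M * (real m)\<^sup>2 \<le> T\<^sup>2 * real n * y\<^sup>2"
      using m Mn T by (intro mult_mono power_mono) auto
    then show "T\<^sup>2 * real (card ?W) * (real (card ?U))\<^sup>2 \<le> 1" using c by (simp add: mult_ac)
    have "1 \<le> y\<^sup>2" using y by simp
    then have "T\<^sup>2 * 1 * real M \<le> T\<^sup>2 * y\<^sup>2 * real n"
      using Mn by (intro mult_mono) auto
    then show "T\<^sup>2 * real (card ?Z) \<le> 1" using c by simp
    have "\<bar>t\<bar> * real m \<le> \<bar>t\<bar> * y" using m by (intro mult_left_mono) auto
    then show "\<bar>t\<bar> * real (card ?U) \<le> pi" using T by simp
  qed (use mM M3 in auto)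
  also have "\<dots> \<le> exp (- ((p * (1 - p)) ^ 3 / 32 * T\<^sup>2 * (y / 2) * (real n / 6) * (real n / 6)))"
  proof -
    have "(p * (1 - p)) ^ 3 / 32 * T\<^sup>2 * (y / 2) * (real n / 6) * (real n / 6)
       \<le> (p * (1 - p)) ^ 3 / 32 * T\<^sup>2 * real m * real M * real M"
      using m M p y by (intro mult_mono mult_nonneg_nonneg) auto
    then show ?thesis by simp
  qed
  also have "\<dots> = (exp (- ((p * (1 - p)) ^ 3 / 4608 * T\<^sup>2 * y * (real n)\<^sup>2)))\<^sup>2"
    by (simp add: power2_eq_square flip: exp_add)
  finally show ?thesis by (rule power2_le_imp_le) simp
qed

lemma tri_var_asymptotics:
  assumes "4 \<le> n"
  shows "p ^ 5 * (1 - p) / 16 * real n ^ 4 \<le> tri_var p {1..n}" "tri_var p {1..n} \<le> 17 * real n ^ 4"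
proof -
  let ?L = "(real (card {1..n} - 2) * p\<^sup>2)\<^sup>2 * (p * (1 - p) * real (card {1..n} choose 2))"
  have n: "real n / 2 \<le> real (n - 2)" "real (n - 2) \<le> real n" using assms by auto
  have "real n * (real n / 2) \<le> real n * (real n - 1)"
    using assms by (intro mult_left_mono) auto
  then have ch: "(real n)\<^sup>2 / 4 \<le> real (n choose 2)" by (simp add: real_choose_two power2_eq_square)
  have "(real n / 2 * p\<^sup>2)\<^sup>2 * (p * (1 - p) * ((real n)\<^sup>2 / 4)) \<le> ?L"
    using n ch p by (auto intro!: mult_mono power_mono mult_nonneg_nonneg)
  also have "?L \<le> tri_var p {1..n}" by (rule tri_var_bounds[OF p]) simp
  finally show "p ^ 5 * (1 - p) / 16 * real n ^ 4 \<le> tri_var p {1..n}"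
    by (simp add: eval_nat_numeral field_simps)
  have "p * (1 - p) \<le> 1" using p by (intro mult_le_one) auto
  then have "(real (n - 2) * p\<^sup>2)\<^sup>2 * (p * (1 - p) * real (n choose 2)) \<le> (real n * 1)\<^sup>2 * (1 * (real n)\<^sup>2)"
    using n p real_choose_two_le[of n] by (intro mult_mono power_mono mult_nonneg_nonneg) (auto simp: power_le_one)
  then have "?L \<le> (real n * 1)\<^sup>2 * (1 * (real n)\<^sup>2)" by simp
  moreover have "real n ^ 3 \<le> real n ^ 4" using assms by (intro power_increasing) auto
  moreover have "tri_var p {1..n} \<le> ?L + 16 * real n ^ 3"
    using tri_var_bounds(2)[OF p, of "{1..n}"] by simp
  ultimately show "tri_var p {1..n} \<le> 17 * real n ^ 4" by (simp add: eval_nat_numeral)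
qed

text \<open>After multiplication by n^2, the largest polynomial terms have exponents -0.02
  (central), -0.095 and -0.0275 (blocks). The exponentials decay in n^0.02 (both blocks), n^0.01,
  n^0.02 and n^0.48. One block size could not cover both block ranges: decay at n^-1.76 needs size
  above n^0.76, the remainder at n^-1.49 needs size below about n^0.653.\<close>

lemma local_err_tendsto: "(\<lambda>n. (real n)\<^sup>2 * local_err p n) \<longlonglongrightarrow> 0"
proof -
  define c1 c2 c3 where "c1 = p ^ 5 * (1 - p) / 4096" and "c2 = (p * (1 - p)) ^ 3 / 4608" and "c3 = p ^ 5 * (1 - p) / 16"
  have c: "0 < c1" "0 < c2" "0 < c3" using p by (auto simp: c1_def c2_def c3_def)
  have "(\<lambda>n. (real n)\<^sup>2 * (real n powr (-176/100) * (4 * real n powr (-176/100) * sqrt (real n ^ 3)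
      + (real n)\<^sup>2 * (real n powr (-176/100) * real n) ^ 3 + 8 * (real n powr (-176/100))\<^sup>2 * real n ^ 3))) \<longlonglongrightarrow> 0"
    by real_asymp
  moreover have "(\<lambda>n. (real n)\<^sup>2 * (real n powr (-1625/1000) * (4 * real n powr (-1625/1000) * sqrt ((real n powr (77/100)) ^ 3)
      + exp (- (c1 * (real n powr (-176/100))\<^sup>2 * (real n powr (77/100))\<^sup>2 * (real n)\<^sup>2))))) \<longlonglongrightarrow> 0"
    using c by real_asymp
  moreover have "(\<lambda>n. (real n)\<^sup>2 * (real n powr (-149/100) * (4 * real n powr (-149/100) * sqrt ((real n powr (635/1000)) ^ 3)
      + exp (- (c1 * (real n powr (-1625/1000))\<^sup>2 * (real n powr (635/1000))\<^sup>2 * (real n)\<^sup>2))))) \<longlonglongrightarrow> 0"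
    using c by real_asymp
  moreover have "(\<lambda>n. (real n)\<^sup>2 * (real n powr (-99/100) * exp (- (c2 * (real n powr (-149/100))\<^sup>2 * real n powr (99/100) * (real n)\<^sup>2)))) \<longlonglongrightarrow> 0"
    using c by real_asymp
  moreover have "(\<lambda>n. (real n)\<^sup>2 * (pi * exp (- (c2 * (real n powr (-99/100))\<^sup>2 * 1 * (real n)\<^sup>2)))) \<longlonglongrightarrow> 0"
    using c by real_asymp
  moreover have "(\<lambda>n. (real n)\<^sup>2 * exp (- (c3 * real n ^ 4 * (real n powr (-176/100))\<^sup>2 / 4))) \<longlonglongrightarrow> 0"
    using c by real_asymp
  ultimately have "(\<lambda>n. (real n)\<^sup>2 * local_err p n) \<longlonglongrightarrow> 0 + 0 + 0 + 0 + 0 + 0"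
    unfolding local_err_def Let_def c1_def c2_def c3_def distrib_left[of "(_::real)\<^sup>2"]
    by (intro tendsto_add)
  then show ?thesis by simp
qed

text \<open>For large \<open>n\<close> the block sizes and set sizes fit into the vertex set and the
  standard deviation is at least 1; then the bounds on the five ranges combine.\<close>

lemma local_error_eventually:
  "eventually (\<lambda>n. 0 < triangle_sd n p \<and> triangle_sd n p \<le> 5 * (real n)\<^sup>2 \<and>
     (\<forall>k::int. \<bar>measure_pmf.prob (erdos_renyi n p) {E. int (triangle_count n E) = k}
       - 1 / triangle_sd n p * std_normal_density (standardize n p (of_int k))\<bar> \<le> local_err p n)) sequentially"
proof -
  define c3 where "c3 = p ^ 5 * (1 - p) / 16"
  have c3: "0 < c3" using p by (simp add: c3_def)
  have "eventually (\<lambda>n. 1 \<le> c3 * real n ^ 4) sequentially" using c3 by real_asymp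
  moreover have "eventually (\<lambda>n. 2 \<le> real n powr (77/100) \<and> 2 \<le> real n powr (635/1000) \<and> 1 \<le> real n powr (99/100)) sequentially"
    by (intro eventually_conj; real_asymp)
  moreover have "eventually (\<lambda>n. real n powr (77/100) \<le> real n / 2 \<and> real n powr (635/1000) \<le> real n / 2 \<and> real n powr (99/100) \<le> real n / 3) sequentially"
    by (intro eventually_conj; real_asymp)
  ultimately show ?thesis using eventually_ge_at_top[of 4]
  proof eventually_elim
    case (elim n)
    define x T1 T2 T3 T4 where "x = real n" and "T1 = x powr (-176/100)" and "T2 = x powr (-1625/1000)"
      and "T3 = x powr (-149/100)" and "T4 = x powr (-99/100)"
    define y1 y2 y3 where "y1 = x powr (77/100)" and "y2 = x powr (635/1000)" and "y3 = x powr (99/100)"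
    define c1 c2 where "c1 = p ^ 5 * (1 - p) / 4096" and "c2 = (p * (1 - p)) ^ 3 / 4608"
    define s where "s = triangle_sd n p"
    have x: "1 \<le> x" "4 \<le> n" using elim by (auto simp: x_def)
    then have x0: "0 < x" by simp
    have "0 \<le> p ^ 5 * (1 - p) / 16 * real n ^ 4" using p by simp
    then have "0 \<le> tri_var p {1..n}" using tri_var_asymptotics(1)[OF x(2)] by linarith
    then have s2: "s\<^sup>2 = tri_var p {1..n}" "0 \<le> s" by (simp_all add: s_def triangle_sd_eq)
    have s2_ge: "c3 * x ^ 4 \<le> s\<^sup>2" and s2_le: "s\<^sup>2 \<le> 17 * x ^ 4"
      using tri_var_asymptotics[OF x(2)] by (auto simp: s2 c3_def x_def)
    have "1\<^sup>2 \<le> s\<^sup>2" using s2_ge elim by (simp add: x_def)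
    then have s1: "1 \<le> s" using s2(2) by (rule power2_le_imp_le)
    have "s\<^sup>2 \<le> (5 * x\<^sup>2)\<^sup>2" using order.trans[OF s2_le, of "25 * x ^ 4"] by (simp add: power_mult_distrib)
    then have s5: "s \<le> 5 * x\<^sup>2" by (rule power2_le_imp_le) simp
    have le: "x powr a \<le> x powr b" if "a \<le> b" for a b using that x by (intro powr_mono) auto
    have one: "x powr a \<le> 1" if "a \<le> 0" for a using le[OF that] x by simp
    have T: "0 \<le> T1" "T1 \<le> T2" "T2 \<le> T3" "T3 \<le> T4" "T4 \<le> pi"
      using one[of "-99/100"] pi_gt3 by (auto simp: T1_def T2_def T3_def T4_def intro!: le)
    have pw: "(x powr a)\<^sup>2 = x powr (2 * a)" for a
      by (simp only: power2_eq_square mult_2 powr_add)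
    have px: "x powr a * x = x powr (a + 1)" for a using x0 by (simp add: powr_add)
    \<comment> \<open>The side conditions of the range lemmas, checked on exponents. Those for
      \<open>T4 * y3\<close> and \<open>T3\<^sup>2 * y3\<^sup>2 * x\<close> hold with exponent
      exactly 0.\<close>
    have bd: "T1 * x \<le> 1" "T2 * x \<le> 1" "T3 * x \<le> 1" "T4 * y3 \<le> 1"
      "T1\<^sup>2 * y1\<^sup>2 * x \<le> 1" "T2\<^sup>2 * y2\<^sup>2 * x \<le> 1" "T3\<^sup>2 * y3\<^sup>2 * x \<le> 1" "T4\<^sup>2 * 1\<^sup>2 * x \<le> 1"
      unfolding T1_def T2_def T3_def T4_def y1_def y2_def y3_def pw power_one mult_1_right powr_add[symmetric] px
      by (rule one, simp)+
    have main: "\<bar>bern_exp p (pairs {1..n}) (\<lambda>X. of_bool (int (tri_count {1..n} X) = k))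
        - 1 / s * std_normal_density ((of_int k - tri_mean p {1..n}) / s)\<bar>
      \<le> T1 * (4 * T1 * sqrt (x ^ 3) + x\<^sup>2 * (T1 * x) ^ 3 + 8 * T1\<^sup>2 * x ^ 3)
        + T2 * (4 * T2 * sqrt (y1 ^ 3) + exp (- (c1 * T1\<^sup>2 * y1\<^sup>2 * x\<^sup>2)))
        + T3 * (4 * T3 * sqrt (y2 ^ 3) + exp (- (c1 * T2\<^sup>2 * y2\<^sup>2 * x\<^sup>2)))
        + T4 * exp (- (c2 * T3\<^sup>2 * y3 * x\<^sup>2))
        + pi * exp (- (c2 * T4\<^sup>2 * 1 * x\<^sup>2))
        + exp (- (s\<^sup>2 * T1\<^sup>2 / 4)) / s" for k :: int
    proof (rule tri_local_error[OF p])
      fix t :: real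
      show "norm (iexp (- (t * tri_mean p {1..n})) * tri_char p {1..n} t - exp (- (s\<^sup>2 * t\<^sup>2 / 2)))
         \<le> 4 * T1 * sqrt (x ^ 3) + x\<^sup>2 * (T1 * x) ^ 3 + 8 * T1\<^sup>2 * x ^ 3" if t: "\<bar>t\<bar> \<le> T1"
      proof -
        have tx: "\<bar>t\<bar> * x \<le> T1 * x" using t x0 by (intro mult_right_mono) auto
        have t2: "t\<^sup>2 \<le> T1\<^sup>2" using power_mono[OF t, of 2] by simp
        have "norm (iexp (- (t * tri_mean p {1..n})) * tri_char p {1..n} t - exp (- (s\<^sup>2 * t\<^sup>2 / 2)))
          \<le> 4 * \<bar>t\<bar> * sqrt (x ^ 3) + x\<^sup>2 * (\<bar>t\<bar> * x) ^ 3 + 8 * t\<^sup>2 * x ^ 3"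
          using tri_char_central[OF p, of "{1..n}" t] tx bd(1)
          by (simp add: x_def tri_mean_def s2(1))
        also have "\<dots> \<le> 4 * T1 * sqrt (x ^ 3) + x\<^sup>2 * (T1 * x) ^ 3 + 8 * T1\<^sup>2 * x ^ 3"
          using x0 by (intro add_mono mult_right_mono mult_left_mono power_mono[OF tx] t t2) auto
        finally show ?thesis .
      qed
      show "norm (tri_char p {1..n} t) \<le> 4 * T2 * sqrt (y1 ^ 3) + exp (- (c1 * T1\<^sup>2 * y1\<^sup>2 * x\<^sup>2))"
        if "T1 \<le> \<bar>t\<bar>" "\<bar>t\<bar> \<le> T2"
        unfolding c1_def x_def
        by (rule tri_char_block_range) (use that T bd elim in \<open>auto simp: x_def y1_def\<close>)
      show "norm (tri_char p {1..n} t) \<le> 4 * T3 * sqrt (y2 ^ 3) + exp (- (c1 * T2\<^sup>2 * y2\<^sup>2 * x\<^sup>2))"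
        if "T2 \<le> \<bar>t\<bar>" "\<bar>t\<bar> \<le> T3"
        unfolding c1_def x_def
        by (rule tri_char_block_range) (use that T bd elim in \<open>auto simp: x_def y2_def\<close>)
      show "norm (tri_char p {1..n} t) \<le> exp (- (c2 * T3\<^sup>2 * y3 * x\<^sup>2))" if "T3 \<le> \<bar>t\<bar>" "\<bar>t\<bar> \<le> T4"
        unfolding c2_def x_def
      proof (rule tri_char_tripartite_range)
        have "\<bar>t\<bar> * y3 \<le> T4 * y3" using that by (intro mult_right_mono) (auto simp: y3_def)
        then show "\<bar>t\<bar> * y3 \<le> pi" using bd pi_gt3 by linarith
      qed (use that T bd elim in \<open>auto simp: x_def y3_def\<close>)
      \<comment> \<open>For t up to \<open>pi\<close> the set \<open>U\<close> must be a single
        vertex, that is \<open>y = 1\<close>, to keep the phases within one period.\<close>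
      show "norm (tri_char p {1..n} t) \<le> exp (- (c2 * T4\<^sup>2 * 1 * x\<^sup>2))" if "T4 \<le> \<bar>t\<bar>" "\<bar>t\<bar> \<le> pi"
        unfolding c2_def x_def
        by (rule tri_char_tripartite_range) (use that T bd elim in \<open>auto simp: x_def\<close>)
    qed (use s1 T x0 in \<open>auto intro!: add_nonneg_nonneg mult_nonneg_nonneg simp: y1_def y2_def\<close>)
    have tail: "exp (- (s\<^sup>2 * T1\<^sup>2 / 4)) / s \<le> exp (- (c3 * x ^ 4 * T1\<^sup>2 / 4))"
    proof -
      have "exp (- (s\<^sup>2 * T1\<^sup>2 / 4)) / s \<le> exp (- (s\<^sup>2 * T1\<^sup>2 / 4)) / 1"
        using s1 by (intro divide_left_mono) auto
      also have "\<dots> \<le> exp (- (c3 * x ^ 4 * T1\<^sup>2 / 4))"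
        using mult_right_mono[OF s2_ge, of "T1\<^sup>2"] by simp
      finally show ?thesis .
    qed
    have "\<bar>measure_pmf.prob (erdos_renyi n p) {E. int (triangle_count n E) = k}
       - 1 / s * std_normal_density (standardize n p (of_int k))\<bar> \<le> local_err p n" for k :: int
    proof -
      have "standardize n p (of_int k) = (of_int k - tri_mean p {1..n}) / s"
        by (simp add: standardize_def tri_mean_def s_def)
      then have "\<bar>measure_pmf.prob (erdos_renyi n p) {E. int (triangle_count n E) = k}
         - 1 / s * std_normal_density (standardize n p (of_int k))\<bar>
        = \<bar>bern_exp p (pairs {1..n}) (\<lambda>X. of_bool (int (tri_count {1..n} X) = k))
        - 1 / s * std_normal_density ((of_int k - tri_mean p {1..n}) / s)\<bar>"
        by (simp only: prob_erdos_renyi triangle_count_eq)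
      also have "\<dots> \<le> local_err p n"
        using order.trans[OF main add_left_mono[OF tail]]
        by (simp only: local_err_def Let_def T1_def T2_def T3_def T4_def y1_def y2_def y3_def c1_def c2_def c3_def x_def)
      finally show ?thesis .
    qed
    then show ?case using s1 s5 by (simp add: s_def x_def)
  qed
qed

section \<open>From the local error to the two forms of the limit theorem\<close>

lemma standardized_prob_lattice:
  assumes "0 < triangle_sd n p"
  shows "standardized_prob n p (standardize n p (of_int k))
    = measure_pmf.prob (erdos_renyi n p) {E. int (triangle_count n E) = k}"
proof -
  have "standardize n p (real N) = standardize n p (of_int k) \<longleftrightarrow> int N = k" for N
  proof -
    have "standardize n p (real N) = standardize n p (of_int k) \<longleftrightarrow> real N = of_int k"
      using assms by (simp add: standardize_def)
    also have "\<dots> \<longleftrightarrow> int N = k" using of_int_eq_iff[of "int N" k, where 'a = real] by simp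
    finally show ?thesis .
  qed
  then show ?thesis by (simp add: standardized_prob_def)
qed

text \<open>Scaling the local error by the standard deviation, at most 5 n^2, is compensated by
  \<open>local_err\<close> being o(n^-2) uniformly in \<open>k\<close>.\<close>

lemma local_deviation_tendsto:
  "(\<lambda>n. SUP x\<in>triangle_lattice n p.
      \<bar>triangle_sd n p * standardized_prob n p x - std_normal_density x\<bar>) \<longlonglongrightarrow> 0"
proof (rule tendsto_sandwich)
  let ?d = "\<lambda>n x. \<bar>triangle_sd n p * standardized_prob n p x - std_normal_density x\<bar>"
  show "eventually (\<lambda>n. 0 \<le> (SUP x\<in>triangle_lattice n p. ?d n x)) sequentially"
  proof (intro always_eventually allI)
    fix n
    have "?d n (standardize n p (of_int 0)) \<le> (SUP x\<in>triangle_lattice n p. ?d n x)"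
      by (rule cSUP_upper[OF _ bdd_above_local_deviation]) (unfold triangle_lattice_def, rule rangeI)
    then show "0 \<le> (SUP x\<in>triangle_lattice n p. ?d n x)" by (rule order.trans[rotated]) simp
  qed
  show "eventually (\<lambda>n. (SUP x\<in>triangle_lattice n p. ?d n x) \<le> 5 * ((real n)\<^sup>2 * local_err p n)) sequentially"
    using local_error_eventually
  proof eventually_elim
    case (elim n)
    show ?case
    proof (rule cSUP_least)
      show "triangle_lattice n p \<noteq> {}" by (simp add: triangle_lattice_def)
      fix x assume "x \<in> triangle_lattice n p"
      then obtain k :: int where x: "x = standardize n p (of_int k)" by (auto simp: triangle_lattice_def)
      let ?D = "measure_pmf.prob (erdos_renyi n p) {E. int (triangle_count n E) = k} - 1 / triangle_sd n p * std_normal_density x"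
      have D: "\<bar>?D\<bar> \<le> local_err p n" using elim x by simp
      have "?d n x = \<bar>triangle_sd n p * ?D\<bar>"
        using elim unfolding x standardized_prob_lattice[OF conjunct1[OF elim]] by (simp add: right_diff_distrib)
      also have "\<dots> = triangle_sd n p * \<bar>?D\<bar>" using elim by (simp add: abs_mult)
      also have "\<dots> \<le> 5 * (real n)\<^sup>2 * local_err p n"
        using elim D by (intro mult_mono) auto
      finally show "?d n x \<le> 5 * ((real n)\<^sup>2 * local_err p n)" by simp
    qed
  qed
  show "(\<lambda>n. 5 * ((real n)\<^sup>2 * local_err p n)) \<longlonglongrightarrow> 0"
    using tendsto_mult_left[OF local_err_tendsto, of 5] by simp
qed simp

lemma point_prob_uniform:
  "\<exists>\<delta> :: nat \<Rightarrow> real. \<delta> \<in> o(\<lambda>n. 1 / real n ^ 2) \<and>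
    (\<forall>n. \<forall>k :: int.
       \<bar>measure_pmf.prob (erdos_renyi n p) {E. int (triangle_count n E) = k}
         - 1 / triangle_sd n p * std_normal_density (standardize n p (of_int k))\<bar> \<le> \<delta> n)"
proof -
  let ?e = "\<lambda>n k. \<bar>measure_pmf.prob (erdos_renyi n p) {E. int (triangle_count n E) = k}
         - 1 / triangle_sd n p * std_normal_density (standardize n p (of_int k))\<bar>"
  \<comment> \<open>The bound must hold for every \<open>n\<close>, so where
    \<open>local_err\<close> is not yet valid the trivial bound takes over. This happens for
    finitely many \<open>n\<close> only and leaves the rate unchanged; at standard deviation 0 the
    convention \<open>1 / 0 = 0\<close> keeps it true.\<close>
  define \<delta> where "\<delta> n = (if \<forall>k. ?e n k \<le> local_err p n then local_err p n else 1 + \<bar>1 / triangle_sd n p\<bar>)" for n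
  have "?e n k \<le> 1 + \<bar>1 / triangle_sd n p\<bar>" for n k
  proof -
    have "0 \<le> std_normal_density x" "std_normal_density x \<le> 1" for x
    proof -
      have "1 \<le> sqrt (2 * pi)" using pi_gt3 by (intro real_le_rsqrt) auto
      then have "1 / sqrt (2 * pi) * exp (- x\<^sup>2 / 2) \<le> 1 * 1" by (intro mult_mono) auto
      then show "std_normal_density x \<le> 1" by (simp add: std_normal_density_def)
    qed simp
    then have "\<bar>1 / triangle_sd n p * std_normal_density (standardize n p (of_int k))\<bar> \<le> \<bar>1 / triangle_sd n p\<bar> * 1"
      unfolding abs_mult by (intro mult_left_mono) (simp_all add: abs_le_iff)
    moreover have "\<bar>measure_pmf.prob (erdos_renyi n p) {E. int (triangle_count n E) = k}\<bar> \<le> 1" by simp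
    ultimately show ?thesis by linarith
  qed
  then have "\<forall>n k. ?e n k \<le> \<delta> n" by (simp add: \<delta>_def)
  moreover have "\<delta> \<in> o(\<lambda>n. 1 / real n ^ 2)"
  proof (rule smalloI_tendsto)
    have "eventually (\<lambda>n. (real n)\<^sup>2 * local_err p n = \<delta> n / (1 / real n ^ 2)) sequentially"
      using local_error_eventually by eventually_elim (simp add: \<delta>_def)
    with local_err_tendsto show "(\<lambda>n. \<delta> n / (1 / real n ^ 2)) \<longlonglongrightarrow> 0"
      by (rule Lim_transform_eventually)
    show "eventually (\<lambda>n. 1 / real n ^ 2 \<noteq> 0) sequentially"
      using eventually_gt_at_top[of 0] by eventually_elim simp
  qed
  ultimately show ?thesis by blast
qed

end

theorem theorem1:
  fixes p :: real
  assumes "0 < p" and "p < 1"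
  shows "(\<lambda>n. SUP x\<in>triangle_lattice n p.
            \<bar>triangle_sd n p * standardized_prob n p x - std_normal_density x\<bar>) \<longlonglongrightarrow> 0
       \<and> (\<exists>\<delta> :: nat \<Rightarrow> real. \<delta> \<in> o(\<lambda>n. 1 / real n ^ 2) \<and>
            (\<forall>n. \<forall>k :: int.
               \<bar>measure_pmf.prob (erdos_renyi n p) {E. int (triangle_count n E) = k}
                 - 1 / triangle_sd n p * std_normal_density (standardize n p (of_int k))\<bar> \<le> \<delta> n))"
  using local_deviation_tendsto[OF assms] point_prob_uniform[OF assms] by (rule conjI)

end
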